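(* Let $M^m$ and $N$ be closed manifolds, $(N,\gamma)$ Riemannian, let $(g(t),\phi(t))_{t\in[0,T)}$ be a solution of the $(RH)_\alpha$ flow with a non-increasing coupling function $\alpha(t)\ge0$, and let the sectional curvature of $N$ be bounded above by ${}^NK\le c_0$. Then: (i) If $N$ has non-positive sectional curvatures, or more generally if $c_0-\frac{\alpha(t)}{m}\le0$ (for all $t\in[0,T)$), the energy density of $\phi$ is bounded by its initial data: $$|\nabla\phi(x,t)|^2\le\max_{y\in M}|\nabla\phi(y,0)|^2,\qquad\forall(x,t)\in M\times[0,T).$$ (ii) If $N$ has non-positive sectional curvatures and $\alpha(t)\ge\underline{\alpha}>0$, then in addition $$|\nabla\phi(x,t)|^2\le\frac{m}{2\underline{\alpha}\,t},\qquad\forall(x,t)\in M\times(0,T).$$ (iii) In general, the energy density satisfies $$|\nabla\phi(x,t)|^2\le2\max_{y\in M}|\nabla\phi(y,0)|^2,\qquad\forall(x,t)\in M\times[0,T^* ),$$ where $T^*:=\min\big\{T,\big(4c_0\max_{y\in M}|\nabla\phi(y,0)|^2\big)^{-1}\big\}$ (with $T^*:=T$ if $c_0\max_{y\in M}|\nabla\phi(y,0)|^2\le 0$).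
   Context: $(g(t),\phi(t))_{t\in[0,T)}$, with $g(t)$ Riemannian metrics on $M$ and $\phi(t):M\to N$ smooth maps, solves $(RH)_\alpha$ with coupling function $\alpha(t)$ (smooth in $t$) if $$\partial_t g=-2\,\mathrm{Rc}+2\alpha\,\nabla\phi\otimes\nabla\phi,\qquad \partial_t\phi=\tau_g\phi ,$$ where $\mathrm{Rc}$ is the Ricci tensor of $g(t)$, $(\nabla\phi\otimes\nabla\phi)_{ij}=\langle\nabla_i\phi,\nabla_j\phi\rangle_\gamma$, and $\tau_g\phi=\mathrm{tr}_g\nabla d\phi$ is the tension field. $|\nabla\phi|^2=g^{ij}\langle\nabla_i\phi,\nabla_j\phi\rangle_\gamma$ (computed with $g(t)$ at time $t$), and $m=\dim M$. *)

theory Defs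
  imports "HOL-Analysis.Analysis"
begin

section \<open>Smooth functions on subsets of Euclidean space\<close>

text \<open>\<open>Ck_on k S f\<close> is meant for open \<open>S\<close> only.\<close>

primrec Ck_on :: "nat \<Rightarrow> 'e::euclidean_space set \<Rightarrow> ('e \<Rightarrow> 'f::real_normed_vector) \<Rightarrow> bool" where
  "Ck_on 0 S f \<longleftrightarrow> continuous_on S f"
| "Ck_on (Suc k) S f \<longleftrightarrow>
     f differentiable_on S \<and> (\<forall>b\<in>Basis. Ck_on k S (\<lambda>x. frechet_derivative f (at x) b))"

text \<open>On an arbitrary set, such as \<open>[0,T) \<times> U\<close>, a function is smooth if near every point of the
  set it extends to a \<open>C\<^sup>\<infinity>\<close> function on an open neighbourhood.\<close>

definition smooth_on :: "'e::euclidean_space set \<Rightarrow> ('e \<Rightarrow> 'f::real_normed_vector) \<Rightarrow> bool" where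
  "smooth_on S f \<longleftrightarrow>
     (\<forall>x\<in>S. \<exists>V F. open V \<and> x \<in> V \<and> (\<forall>k. Ck_on k V F) \<and> (\<forall>y\<in>V \<inter> S. F y = f y))"


section \<open>Closed manifolds\<close>

text \<open>A chart is a pair of a domain and a coordinate map; the values of the coordinate map outside
  the domain are irrelevant.\<close>

type_synonym ('a, 'm) chart = "'a set \<times> ('a \<Rightarrow> real^'m)"

definition dom_chart :: "('a, 'm) chart \<Rightarrow> 'a set" where
  "dom_chart c = fst c"

definition coord :: "('a, 'm) chart \<Rightarrow> 'a \<Rightarrow> real^'m" where
  "coord c = snd c"

definition img_chart :: "('a, 'm) chart \<Rightarrow> (real^'m) set" where
  "img_chart c = coord c ` dom_chart c"

definition inv_coord :: "('a, 'm) chart \<Rightarrow> real^'m \<Rightarrow> 'a" where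
  "inv_coord c = inv_into (dom_chart c) (coord c)"

definition is_chart :: "('a::topological_space, 'm::finite) chart \<Rightarrow> bool" where
  "is_chart c \<longleftrightarrow> open (dom_chart c) \<and> open (img_chart c) \<and>
     homeomorphism (dom_chart c) (img_chart c) (coord c) (inv_coord c)"

definition smooth_atlas :: "('a::topological_space, 'm::finite) chart set \<Rightarrow> bool" where
  "smooth_atlas A \<longleftrightarrow>
     (\<forall>c\<in>A. is_chart c) \<and> (\<Union>c\<in>A. dom_chart c) = UNIV \<and>
     (\<forall>c\<in>A. \<forall>d\<in>A. smooth_on (coord c ` (dom_chart c \<inter> dom_chart d)) (coord d \<circ> inv_coord c))"

text \<open>The manifold is the whole type \<open>'a\<close>, its smooth structure the one determined by the (not
  necessarily maximal) atlas; its dimension is \<open>CARD('m)\<close>. It need not be connected.\<close>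

definition closed_manifold ::
    "('a::{t2_space,second_countable_topology}, 'm::finite) chart set \<Rightarrow> bool" where
  "closed_manifold A \<longleftrightarrow> compact (UNIV :: 'a set) \<and> smooth_atlas A"


section \<open>Riemannian metrics\<close>

text \<open>A metric is given by its component matrix \<open>g c y\<close> in every chart \<open>c\<close> of the atlas, as a
  function of the coordinates \<open>y \<in> img_chart c\<close>, subject to the transformation law of a
  covariant 2-tensor.\<close>

type_synonym ('a, 'm) metric = "('a, 'm) chart \<Rightarrow> real^'m \<Rightarrow> real^'m^'m"

definition transition_matrix ::
    "('a, 'm::finite) chart \<Rightarrow> ('a, 'm) chart \<Rightarrow> real^'m \<Rightarrow> real^'m^'m" where
  "transition_matrix c d y = matrix (frechet_derivative (coord d \<circ> inv_coord c) (at y))"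

definition riemannian_metric ::
    "('a, 'm::finite) chart set \<Rightarrow> ('a, 'm) metric \<Rightarrow> bool" where
  "riemannian_metric A g \<longleftrightarrow>
     (\<forall>c\<in>A. smooth_on (img_chart c) (g c)) \<and>
     (\<forall>c\<in>A. \<forall>y\<in>img_chart c. transpose (g c y) = g c y \<and> (\<forall>v. v \<noteq> 0 \<longrightarrow> v \<bullet> (g c y *v v) > 0)) \<and>
     (\<forall>c\<in>A. \<forall>d\<in>A. \<forall>p \<in> dom_chart c \<inter> dom_chart d.
        g c (coord c p) =
          transpose (transition_matrix c d (coord c p)) ** g d (coord d p)
            ** transition_matrix c d (coord c p))"


section \<open>Levi-Civita connection and curvature in coordinates\<close>

definition partial :: "'m::finite \<Rightarrow> (real^'m \<Rightarrow> real) \<Rightarrow> real^'m \<Rightarrow> real" where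
  "partial i f y = frechet_derivative f (at y) (axis i 1)"

text \<open>\<open>christoffel G y k i j\<close> is \<open>\<Gamma>\<^sup>k\<^sub>i\<^sub>j\<close> at \<open>y\<close>.\<close>

definition christoffel ::
    "(real^'m::finite \<Rightarrow> real^'m^'m) \<Rightarrow> real^'m \<Rightarrow> 'm \<Rightarrow> 'm \<Rightarrow> 'm \<Rightarrow> real" where
  "christoffel G y k i j =
     (\<Sum>l\<in>UNIV. 1/2 * matrix_inv (G y) $ k $ l *
        (partial i (\<lambda>z. G z $ j $ l) y + partial j (\<lambda>z. G z $ i $ l) y
          - partial l (\<lambda>z. G z $ i $ j) y))"

text \<open>\<open>riem G y l i j k\<close> is the \<open>l\<close>-th component of
  \<open>R(\<partial>\<^sub>i,\<partial>\<^sub>j)\<partial>\<^sub>k = \<nabla>\<^sub>i\<nabla>\<^sub>j\<partial>\<^sub>k - \<nabla>\<^sub>j\<nabla>\<^sub>i\<partial>\<^sub>k\<close>.\<close>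

definition riem ::
    "(real^'m::finite \<Rightarrow> real^'m^'m) \<Rightarrow> real^'m \<Rightarrow> 'm \<Rightarrow> 'm \<Rightarrow> 'm \<Rightarrow> 'm \<Rightarrow> real" where
  "riem G y l i j k =
     partial i (\<lambda>z. christoffel G z l j k) y - partial j (\<lambda>z. christoffel G z l i k) y
     + (\<Sum>p\<in>UNIV. christoffel G y l i p * christoffel G y p j k
                  - christoffel G y l j p * christoffel G y p i k)"

text \<open>\<open>Rc(Y,Z)\<close> is the trace of \<open>X \<mapsto> R(X,Y)Z\<close>; it is positive on round spheres.\<close>

definition ricci :: "(real^'m::finite \<Rightarrow> real^'m^'m) \<Rightarrow> real^'m \<Rightarrow> real^'m^'m" where
  "ricci G y = (\<chi> j k. \<Sum>i\<in>UNIV. riem G y i i j k)"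

text \<open>\<open>K(v,w) = \<langle>R(v,w)w,v\<rangle> / (|v|\<^sup>2|w|\<^sup>2 - \<langle>v,w\<rangle>\<^sup>2)\<close>\<close>

definition sectional ::
    "(real^'m::finite \<Rightarrow> real^'m^'m) \<Rightarrow> real^'m \<Rightarrow> real^'m \<Rightarrow> real^'m \<Rightarrow> real" where
  "sectional G y v w =
     (\<chi> l. \<Sum>i\<in>UNIV. \<Sum>j\<in>UNIV. \<Sum>k\<in>UNIV. riem G y l i j k * v $ i * w $ j * w $ k) \<bullet> (G y *v v)
     / ((v \<bullet> (G y *v v)) * (w \<bullet> (G y *v w)) - (v \<bullet> (G y *v w))\<^sup>2)"

definition sectional_le ::
    "('a, 'm::finite) chart set \<Rightarrow> ('a, 'm) metric \<Rightarrow> real \<Rightarrow> bool" where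
  "sectional_le A g K \<longleftrightarrow>
     (\<forall>c\<in>A. \<forall>y\<in>img_chart c. \<forall>v w. v \<noteq> w \<and> independent {v, w} \<longrightarrow> sectional (g c) y v w \<le> K)"


section \<open>Energy density and tension field\<close>

text \<open>Below, \<open>G\<close> and \<open>H\<close> are the metrics of the domain and the target in charts, and \<open>f\<close> is the
  coordinate expression of the map.\<close>

definition local_rep ::
    "('a, 'm) chart \<Rightarrow> ('b, 'n) chart \<Rightarrow> ('a \<Rightarrow> 'b) \<Rightarrow> real^'m \<Rightarrow> real^'n" where
  "local_rep c d f = coord d \<circ> f \<circ> inv_coord c"

text \<open>\<open>(\<nabla>\<phi> \<otimes> \<nabla>\<phi>)\<^sub>i\<^sub>j = \<langle>\<nabla>\<^sub>i\<phi>, \<nabla>\<^sub>j\<phi>\<rangle>\<close>\<close>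

definition grad_tensor ::
    "(real^'n::finite \<Rightarrow> real^'n^'n) \<Rightarrow> (real^'m::finite \<Rightarrow> real^'n) \<Rightarrow> real^'m \<Rightarrow> real^'m^'m" where
  "grad_tensor H f y =
     (\<chi> i j. \<Sum>a\<in>UNIV. \<Sum>b\<in>UNIV.
        H (f y) $ a $ b * partial i (\<lambda>z. f z $ a) y * partial j (\<lambda>z. f z $ b) y)"

definition trace_metric :: "real^'m::finite^'m \<Rightarrow> real^'m^'m \<Rightarrow> real" where
  "trace_metric G B = (\<Sum>i\<in>UNIV. \<Sum>j\<in>UNIV. matrix_inv G $ i $ j * B $ i $ j)"

text \<open>The \<open>a\<close>-th component of \<open>\<nabla>d\<phi>\<close>, with \<open>\<nabla>\<close> the connection on
  \<open>T\<^sup>*M \<otimes> \<phi>\<^sup>*TN\<close>.\<close>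

definition hess_map ::
    "(real^'m::finite \<Rightarrow> real^'m^'m) \<Rightarrow> (real^'n::finite \<Rightarrow> real^'n^'n) \<Rightarrow> (real^'m \<Rightarrow> real^'n)
      \<Rightarrow> real^'m \<Rightarrow> 'n \<Rightarrow> real^'m^'m" where
  "hess_map G H f y a =
     (\<chi> i j. partial i (partial j (\<lambda>z. f z $ a)) y
        - (\<Sum>k\<in>UNIV. christoffel G y k i j * partial k (\<lambda>z. f z $ a) y)
        + (\<Sum>b\<in>UNIV. \<Sum>e\<in>UNIV. christoffel H (f y) a b e
             * partial i (\<lambda>z. f z $ b) y * partial j (\<lambda>z. f z $ e) y))"

definition tension ::
    "(real^'m::finite \<Rightarrow> real^'m^'m) \<Rightarrow> (real^'n::finite \<Rightarrow> real^'n^'n) \<Rightarrow> (real^'m \<Rightarrow> real^'n)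
      \<Rightarrow> real^'m \<Rightarrow> real^'n" where
  "tension G H f y = (\<chi> a. trace_metric (G y) (hess_map G H f y a))"

definition energy_density_in ::
    "('a, 'm::finite) metric \<Rightarrow> ('b, 'n::finite) metric \<Rightarrow> ('a, 'm) chart \<Rightarrow> ('b, 'n) chart
      \<Rightarrow> ('a \<Rightarrow> 'b) \<Rightarrow> 'a \<Rightarrow> real" where
  "energy_density_in g \<gamma> c d f p =
     trace_metric (g c (coord c p)) (grad_tensor (\<gamma> d) (local_rep c d f) (coord c p))"

definition chart_at :: "('a, 'm) chart set \<Rightarrow> 'a \<Rightarrow> ('a, 'm) chart" where
  "chart_at A p = (SOME c. c \<in> A \<and> p \<in> dom_chart c)"

text \<open>\<open>|\<nabla>f|\<^sup>2(p)\<close>; for metrics and a differentiable map the value does not depend on the charts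
  chosen.\<close>

definition energy_density ::
    "('a, 'm::finite) chart set \<Rightarrow> ('a, 'm) metric \<Rightarrow> ('b, 'n::finite) chart set \<Rightarrow> ('b, 'n) metric
      \<Rightarrow> ('a \<Rightarrow> 'b) \<Rightarrow> 'a \<Rightarrow> real" where
  "energy_density A g B \<gamma> f p = energy_density_in g \<gamma> (chart_at A p) (chart_at B (f p)) f p"


section \<open>The flow\<close>

text \<open>\<open>T = \<infinity>\<close> is allowed.\<close>

definition time_interval :: "ereal \<Rightarrow> real set" where
  "time_interval T = {t. 0 \<le> t \<and> ereal t < T}"

definition smooth_metric_family ::
    "('a, 'm::finite) chart set \<Rightarrow> real set \<Rightarrow> (real \<Rightarrow> ('a, 'm) metric) \<Rightarrow> bool" where
  "smooth_metric_family A I g \<longleftrightarrow>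
     (\<forall>t\<in>I. riemannian_metric A (g t)) \<and>
     (\<forall>c\<in>A. smooth_on (I \<times> img_chart c) (\<lambda>(t, y). g t c y))"

definition smooth_map_family ::
    "('a::topological_space, 'm::finite) chart set \<Rightarrow> ('b::topological_space, 'n::finite) chart set
      \<Rightarrow> real set \<Rightarrow> (real \<Rightarrow> 'a \<Rightarrow> 'b) \<Rightarrow> bool" where
  "smooth_map_family A B I \<phi> \<longleftrightarrow>
     continuous_on (I \<times> UNIV) (\<lambda>(t, p). \<phi> t p) \<and>
     (\<forall>c\<in>A. \<forall>d\<in>B.
        smooth_on {(t, y). t \<in> I \<and> y \<in> img_chart c \<and> \<phi> t (inv_coord c y) \<in> dom_chart d}
          (\<lambda>(t, y). local_rep c d (\<phi> t) y))"

text \<open>Time derivatives at \<open>t = 0\<close> are one-sided. In the second equation \<open>\<phi> s p\<close> stays in the domain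
  of the chart \<open>d\<close> for \<open>s\<close> near \<open>t\<close>.\<close>

definition RH_flow ::
    "('a::topological_space, 'm::finite) chart set \<Rightarrow> ('b::topological_space, 'n::finite) chart set
      \<Rightarrow> ('b, 'n) metric \<Rightarrow> (real \<Rightarrow> real) \<Rightarrow> ereal
      \<Rightarrow> (real \<Rightarrow> ('a, 'm) metric) \<Rightarrow> (real \<Rightarrow> 'a \<Rightarrow> 'b) \<Rightarrow> bool" where
  "RH_flow A B \<gamma> \<alpha> T g \<phi> \<longleftrightarrow>
     smooth_on (time_interval T) \<alpha> \<and>
     smooth_metric_family A (time_interval T) g \<and>
     smooth_map_family A B (time_interval T) \<phi> \<and>
     (\<forall>t\<in>time_interval T. \<forall>c\<in>A. \<forall>d\<in>B. \<forall>p\<in>dom_chart c. \<phi> t p \<in> dom_chart d \<longrightarrow>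
        ((\<lambda>s. g s c (coord c p)) has_vector_derivative
           (- 2) *\<^sub>R ricci (g t c) (coord c p)
           + (2 * \<alpha> t) *\<^sub>R grad_tensor (\<gamma> d) (local_rep c d (\<phi> t)) (coord c p))
          (at t within time_interval T) \<and>
        ((\<lambda>s. coord d (\<phi> s p)) has_vector_derivative
           tension (g t c) (\<gamma> d) (local_rep c d (\<phi> t)) (coord c p))
          (at t within time_interval T))"

end

theory Submission
  imports Defs
begin

text \<open>
  In coordinates \<open>|\<nabla>\<phi>|\<^sup>2\<close> is the trace of \<open>\<nabla>\<phi> \<otimes> \<nabla>\<phi>\<close> with respect to \<open>g\<close>. Differentiating twice
  with the Levi-Civita connections, the Ricci identity for \<open>\<nabla>d\<phi>\<close> turns \<open>tr \<nabla>\<^sup>2 d\<phi>\<close> into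
  \<open>\<nabla>\<tau>\<close> plus the Ricci curvature of \<open>g\<close> and the curvature of \<open>N\<close>. The Ricci term cancels against
  the one in \<open>\<partial>\<^sub>t g\<close>, so at a spatial maximum, where \<open>\<Delta>|\<nabla>\<phi>|\<^sup>2 \<le> 0\<close>,
  \<open>\<partial>\<^sub>t |\<nabla>\<phi>|\<^sup>2 \<le> 2 (K - \<alpha>/m) |\<nabla>\<phi>|\<^sup>4\<close> for every bound \<open>K \<ge> 0\<close> of the sectional curvatures of
  \<open>N\<close>. The three claims follow by comparing the maximum of \<open>|\<nabla>\<phi>|\<^sup>2\<close> with solutions of
  \<open>\<rho>' > 2 (K - \<alpha>/m) \<rho>\<^sup>2\<close>.
\<close>

section \<open>Smooth functions\<close>

text \<open>All geometry takes place in one chart of each manifold and at one point. A covariant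
  derivative is a directional derivative corrected by \<open>conn\<close>, and a trace is a sum over
  a frame orthonormal at that point only. Metric compatibility absorbs the derivative of the inverse
  metric into the corrections, which takes the place of normal coordinates.

  The quotient \<alpha>/m comes from |\<nabla>\<phi> \<otimes> \<nabla>\<phi>|^2 \<ge>
  |\<nabla>\<phi>|^4 / m, Cauchy-Schwarz for the trace of an m by m matrix. The curvature of N
  contributes at most K (|\<nabla>\<phi>|^4 - |\<nabla>\<phi> \<otimes> \<nabla>\<phi>|^2), and K
  \<ge> 0 allows the subtracted square to be dropped.

  At t = 0 time derivatives are one-sided, so the inequality is derived for t > 0 and the initial
  time enters through continuity. Comparison at a contact point requires strict inequalities; each
  barrier is therefore an explicit solution of \<rho>' = k \<rho>^2 with slightly perturbed data,
  and the perturbation is removed by a limit. The 4 in T* is a doubling time: E0 / (1 - 2 c0 E0 t),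
  which solves \<rho>' = 2 c0 \<rho>^2 from E0, reaches 2 E0 at t = 1 / (4 c0 E0).\<close>

abbreviation dir_deriv :: "('e::real_normed_vector \<Rightarrow> 'f::real_normed_vector) \<Rightarrow> 'e \<Rightarrow> 'e \<Rightarrow> 'f"
  where "dir_deriv f y u \<equiv> frechet_derivative f (at y) u"

lemma dir_deriv_eqI: "(f has_derivative f') (at x) \<Longrightarrow> f' u = dir_deriv f x u"
  using frechet_derivative_at by metis

text \<open>Openness is built in because \<open>Ck_on\<close> takes two-sided derivatives at the
  points of its set.\<close>

definition smooth_in :: "'e::euclidean_space set \<Rightarrow> ('e \<Rightarrow> 'f::real_normed_vector) \<Rightarrow> bool" where
  "smooth_in S f \<longleftrightarrow> open S \<and> (\<forall>k. Ck_on k S f)"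

text \<open>A derivative at a point depends only on the germ there, so on an open set equality of
  values passes to all derivatives. This is how derivative formulas valid only on \<open>S\<close>
  are substituted in the inductions below.\<close>

lemma Ck_on_cong:
  assumes "open S" "\<And>x. x \<in> S \<Longrightarrow> f x = g x" "Ck_on k S f"
  shows "Ck_on k S g"
  using assms(2,3)
proof (induction k arbitrary: f g)
  case 0
  then show ?case by (simp add: continuous_on_eq)
next
  case (Suc k)
  have d: "f differentiable at x" if "x \<in> S" for x
    using Suc.prems(2) that \<open>open S\<close>
    by (metis Ck_on.simps(2) differentiable_on_def at_within_open)
  have fg: "frechet_derivative f (at x) = frechet_derivative g (at x)" if "x \<in> S" for x
    by (rule frechet_derivative_transform_within_open[OF d \<open>open S\<close>]) (use that Suc.prems in auto)
  have "g differentiable_on S"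
    unfolding differentiable_on_def
  proof
    fix x assume x: "x \<in> S"
    have "(f has_derivative frechet_derivative f (at x)) (at x)"
      using d[OF x] frechet_derivative_works by blast
    from has_derivative_transform_within_open[OF this \<open>open S\<close> x Suc.prems(1)]
    show "g differentiable (at x within S)" using differentiableI differentiable_at_withinI by blast
  qed
  moreover have "Ck_on k S (\<lambda>x. dir_deriv g x b)" if "b \<in> Basis" for b
    by (rule Suc.IH[of "\<lambda>x. dir_deriv f x b"]) (use fg Suc.prems(2) that in auto)
  ultimately show ?case by simp
qed

lemma Ck_on_subset: "Ck_on k S f \<Longrightarrow> S' \<subseteq> S \<Longrightarrow> Ck_on k S' f"
  by (induction k arbitrary: f) (auto intro: continuous_on_subset differentiable_on_subset)

lemma Ck_on_local:
  assumes "\<And>x. x \<in> S \<Longrightarrow> \<exists>V. open V \<and> x \<in> V \<and> Ck_on k V f" "open S"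
  shows "Ck_on k S f"
  using assms(1)
proof (induction k arbitrary: f)
  case 0
  show ?case
    unfolding Ck_on.simps
  proof (rule continuous_at_imp_continuous_on, rule ballI)
    fix x assume "x \<in> S"
    then show "isCont f x" using 0
      by (metis Ck_on.simps(1) continuous_on_eq_continuous_at)
  qed
next
  case (Suc k)
  have "f differentiable_on S"
    unfolding differentiable_on_def
  proof
    fix x assume "x \<in> S"
    then obtain V where "open V" "x \<in> V" "Ck_on (Suc k) V f" using Suc.prems by blast
    then have "f differentiable at x"
      by (metis Ck_on.simps(2) differentiable_on_def at_within_open)
    then show "f differentiable at x within S" by (rule differentiable_at_withinI)
  qed
  moreover have "Ck_on k S (\<lambda>x. dir_deriv f x b)" if "b \<in> Basis" for b
    using Suc.IH Suc.prems that by (metis Ck_on.simps(2))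
  ultimately show ?case by simp
qed

text \<open>Each local extension \<open>F\<close> agrees with \<open>f\<close> on the open set
  \<open>V \<inter> S\<close>, so \<open>f\<close> inherits its derivatives there.\<close>

lemma smooth_on_open:
  assumes "open S" "smooth_on S f"
  shows "smooth_in S f"
  unfolding smooth_in_def
proof (intro conjI allI \<open>open S\<close> Ck_on_local)
  fix k x assume "x \<in> S"
  then obtain V F where V: "open V" "x \<in> V" "\<forall>k. Ck_on k V F" "\<forall>y\<in>V \<inter> S. F y = f y"
    using assms(2) unfolding smooth_on_def by blast
  have "Ck_on k (V \<inter> S) f"
    by (rule Ck_on_cong[of _ F]) (use V \<open>open S\<close> Ck_on_subset[of k V F "V \<inter> S"] in auto)
  then show "\<exists>V. open V \<and> x \<in> V \<and> Ck_on k V f" using V \<open>x \<in> S\<close> \<open>open S\<close> by blast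
qed

lemma smooth_on_subset: "smooth_on S f \<Longrightarrow> S' \<subseteq> S \<Longrightarrow> smooth_on S' f"
  unfolding smooth_on_def by (meson IntD1 IntD2 IntI subsetD)

lemma Ck_on_differentiable: "Ck_on (Suc k) S f \<Longrightarrow> open S \<Longrightarrow> x \<in> S \<Longrightarrow> f differentiable at x"
  by (metis Ck_on.simps(2) differentiable_on_def at_within_open)

lemma Ck_on_add_scale:
  assumes "open S" "Ck_on k S f" "Ck_on k S g"
  shows "Ck_on k S (\<lambda>x. a *\<^sub>R f x + c *\<^sub>R g x)"
  using assms(2,3)
proof (induction k arbitrary: f g)
  case 0
  then show ?case by (auto intro!: continuous_intros)
next
  case (Suc k)
  have hd: "((\<lambda>x. a *\<^sub>R f x + c *\<^sub>R g x) has_derivative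
      (\<lambda>u. a *\<^sub>R dir_deriv f x u + c *\<^sub>R dir_deriv g x u)) (at x)" if "x \<in> S" for x
    using Ck_on_differentiable[OF Suc.prems(1) \<open>open S\<close> that] Ck_on_differentiable[OF Suc.prems(2) \<open>open S\<close> that]
    unfolding frechet_derivative_works by (auto intro!: derivative_eq_intros)
  then have "(\<lambda>x. a *\<^sub>R f x + c *\<^sub>R g x) differentiable_on S"
    unfolding differentiable_on_def using differentiableI differentiable_at_withinI by blast
  moreover have "Ck_on k S (\<lambda>x. dir_deriv (\<lambda>x. a *\<^sub>R f x + c *\<^sub>R g x) x b)" if b: "b \<in> Basis" for b
  proof (rule Ck_on_cong[OF \<open>open S\<close>])
    show "Ck_on k S (\<lambda>x. a *\<^sub>R dir_deriv f x b + c *\<^sub>R dir_deriv g x b)"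
      using Suc b by simp
  qed (rule dir_deriv_eqI[OF hd])
  ultimately show ?case by simp
qed

lemma Ck_on_zero: "Ck_on k S (\<lambda>x. 0)"
  by (induction k) (auto simp: differentiable_on_const)

lemma Ck_on_sum:
  assumes "open S" "finite I" "\<And>i. i \<in> I \<Longrightarrow> Ck_on k S (f i)"
  shows "Ck_on k S (\<lambda>x. \<Sum>i\<in>I. (c i::real) *\<^sub>R f i x)"
  using assms(2,3)
proof (induction I)
  case empty
  then show ?case by (simp add: Ck_on_zero)
next
  case (insert i I)
  then have "Ck_on k S (\<lambda>x. c i *\<^sub>R f i x + 1 *\<^sub>R (\<Sum>i\<in>I. c i *\<^sub>R f i x))"
    by (intro Ck_on_add_scale \<open>open S\<close>) auto
  then show ?case using insert by simp
qed

lemma smooth_in_differentiable: "smooth_in S f \<Longrightarrow> x \<in> S \<Longrightarrow> f differentiable at x"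
  unfolding smooth_in_def using Ck_on_differentiable by blast

lemma smooth_in_has_derivative:
  "smooth_in S f \<Longrightarrow> x \<in> S \<Longrightarrow> (f has_derivative dir_deriv f x) (at x)"
  using smooth_in_differentiable frechet_derivative_works by blast

lemma smooth_in_linear: "smooth_in S f \<Longrightarrow> x \<in> S \<Longrightarrow> linear (dir_deriv f x)"
  using smooth_in_has_derivative has_derivative_linear by blast

lemma smooth_in_isCont: "smooth_in S f \<Longrightarrow> x \<in> S \<Longrightarrow> isCont f x"
  using smooth_in_has_derivative has_derivative_continuous by blast

lemma smooth_in_cong:
  assumes "smooth_in S f" "\<And>x. x \<in> S \<Longrightarrow> f x = g x"
  shows "smooth_in S g"
  unfolding smooth_in_def
proof (intro conjI allI)
  show op: "open S" using assms(1) unfolding smooth_in_def by blast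
  fix k
  have "Ck_on k S f" using assms(1) unfolding smooth_in_def by blast
  with op assms(2) show "Ck_on k S g" by (rule Ck_on_cong)
qed

lemma smooth_in_subset: "smooth_in S f \<Longrightarrow> S' \<subseteq> S \<Longrightarrow> open S' \<Longrightarrow> smooth_in S' f"
  unfolding smooth_in_def using Ck_on_subset by blast

lemma smooth_in_sum:
  assumes "open S" "finite I" "\<And>i. i \<in> I \<Longrightarrow> smooth_in S (f i)"
  shows "smooth_in S (\<lambda>x. \<Sum>i\<in>I. (c i::real) *\<^sub>R f i x)"
  using Ck_on_sum[OF assms(1,2)] assms unfolding smooth_in_def by blast

lemma linear_sum_Basis:
  fixes L :: "'e::euclidean_space \<Rightarrow> 'f::real_vector"
  assumes "linear L"
  shows "L u = (\<Sum>b\<in>Basis. (u \<bullet> b) *\<^sub>R L b)"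
proof -
  have "L u = L (\<Sum>b\<in>Basis. (u \<bullet> b) *\<^sub>R b)" by (simp add: euclidean_representation)
  also have "\<dots> = (\<Sum>b\<in>Basis. (u \<bullet> b) *\<^sub>R L b)"
    by (simp add: linear_sum[OF assms] linear_scale[OF assms])
  finally show ?thesis .
qed

text \<open>\<open>Ck_on\<close> speaks of basis directions only; any other direction is a fixed
  linear combination of them.\<close>

lemma smooth_in_dir_deriv:
  assumes "smooth_in S f"
  shows "smooth_in S (\<lambda>x. dir_deriv f x u)"
proof (rule smooth_in_cong)
  show "smooth_in S (\<lambda>x. \<Sum>b\<in>Basis. (u \<bullet> b) *\<^sub>R dir_deriv f x b)"
  proof (rule smooth_in_sum)
    show "smooth_in S (\<lambda>x. dir_deriv f x b)" if "b \<in> Basis" for b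
      unfolding smooth_in_def
    proof (intro conjI allI)
      show "open S" using assms unfolding smooth_in_def by blast
      fix k
      have "Ck_on (Suc k) S f" using assms unfolding smooth_in_def by blast
      then show "Ck_on k S (\<lambda>x. dir_deriv f x b)" using that by simp
    qed
  qed (use assms in \<open>auto simp: smooth_in_def\<close>)
qed (rule linear_sum_Basis[OF smooth_in_linear[OF assms], symmetric])

lemma smooth_in_inner:
  fixes f :: "'e::euclidean_space \<Rightarrow> 'f::real_inner"
  assumes "smooth_in S f"
  shows "smooth_in S (\<lambda>x. f x \<bullet> c)"
proof -
  have op: "open S" using assms unfolding smooth_in_def by blast
  have "Ck_on k S f \<Longrightarrow> Ck_on k S (\<lambda>x. f x \<bullet> c)" for k
  proof (induction k arbitrary: f)
    case 0
    then show ?case by (auto intro!: continuous_intros)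
  next
    case (Suc k)
    have hd: "((\<lambda>x. f x \<bullet> c) has_derivative (\<lambda>u. dir_deriv f x u \<bullet> c)) (at x)" if "x \<in> S" for x
      using Ck_on_differentiable[OF Suc.prems op that]
      unfolding frechet_derivative_works by (rule has_derivative_inner_left)
    then have "(\<lambda>x. f x \<bullet> c) differentiable_on S"
      unfolding differentiable_on_def using differentiableI differentiable_at_withinI by blast
    moreover have "Ck_on k S (\<lambda>x. dir_deriv (\<lambda>x. f x \<bullet> c) x b)" if b: "b \<in> Basis" for b
    proof (rule Ck_on_cong[OF op])
      show "Ck_on k S (\<lambda>x. dir_deriv f x b \<bullet> c)"
        using Suc b by simp
    qed (rule dir_deriv_eqI[OF hd])
    ultimately show ?case by simp
  qed
  then show ?thesis using assms unfolding smooth_in_def by blast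
qed

text \<open>Passes from joint smoothness in time and space to the calculus at a fixed time. By the
  second part a spatial derivative is a joint derivative in direction \<open>(0, u)\<close>, hence
  again jointly smooth.\<close>

lemma smooth_in_Pair_slice:
  fixes f :: "'d::euclidean_space \<times> 'e::euclidean_space \<Rightarrow> 'f::real_normed_vector"
  assumes "smooth_in W f"
  shows "smooth_in {y. (t, y) \<in> W} (\<lambda>y. f (t, y))"
    and "(t, y) \<in> W \<Longrightarrow> dir_deriv (\<lambda>y. f (t, y)) y u = dir_deriv f (t, y) (0, u)"
proof -
  have op: "open W" using assms unfolding smooth_in_def by blast
  have "open ((\<lambda>y. (t, y)) -` W)"
    by (intro open_vimage op continuous_intros)
  then have ops: "open {y. (t, y) \<in> W}" unfolding vimage_def .
  have hd: "((\<lambda>y. f (t, y)) has_derivative (\<lambda>u. dir_deriv f (t, y) (0, u))) (at y)"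
    if "f differentiable at (t, y)" for f :: "'d \<times> 'e \<Rightarrow> 'f" and y
  proof -
    have "((\<lambda>y. (t, y)) has_derivative (\<lambda>u. (0, u))) (at y)"
      by (auto intro!: derivative_eq_intros)
    from has_derivative_compose[OF this that[unfolded frechet_derivative_works]] show ?thesis .
  qed
  show "dir_deriv (\<lambda>y. f (t, y)) y u = dir_deriv f (t, y) (0, u)" if "(t, y) \<in> W"
    by (rule dir_deriv_eqI[OF hd[OF smooth_in_differentiable[OF assms that]], symmetric])
  have "smooth_in W f \<Longrightarrow> Ck_on k {y. (t, y) \<in> W} (\<lambda>y. f (t, y))" for k
  proof (induction k arbitrary: f)
    case 0
    have "continuous_on W f" using 0 unfolding smooth_in_def by (metis Ck_on.simps(1))
    then show ?case
      by (auto intro!: continuous_on_compose2[of W f] continuous_intros)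
  next
    case (Suc k)
    have d: "f differentiable at (t, y)" if "(t, y) \<in> W" for y
      using smooth_in_differentiable Suc.prems that by blast
    have "(\<lambda>y. f (t, y)) differentiable_on {y. (t, y) \<in> W}"
      unfolding differentiable_on_def using differentiableI[OF hd[OF d]] differentiable_at_withinI by blast
    moreover have "Ck_on k {y. (t, y) \<in> W} (\<lambda>x. dir_deriv (\<lambda>y. f (t, y)) x b)" if b: "b \<in> Basis" for b
    proof (rule Ck_on_cong[OF ops])
      show "Ck_on k {y. (t, y) \<in> W} (\<lambda>y. dir_deriv f (t, y) (0, b))"
        by (rule Suc.IH[OF smooth_in_dir_deriv[OF Suc.prems]])
    qed (auto intro: dir_deriv_eqI[OF hd[OF d]])
    ultimately show ?case by simp
  qed
  then show "smooth_in {y. (t, y) \<in> W} (\<lambda>y. f (t, y))"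
    using assms ops unfolding smooth_in_def by blast
qed

section \<open>Symmetry of second derivatives\<close>

lemma dir_deriv_mvt:
  fixes f :: "'e::real_normed_vector \<Rightarrow> real"
  assumes "0 < (h::real)" "\<And>s. 0 \<le> s \<Longrightarrow> s \<le> h \<Longrightarrow> f differentiable at (x + s *\<^sub>R u)"
  obtains s where "0 < s" "s < h" "f (x + h *\<^sub>R u) - f x = h * dir_deriv f (x + s *\<^sub>R u) u"
proof -
  have der: "((\<lambda>s. f (x + s *\<^sub>R u)) has_real_derivative dir_deriv f (x + s *\<^sub>R u) u) (at s)"
    if "0 \<le> s" "s \<le> h" for s
  proof -
    have a: "((\<lambda>s. x + s *\<^sub>R u) has_derivative (\<lambda>r. r *\<^sub>R u)) (at s)"
      by (auto intro!: derivative_eq_intros)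
    have b: "(f has_derivative dir_deriv f (x + s *\<^sub>R u)) (at (x + s *\<^sub>R u))"
      using assms(2)[OF that] frechet_derivative_works by blast
    have "((\<lambda>s. f (x + s *\<^sub>R u)) has_derivative (\<lambda>r. dir_deriv f (x + s *\<^sub>R u) (r *\<^sub>R u))) (at s)"
      using has_derivative_compose[OF a b] .
    moreover have "(\<lambda>r. dir_deriv f (x + s *\<^sub>R u) (r *\<^sub>R u)) = (*) (dir_deriv f (x + s *\<^sub>R u) u)"
      using linear_scale[OF has_derivative_linear[OF b]] by (auto simp: mult.commute)
    ultimately show ?thesis unfolding has_field_derivative_def by metis
  qed
  obtain s where "0 < s" "s < h" "f (x + h *\<^sub>R u) - f (x + 0 *\<^sub>R u) = (h - 0) * dir_deriv f (x + s *\<^sub>R u) u"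
    using MVT2[OF assms(1) der] by blast
  then show thesis using that by simp
qed

text \<open>Two applications of the mean value theorem, along \<open>u\<close> and then along
  \<open>v\<close>, make the second difference equal to h^2 times the mixed derivative at a point of
  the parallelogram; continuity of that derivative does the rest.\<close>

lemma second_difference:
  fixes f :: "'e::euclidean_space \<Rightarrow> real"
  assumes f: "smooth_in S f" and x: "x \<in> S" and e: "e > 0"
  shows "\<exists>d>0. \<forall>h. 0 < h \<and> h < d \<longrightarrow>
    \<bar>f (x + h *\<^sub>R u + h *\<^sub>R v) - f (x + h *\<^sub>R u) - f (x + h *\<^sub>R v) + f x
      - h\<^sup>2 * dir_deriv (\<lambda>y. dir_deriv f y u) x v\<bar> \<le> h\<^sup>2 * e"
proof -
  let ?D = "\<lambda>y. dir_deriv (\<lambda>y. dir_deriv f y u) y v"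
  have S: "open S" using f unfolding smooth_in_def by blast
  have D: "isCont ?D x"
    by (intro smooth_in_isCont[OF _ x] smooth_in_dir_deriv f)
  obtain d1 where d1: "d1 > 0" "\<And>y. dist y x < d1 \<Longrightarrow> \<bar>?D y - ?D x\<bar> < e"
    using D e unfolding continuous_at_eps_delta dist_real_def by blast
  obtain d2 where d2: "d2 > 0" "ball x d2 \<subseteq> S"
    using S x open_contains_ball by blast
  \<comment> \<open>Scaled so that the whole parallelogram spanned by \<open>h *\<^sub>R u\<close>
    and \<open>h *\<^sub>R v\<close> stays within \<open>min d1 d2\<close> of \<open>x\<close>; the
    summand 1 keeps the denominator positive when both vectors vanish.\<close>
  define d where "d = min d1 d2 / (norm u + norm v + 1)"
  have nz: "norm u + norm v + 1 > 0" by (simp add: add_nonneg_pos)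
  have d: "d > 0" unfolding d_def using d1 d2 nz by simp
  have near: "dist (x + s *\<^sub>R u + r *\<^sub>R v) x < min d1 d2"
    if "0 \<le> s" "s \<le> h" "0 \<le> r" "r \<le> h" "h < d" for s r h
  proof -
    have "norm (s *\<^sub>R u + r *\<^sub>R v) \<le> s * norm u + r * norm v"
      using norm_triangle_ineq[of "s *\<^sub>R u" "r *\<^sub>R v"] that by simp
    also have "\<dots> \<le> h * norm u + h * norm v"
      using that by (intro add_mono mult_right_mono) auto
    also have "\<dots> \<le> h * (norm u + norm v + 1)" using that by (simp add: algebra_simps)
    also have "\<dots> < d * (norm u + norm v + 1)" using that nz by simp
    also have "\<dots> = min d1 d2" unfolding d_def using nz by simp
    finally show ?thesis by (simp add: dist_norm add.assoc)
  qed
  have "\<bar>f (x + h *\<^sub>R u + h *\<^sub>R v) - f (x + h *\<^sub>R u) - f (x + h *\<^sub>R v) + f x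
      - h\<^sup>2 * ?D x\<bar> \<le> h\<^sup>2 * e" if h: "0 < h" "h < d" for h
  proof -
    have inS: "x + s *\<^sub>R u + r *\<^sub>R v \<in> S" if "0 \<le> s" "s \<le> h" "0 \<le> r" "r \<le> h" for s r
      using near[OF that h(2)] d2(2) by (auto simp: dist_commute)
    \<comment> \<open>The increment in direction \<open>v\<close>. Its derivative along
      \<open>u\<close> is an increment of \<open>\<lambda>y. dir_deriv f y u\<close>, to which the
      mean value theorem applies again.\<close>
    define p where "p = (\<lambda>y. f (y + h *\<^sub>R v) - f y)"
    have fd: "f differentiable at (x + s *\<^sub>R u + r *\<^sub>R v)" if "0 \<le> s" "s \<le> h" "0 \<le> r" "r \<le> h" for s r
      using smooth_in_differentiable[OF f] inS that by blast
    have pd: "(p has_derivative (\<lambda>w. dir_deriv f (x + s *\<^sub>R u + h *\<^sub>R v) w - dir_deriv f (x + s *\<^sub>R u) w))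
        (at (x + s *\<^sub>R u))" if "0 \<le> s" "s \<le> h" for s
    proof -
      have 1: "(f has_derivative dir_deriv f (x + s *\<^sub>R u + h *\<^sub>R v)) (at (x + s *\<^sub>R u + h *\<^sub>R v))"
        using fd[of s h] that h frechet_derivative_works by auto
      have 2: "(f has_derivative dir_deriv f (x + s *\<^sub>R u)) (at (x + s *\<^sub>R u))"
        using fd[of s 0] that h frechet_derivative_works by auto
      have "((\<lambda>y. y + h *\<^sub>R v) has_derivative (\<lambda>w. w)) (at (x + s *\<^sub>R u))"
        by (auto intro!: derivative_eq_intros)
      from has_derivative_compose[OF this 1] 2 show ?thesis
        unfolding p_def by (intro has_derivative_diff)
    qed
    obtain s where s: "0 < s" "s < h" "p (x + h *\<^sub>R u) - p x = h * dir_deriv p (x + s *\<^sub>R u) u"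
      using dir_deriv_mvt[OF h(1) differentiableI[OF pd]] by blast
    have dp: "dir_deriv p (x + s *\<^sub>R u) u = dir_deriv f (x + s *\<^sub>R u + h *\<^sub>R v) u - dir_deriv f (x + s *\<^sub>R u) u"
      by (rule dir_deriv_eqI[OF pd, symmetric]) (use s in auto)
    have "(\<lambda>y. dir_deriv f y u) differentiable at (x + s *\<^sub>R u + r *\<^sub>R v)" if "0 \<le> r" "r \<le> h" for r
      using smooth_in_differentiable[OF smooth_in_dir_deriv[OF f]] inS[of s r] that s by auto
    then obtain r where r: "0 < r" "r < h"
      "dir_deriv f (x + s *\<^sub>R u + h *\<^sub>R v) u - dir_deriv f (x + s *\<^sub>R u) u
        = h * ?D (x + s *\<^sub>R u + r *\<^sub>R v)"
      using dir_deriv_mvt[OF h(1), of "\<lambda>y. dir_deriv f y u" "x + s *\<^sub>R u" v] by blast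
    have "f (x + h *\<^sub>R u + h *\<^sub>R v) - f (x + h *\<^sub>R u) - f (x + h *\<^sub>R v) + f x = p (x + h *\<^sub>R u) - p x"
      unfolding p_def by simp
    also have "\<dots> = h\<^sup>2 * ?D (x + s *\<^sub>R u + r *\<^sub>R v)"
      using s r dp by (simp add: power2_eq_square)
    finally have "f (x + h *\<^sub>R u + h *\<^sub>R v) - f (x + h *\<^sub>R u) - f (x + h *\<^sub>R v) + f x - h\<^sup>2 * ?D x
       = h\<^sup>2 * (?D (x + s *\<^sub>R u + r *\<^sub>R v) - ?D x)" by (simp add: algebra_simps)
    moreover have "\<bar>?D (x + s *\<^sub>R u + r *\<^sub>R v) - ?D x\<bar> \<le> e"
      using d1(2) near[of s h r] s r h by (simp add: less_imp_le)
    ultimately show ?thesis by (simp add: abs_mult mult_left_mono)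
  qed
  then show ?thesis using d by blast
qed

text \<open>The second difference is symmetric in \<open>u\<close> and \<open>v\<close>, so both
  mixed derivatives approximate the same number.\<close>

lemma smooth_in_symmetric_real:
  fixes f :: "'e::euclidean_space \<Rightarrow> real"
  assumes f: "smooth_in S f" and x: "x \<in> S"
  shows "dir_deriv (\<lambda>y. dir_deriv f y u) x v = dir_deriv (\<lambda>y. dir_deriv f y v) x u"
    (is "?a = ?b")
proof (rule ccontr)
  assume "?a \<noteq> ?b"
  \<comment> \<open>A third of the gap, because the two approximation errors add up to at most
    \<open>2 * e\<close>.\<close>
  define e where "e = \<bar>?a - ?b\<bar> / 3"
  have e: "e > 0" using \<open>?a \<noteq> ?b\<close> e_def by simp
  obtain d1 where d1: "d1 > 0" "\<And>h. 0 < h \<Longrightarrow> h < d1 \<Longrightarrow>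
     \<bar>f (x + h *\<^sub>R u + h *\<^sub>R v) - f (x + h *\<^sub>R u) - f (x + h *\<^sub>R v) + f x - h\<^sup>2 * ?a\<bar> \<le> h\<^sup>2 * e"
    using second_difference[OF f x e, of u v] by blast
  obtain d2 where d2: "d2 > 0" "\<And>h. 0 < h \<Longrightarrow> h < d2 \<Longrightarrow>
     \<bar>f (x + h *\<^sub>R v + h *\<^sub>R u) - f (x + h *\<^sub>R v) - f (x + h *\<^sub>R u) + f x - h\<^sup>2 * ?b\<bar> \<le> h\<^sup>2 * e"
    using second_difference[OF f x e, of v u] by blast
  define h where "h = min d1 d2 / 2"
  have h: "0 < h" "h < d1" "h < d2" using d1 d2 h_def by auto
  have eq: "x + h *\<^sub>R v + h *\<^sub>R u = x + h *\<^sub>R u + h *\<^sub>R v" by simp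
  have "\<bar>h\<^sup>2 * ?a - h\<^sup>2 * ?b\<bar> \<le> 2 * (h\<^sup>2 * e)"
    using d1(2)[OF h(1,2)] d2(2)[OF h(1,3)] unfolding eq by linarith
  then have "h\<^sup>2 * \<bar>?a - ?b\<bar> \<le> h\<^sup>2 * (2 * e)"
    by (simp add: abs_mult flip: right_diff_distrib)
  then have "\<bar>?a - ?b\<bar> \<le> 2 * e" using h by simp
  then show False using e e_def by simp
qed

lemma smooth_in_symmetric:
  fixes f :: "'e::euclidean_space \<Rightarrow> 'f::euclidean_space"
  assumes f: "smooth_in S f" and x: "x \<in> S"
  shows "dir_deriv (\<lambda>y. dir_deriv f y u) x v = dir_deriv (\<lambda>y. dir_deriv f y v) x u"
proof -
  have op: "open S" using f unfolding smooth_in_def by blast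
  have 1: "dir_deriv (\<lambda>y. g y \<bullet> c) y w = dir_deriv g y w \<bullet> c" if "smooth_in S g" "y \<in> S"
    for g :: "'e \<Rightarrow> 'f" and y w c
    by (rule dir_deriv_eqI[OF has_derivative_inner_left[OF smooth_in_has_derivative[OF that]], symmetric])
  have 2: "dir_deriv (\<lambda>y. dir_deriv (\<lambda>y. f y \<bullet> c) y w) x z = dir_deriv (\<lambda>y. dir_deriv f y w) x z \<bullet> c" for w z c
  proof -
    have "frechet_derivative (\<lambda>y. dir_deriv f y w \<bullet> c) (at x) = frechet_derivative (\<lambda>y. dir_deriv (\<lambda>y. f y \<bullet> c) y w) (at x)"
      by (rule frechet_derivative_transform_within_open[OF _ op x])
        (use 1[OF f] smooth_in_differentiable[OF smooth_in_inner[OF smooth_in_dir_deriv[OF f]] x] in auto)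
    then show ?thesis using 1[OF smooth_in_dir_deriv[OF f] x] by metis
  qed
  show ?thesis
  proof (rule euclidean_eqI)
    fix c :: 'f
    have "dir_deriv (\<lambda>y. dir_deriv (\<lambda>y. f y \<bullet> c) y u) x v
        = dir_deriv (\<lambda>y. dir_deriv (\<lambda>y. f y \<bullet> c) y v) x u"
      by (rule smooth_in_symmetric_real[OF smooth_in_inner[OF f] x])
    then show "dir_deriv (\<lambda>y. dir_deriv f y u) x v \<bullet> c = dir_deriv (\<lambda>y. dir_deriv f y v) x u \<bullet> c"
      unfolding 2 .
  qed
qed

section \<open>Inner products given by matrices\<close>

text \<open>Evaluates any covariant 2-tensor on a pair of vectors. Neither symmetry nor positivity
  is imposed, since it is also applied to derivatives of the metric, to \<open>ricci\<close> and to
  \<open>grad_tensor\<close>.\<close>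

definition mip :: "real^'m^'m \<Rightarrow> real^'m::finite \<Rightarrow> real^'m \<Rightarrow> real" where
  "mip G v w = v \<bullet> (G *v w)"

definition posdef :: "real^'m::finite^'m \<Rightarrow> bool" where
  "posdef G \<longleftrightarrow> transpose G = G \<and> (\<forall>v. v \<noteq> 0 \<longrightarrow> mip G v v > 0)"

definition orthonormal_frame :: "real^'m::finite^'m \<Rightarrow> ('m \<Rightarrow> real^'m) \<Rightarrow> bool" where
  "orthonormal_frame G E \<longleftrightarrow> (\<forall>a b. mip G (E a) (E b) = (if a = b then 1 else 0))"

lemma bilinear_mip: "bilinear (mip G)"
  unfolding bilinear_def mip_def
  by (auto intro!: linearI simp: inner_add_left inner_add_right matrix_vector_right_distrib
      matrix_vector_mult_scaleR)

lemmas mip_add_left = bilinear_ladd[OF bilinear_mip]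
  and mip_add_right = bilinear_radd[OF bilinear_mip]
  and mip_diff_left = bilinear_lsub[OF bilinear_mip]
  and mip_diff_right = bilinear_rsub[OF bilinear_mip]
  and mip_minus_left = bilinear_lneg[OF bilinear_mip]
  and mip_scale_left = bilinear_lmul[OF bilinear_mip, unfolded real_scaleR_def]
  and mip_scale_right = bilinear_rmul[OF bilinear_mip, unfolded real_scaleR_def]
  and mip_zero_left [simp] = bilinear_lzero[OF bilinear_mip]
  and mip_zero_right [simp] = bilinear_rzero[OF bilinear_mip]

lemma mip_sum_left: "mip G (\<Sum>i\<in>I. f i) w = (\<Sum>i\<in>I. mip G (f i) w)"
  unfolding mip_def by (simp add: inner_sum_left)

lemma mip_sum_right: "mip G w (\<Sum>i\<in>I. f i) = (\<Sum>i\<in>I. mip G w (f i))"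
  unfolding mip_def by (induction I rule: infinite_finite_induct)
    (auto simp: matrix_vector_right_distrib inner_add_right)

lemma mip_expand: "mip G v w = (\<Sum>i\<in>UNIV. \<Sum>j\<in>UNIV. G $ i $ j * v $ i * w $ j)"
  unfolding mip_def inner_vec_def matrix_vector_mult_def by (simp add: sum_distrib_left mult_ac)

lemma mip_axis: "mip G (axis i 1) (axis j 1) = G $ i $ j"
  unfolding mip_def by (simp add: inner_axis' matrix_vector_mult_basis column_def)

lemma mip_transpose: "mip (transpose G) v w = mip G w v"
  unfolding mip_expand by (subst sum.swap) (simp add: transpose_def mult_ac)

lemma mip_commute: "transpose G = G \<Longrightarrow> mip G v w = mip G w v"
  using mip_transpose by metis

lemma posdef_commute: "posdef G \<Longrightarrow> mip G v w = mip G w v"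
  unfolding posdef_def using mip_commute by blast

lemma posdef_ge0: "posdef G \<Longrightarrow> mip G v v \<ge> 0"
  unfolding posdef_def by (cases "v = 0") (auto simp: less_imp_le)

lemma posdef_eq0: "posdef G \<Longrightarrow> mip G v v = 0 \<Longrightarrow> v = 0"
  unfolding posdef_def by force

lemma posdef_invertible:
  assumes "posdef G"
  shows "invertible G"
proof -
  have "x = 0" if "G *v x = 0" for x
    using that assms posdef_eq0[of G x] by (simp add: mip_def)
  then show ?thesis
    unfolding invertible_left_inverse matrix_left_invertible_ker by blast
qed

lemma matrix_inv_mult:
  fixes G :: "real^'m::finite^'m"
  assumes "invertible G"
  shows "G ** matrix_inv G = mat 1" "matrix_inv G ** G = mat 1"
proof -
  have "\<exists>A'. G ** A' = mat 1 \<and> A' ** G = mat 1" using assms unfolding invertible_def by blast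
  from someI_ex[OF this] show "G ** matrix_inv G = mat 1" "matrix_inv G ** G = mat 1"
    unfolding matrix_inv_def by auto
qed

lemma matrix_inv_eqI:
  fixes G :: "real^'m::finite^'m"
  assumes "G ** B = mat 1"
  shows "matrix_inv G = B"
proof -
  have "B ** G = mat 1" using assms by (simp add: matrix_left_right_inverse)
  then have "invertible G" using assms unfolding invertible_def by blast
  have "matrix_inv G = matrix_inv G ** (G ** B)" using assms by simp
  also have "\<dots> = (matrix_inv G ** G) ** B" by (simp add: matrix_mul_assoc)
  also have "\<dots> = B" using matrix_inv_mult[OF \<open>invertible G\<close>] by simp
  finally show ?thesis .
qed

text \<open>Fewer vectors than the dimension do not span; a vector outside their span, minus its
  projection onto them, is non-zero and can be normalized.\<close>

lemma mip_Gram_Schmidt: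
  fixes G :: "real^'m::finite^'m"
  assumes G: "posdef G" and k: "k \<le> CARD('m)"
  shows "\<exists>B. finite B \<and> card B = k \<and> (\<forall>v\<in>B. \<forall>w\<in>B. mip G v w = (if v = w then 1 else 0))"
  using k
proof (induction k)
  case 0
  show ?case by (rule exI[of _ "{}"]) simp
next
  case (Suc k)
  then have "k \<le> CARD('m)" by simp
  with Suc.IH obtain B where B: "finite B" "card B = k"
    and on: "\<forall>v\<in>B. \<forall>w\<in>B. mip G v w = (if v = w then 1 else 0)" by blast
  have "span B \<noteq> UNIV"
  proof
    assume "span B = UNIV"
    then have "dim (UNIV :: (real^'m) set) \<le> card B"
      using dim_le_card[of UNIV B] B(1) by simp
    then show False using B(2) Suc.prems by simp
  qed
  then obtain x where x: "x \<notin> span B" by blast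
  define z where "z = x - (\<Sum>b\<in>B. mip G x b *\<^sub>R b)"
  have "z \<noteq> 0"
  proof
    assume "z = 0"
    then have "x = (\<Sum>b\<in>B. mip G x b *\<^sub>R b)" by (simp add: z_def)
    also have "\<dots> \<in> span B" by (intro span_sum span_scale span_base)
    finally show False using x by blast
  qed
  then have pos: "mip G z z > 0" using G unfolding posdef_def by blast
  have orth: "mip G z b = 0" if "b \<in> B" for b
  proof -
    have "(\<Sum>c\<in>B. mip G x c * mip G c b) = (\<Sum>c\<in>B. if c = b then mip G x b else 0)"
      by (rule sum.cong) (use on that in auto)
    also have "\<dots> = mip G x b" using B(1) that by (simp add: sum.delta)
    finally show ?thesis
      by (simp add: z_def mip_diff_left mip_sum_left mip_scale_left)
  qed
  define n where "n = (1 / sqrt (mip G z z)) *\<^sub>R z"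
  have nn: "mip G n n = 1"
    using pos by (simp add: n_def mip_scale_left mip_scale_right)
  have nb: "mip G n b = 0" "mip G b n = 0" if "b \<in> B" for b
    using orth[OF that] posdef_commute[OF G, of b] by (auto simp: n_def mip_scale_left)
  have "n \<notin> B" using nn nb(1)[of n] by auto
  then have "card (insert n B) = Suc k" using B by simp
  moreover have "\<forall>v\<in>insert n B. \<forall>w\<in>insert n B. mip G v w = (if v = w then 1 else 0)"
    using on nn nb \<open>n \<notin> B\<close> by auto
  ultimately show ?case using B(1) by (intro exI[of _ "insert n B"]) simp
qed

lemma orthonormal_frame_exists:
  fixes G :: "real^'m::finite^'m"
  assumes "posdef G"
  obtains E where "orthonormal_frame G E"
proof -
  obtain B where B: "finite B" "card B = CARD('m)"
    "\<forall>v\<in>B. \<forall>w\<in>B. mip G v w = (if v = w then 1 else 0)"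
    using mip_Gram_Schmidt[OF assms order_refl] by blast
  then obtain E where E: "bij_betw E (UNIV :: 'm set) B"
    using finite_same_card_bij[OF finite_class.finite_UNIV B(1) B(2)[symmetric]] by blast
  then have "inj E" "\<And>a. E a \<in> B" by (auto simp: bij_betw_def)
  then have "mip G (E a) (E b) = (if a = b then 1 else 0)" for a b
    using B(3) by (simp add: inj_eq)
  then show thesis using that unfolding orthonormal_frame_def by blast
qed

text \<open>For the matrix Q with columns \<open>E a\<close>, orthonormality reads Q^T G Q = 1;
  moving Q^T to the other side gives G Q Q^T = 1, so the inverse is Q Q^T. This is what converts
  contractions with the inverse metric into frame sums.\<close>

lemma orthonormal_frame_inverse:
  assumes "orthonormal_frame G E"
  shows "matrix_inv G $ i $ j = (\<Sum>a\<in>UNIV. E a $ i * E a $ j)"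
proof -
  define Q where "Q = (\<chi> i a. E a $ i)"
  have 1: "(transpose Q ** (G ** Q)) $ a $ b = mip G (E a) (E b)" for a b
    unfolding matrix_matrix_mult_def transpose_def Q_def mip_expand
    by (simp add: sum_distrib_left mult_ac)
  have "transpose Q ** (G ** Q) = mat 1"
    using assms unfolding vec_eq_iff 1 orthonormal_frame_def mat_def by simp
  then have "(G ** Q) ** transpose Q = mat 1" by (simp add: matrix_left_right_inverse)
  then have "matrix_inv G = Q ** transpose Q"
    by (intro matrix_inv_eqI) (simp add: matrix_mul_assoc)
  then show ?thesis by (simp add: matrix_matrix_mult_def transpose_def Q_def)
qed

lemma orthonormal_frame_expand:
  assumes "orthonormal_frame G E" "posdef G"
  shows "v = (\<Sum>a\<in>UNIV. mip G v (E a) *\<^sub>R E a)"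
proof -
  have "(\<Sum>a\<in>UNIV. mip G v (E a) *\<^sub>R E a) $ i = v $ i" for i
  proof -
    have G: "transpose G = G" using assms unfolding posdef_def by blast
    have "(\<Sum>a\<in>UNIV. mip G v (E a) *\<^sub>R E a) $ i = (\<Sum>a\<in>UNIV. \<Sum>k\<in>UNIV. E a $ i * E a $ k * (G *v v) $ k)"
      unfolding mip_commute[OF G, of v]
      by (simp add: mip_def inner_vec_def sum_distrib_left sum_distrib_right mult_ac)
    also have "\<dots> = (\<Sum>k\<in>UNIV. matrix_inv G $ i $ k * (G *v v) $ k)"
      unfolding orthonormal_frame_inverse[OF assms(1)] sum_distrib_right by (rule sum.swap)
    also have "\<dots> = (matrix_inv G *v (G *v v)) $ i"
      by (simp add: matrix_vector_mult_def)
    also have "\<dots> = v $ i"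
      by (simp add: matrix_vector_mul_assoc matrix_inv_mult[OF posdef_invertible[OF assms(2)]])
    finally show ?thesis .
  qed
  then show ?thesis by (simp add: vec_eq_iff)
qed

section \<open>Traces with respect to a metric, and their derivatives when the metric varies\<close>

lemma vec_axis_expand: "(v :: real^'m::finite) = (\<Sum>i\<in>UNIV. v $ i *\<^sub>R axis i 1)"
proof -
  have "(\<Sum>i\<in>UNIV. v $ i *\<^sub>R axis i 1) $ k = (\<Sum>i\<in>UNIV. if i = k then v $ k else 0)" for k
    unfolding sum_component by (rule sum.cong) (auto simp: axis_def)
  then show ?thesis by (simp add: vec_eq_iff)
qed

lemma linear_axis_expand:
  fixes L :: "real^'m::finite \<Rightarrow> 'f::real_vector"
  assumes "linear L"
  shows "L v = (\<Sum>i\<in>UNIV. v $ i *\<^sub>R L (axis i 1))"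
  by (subst vec_axis_expand[of v]) (simp add: linear_sum[OF assms] linear_scale[OF assms])

lemma bilinear_axis_expand:
  fixes B :: "real^'m::finite \<Rightarrow> real^'k::finite \<Rightarrow> 'f::real_vector"
  assumes "bilinear B"
  shows "B v w = (\<Sum>i\<in>UNIV. \<Sum>j\<in>UNIV. (v $ i * w $ j) *\<^sub>R B (axis i 1) (axis j 1))"
proof -
  have "B v w = (\<Sum>i\<in>UNIV. v $ i *\<^sub>R B (axis i 1) w)"
    using linear_axis_expand[of "\<lambda>v. B v w" v] assms unfolding bilinear_def by blast
  also have "\<dots> = (\<Sum>i\<in>UNIV. v $ i *\<^sub>R (\<Sum>j\<in>UNIV. w $ j *\<^sub>R B (axis i 1) (axis j 1)))"
    using linear_axis_expand[of "B (axis _ 1)" w] assms unfolding bilinear_def by metis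
  finally show ?thesis by (simp add: scaleR_sum_right)
qed

definition mtrace :: "real^'m::finite^'m \<Rightarrow> (real^'m \<Rightarrow> real^'m \<Rightarrow> 'f::real_vector) \<Rightarrow> 'f" where
  "mtrace G B = (\<Sum>i\<in>UNIV. \<Sum>j\<in>UNIV. matrix_inv G $ i $ j *\<^sub>R B (axis i 1) (axis j 1))"

lemma mtrace_frame:
  assumes "orthonormal_frame G E" "bilinear B"
  shows "mtrace G B = (\<Sum>a\<in>UNIV. B (E a) (E a))"
proof -
  have "(\<Sum>a\<in>UNIV. B (E a) (E a))
      = (\<Sum>a\<in>UNIV. \<Sum>i\<in>UNIV. \<Sum>j\<in>UNIV. (E a $ i * E a $ j) *\<^sub>R B (axis i 1) (axis j 1))"
    by (rule sum.cong[OF refl]) (rule bilinear_axis_expand[OF assms(2)])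
  also have "\<dots> = (\<Sum>i\<in>UNIV. \<Sum>a\<in>UNIV. \<Sum>j\<in>UNIV. (E a $ i * E a $ j) *\<^sub>R B (axis i 1) (axis j 1))"
    by (rule sum.swap)
  also have "\<dots> = mtrace G B"
    unfolding mtrace_def orthonormal_frame_inverse[OF assms(1)] scaleR_sum_left
    by (intro sum.cong refl sum.swap)
  finally show ?thesis ..
qed

text \<open>Cramer's rule makes the entries of the inverse quotients of determinants, from which its
  differentiability and continuity are read off.\<close>

lemma matrix_inv_cramer:
  fixes G :: "real^'m::finite^'m"
  assumes "invertible G"
  shows "matrix_inv G $ k $ j = det (\<chi> i l. if l = k then axis j 1 $ i else G $ i $ l) / det G"
proof -
  have d: "det G \<noteq> 0" using assms by (simp add: invertible_det_nz)
  have "G *v (matrix_inv G *v axis j 1) = axis j 1"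
    by (simp add: matrix_vector_mul_assoc matrix_inv_mult[OF assms])
  then have "matrix_inv G *v axis j 1 = (\<chi> k. det (\<chi> i l. if l = k then axis j 1 $ i else G $ i $ l) / det G)"
    using cramer[OF d] by blast
  then have "(matrix_inv G *v axis j 1) $ k = det (\<chi> i l. if l = k then axis j 1 $ i else G $ i $ l) / det G"
    by simp
  moreover have "(matrix_inv G *v axis j 1) $ k = matrix_inv G $ k $ j"
    by (simp add: matrix_vector_mult_basis column_def)
  ultimately show ?thesis by simp
qed

lemma differentiable_det:
  fixes G :: "'e::real_normed_vector \<Rightarrow> real^'m::finite^'m"
  assumes "\<And>i j. (\<lambda>z. G z $ i $ j) differentiable at y"
  shows "(\<lambda>z. det (G z)) differentiable at y"
proof -
  have "\<exists>D. ((\<lambda>z. G z $ i $ j) has_derivative D) (at y)" for i j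
    using assms differentiable_def by blast
  then obtain D where D: "\<And>i j. ((\<lambda>z. G z $ i $ j) has_derivative D i j) (at y)" by metis
  show ?thesis unfolding det_def
    by (rule differentiableI, rule derivative_intros, rule has_derivative_mult, rule has_derivative_const,
        rule has_derivative_prod, rule D)
qed

lemma differentiable_matrix_inv:
  fixes G :: "'e::real_normed_vector \<Rightarrow> real^'m::finite^'m"
  assumes G: "\<And>i j. (\<lambda>z. G z $ i $ j) differentiable at y"
    and S: "open S" "y \<in> S" "\<And>z. z \<in> S \<Longrightarrow> invertible (G z)"
  shows "(\<lambda>z. matrix_inv (G z) $ k $ j) differentiable at y"
proof -
  have "(\<lambda>z. det (\<chi> i l. if l = k then axis j 1 $ i else G z $ i $ l)) differentiable at y"
  proof (rule differentiable_det)
    show "(\<lambda>z. (\<chi> i l. if l = k then axis j 1 $ i else G z $ i $ l) $ i $ l) differentiable at y" for i l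
      by (cases "l = k") (simp_all add: G)
  qed
  then have "(\<lambda>z. det (\<chi> i l. if l = k then axis j 1 $ i else G z $ i $ l) / det (G z)) differentiable at y"
    using differentiable_det[OF G] S(2,3) invertible_det_nz by (intro differentiable_divide) auto
  then obtain D where "((\<lambda>z. det (\<chi> i l. if l = k then axis j 1 $ i else G z $ i $ l) / det (G z)) has_derivative D) (at y)"
    unfolding differentiable_def by blast
  then have "((\<lambda>z. matrix_inv (G z) $ k $ j) has_derivative D) (at y)"
    by (rule has_derivative_transform_within_open[OF _ S(1,2)]) (simp add: matrix_inv_cramer[OF S(3)])
  then show ?thesis by (rule differentiableI)
qed

lemma continuous_on_det:
  fixes G :: "'e::topological_space \<Rightarrow> real^'m::finite^'m"
  assumes "\<And>i j. continuous_on S (\<lambda>z. G z $ i $ j)"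
  shows "continuous_on S (\<lambda>z. det (G z))"
  unfolding det_def by (intro continuous_intros assms)

lemma continuous_on_matrix_inv:
  fixes G :: "'e::topological_space \<Rightarrow> real^'m::finite^'m"
  assumes G: "continuous_on S G" and S: "\<And>z. z \<in> S \<Longrightarrow> invertible (G z)"
  shows "continuous_on S (\<lambda>z. matrix_inv (G z) $ k $ j)"
proof -
  have Gij: "continuous_on S (\<lambda>z. G z $ i $ j)" for i j
    using G by (intro continuous_intros)
  have "continuous_on S (\<lambda>z. det (\<chi> i l. if l = k then axis j 1 $ i else G z $ i $ l))"
  proof (rule continuous_on_det)
    show "continuous_on S (\<lambda>z. (\<chi> i l. if l = k then axis j 1 $ i else G z $ i $ l) $ i $ l)" for i l
      by (cases "l = k") (simp_all add: Gij)
  qed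
  moreover have "continuous_on S (\<lambda>z. det (G z))"
    by (rule continuous_on_det[OF Gij])
  ultimately have "continuous_on S (\<lambda>z. det (\<chi> i l. if l = k then axis j 1 $ i else G z $ i $ l) / det (G z))"
    using S invertible_det_nz by (intro continuous_intros) auto
  then show ?thesis
    by (rule continuous_on_eq) (simp add: matrix_inv_cramer[OF S])
qed

lemma has_derivative_entry:
  assumes "(G has_derivative G') F"
  shows "((\<lambda>z. (G z :: real^'k::finite^'l::finite) $ i $ j) has_derivative (\<lambda>u. G' u $ i $ j)) F"
  using assms by (intro bounded_linear.has_derivative[OF bounded_linear_vec_nth])

text \<open>The product rule for G^-1 G = 1 gives (G^-1)' = - G^-1 G' G^-1, and both outer factors
  are expanded in the frame. Only the frame at \<open>y\<close> occurs; no frame field has to be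
  differentiated.\<close>

lemma has_derivative_matrix_inv:
  fixes G :: "'e::real_normed_vector \<Rightarrow> real^'m::finite^'m"
  assumes G: "(G has_derivative G') (at y)"
    and S: "open S" "y \<in> S" "\<And>z. z \<in> S \<Longrightarrow> posdef (G z)"
    and E: "orthonormal_frame (G y) E"
  shows "((\<lambda>z. matrix_inv (G z) $ i $ j) has_derivative
    (\<lambda>u. - (\<Sum>a\<in>UNIV. \<Sum>b\<in>UNIV. mip (G' u) (E a) (E b) * E a $ i * E b $ j))) (at y)"
proof -
  let ?P = "\<lambda>z. matrix_inv (G z)"
  note inv = posdef_invertible[OF S(3)]
  have dG: "((\<lambda>z. G z $ i $ j) has_derivative (\<lambda>u. G' u $ i $ j)) (at y)" for i j
    by (rule has_derivative_entry[OF G])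
  have "(\<lambda>z. ?P z $ i $ j) differentiable at y" for i j
    by (rule differentiable_matrix_inv[OF differentiableI[OF dG] S(1,2) inv])
  then have "\<exists>D. ((\<lambda>z. ?P z $ i $ j) has_derivative D) (at y)" for i j
    unfolding differentiable_def by blast
  then obtain D where D: "\<And>i j. ((\<lambda>z. ?P z $ i $ j) has_derivative D i j) (at y)" by metis
  have eq: "(\<Sum>k\<in>UNIV. D i k u * G y $ k $ j) = - (\<Sum>k\<in>UNIV. ?P y $ i $ k * G' u $ k $ j)" for i j u
  proof -
    have 1: "((\<lambda>z. \<Sum>k\<in>UNIV. ?P z $ i $ k * G z $ k $ j) has_derivative
        (\<lambda>u. \<Sum>k\<in>UNIV. ?P y $ i $ k * G' u $ k $ j + D i k u * G y $ k $ j)) (at y)"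
      by (intro has_derivative_sum has_derivative_mult D dG)
    have 2: "(\<Sum>k\<in>UNIV. ?P z $ i $ k * G z $ k $ j) = mat 1 $ i $ j" if "z \<in> S" for z
    proof -
      have "(?P z ** G z) $ i $ j = mat 1 $ i $ j"
        using matrix_inv_mult(2)[OF inv[OF that]] by simp
      then show ?thesis by (simp add: matrix_matrix_mult_def)
    qed
    from has_derivative_transform_within_open[OF 1 S(1,2) 2]
    have "((\<lambda>z. mat 1 $ i $ j) has_derivative
        (\<lambda>u. \<Sum>k\<in>UNIV. ?P y $ i $ k * G' u $ k $ j + D i k u * G y $ k $ j)) (at y)" .
    from has_derivative_unique[OF this has_derivative_const]
    have "(\<lambda>u. \<Sum>k\<in>UNIV. ?P y $ i $ k * G' u $ k $ j + D i k u * G y $ k $ j) = (\<lambda>u. 0)" .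
    from fun_cong[OF this, of u]
    have "(\<Sum>k\<in>UNIV. ?P y $ i $ k * G' u $ k $ j + D i k u * G y $ k $ j) = 0" .
    then show ?thesis by (simp add: sum.distrib)
  qed
  have "D i j u = - (\<Sum>a\<in>UNIV. \<Sum>b\<in>UNIV. mip (G' u) (E a) (E b) * E a $ i * E b $ j)" for u
  proof -
    define D' where "D' = (\<chi> i j. D i j u)"
    have "D' ** G y = - (?P y ** G' u)"
      using eq by (simp add: D'_def vec_eq_iff matrix_matrix_mult_def)
    then have "(D' ** G y) ** ?P y = - (?P y ** G' u) ** ?P y" by (rule arg_cong)
    then have "D' ** (G y ** ?P y) = - (?P y ** G' u) ** ?P y"
      by (simp only: matrix_mul_assoc)
    then have D'2: "D' = - (?P y ** G' u) ** ?P y"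
      by (simp add: matrix_inv_mult[OF inv[OF S(2)]])
    have "D i j u = D' $ i $ j" by (simp add: D'_def)
    also have "\<dots> = - (\<Sum>l\<in>UNIV. \<Sum>k\<in>UNIV. G' u $ k $ l * ?P y $ i $ k * ?P y $ l $ j)"
      unfolding D'2 by (simp add: matrix_matrix_mult_def sum_distrib_left sum_distrib_right sum_negf mult_ac)
    also have "\<dots> = - (\<Sum>k\<in>UNIV. \<Sum>l\<in>UNIV. G' u $ k $ l * ?P y $ i $ k * ?P y $ l $ j)"
      by (subst sum.swap) simp
    also have "\<dots> = - mip (G' u) (\<Sum>a\<in>UNIV. E a $ i *\<^sub>R E a) (\<Sum>b\<in>UNIV. E b $ j *\<^sub>R E b)"
      unfolding mip_expand orthonormal_frame_inverse[OF E] by (simp add: sum_component mult_ac)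
    also have "\<dots> = - (\<Sum>a\<in>UNIV. \<Sum>b\<in>UNIV. mip (G' u) (E a) (E b) * E a $ i * E b $ j)"
      by (simp add: mip_sum_left mip_sum_right mip_scale_left mip_scale_right sum_distrib_left mult_ac)
        (subst sum.swap, simp add: mult_ac)
    finally show ?thesis .
  qed
  then have "D i j = (\<lambda>u. - (\<Sum>a\<in>UNIV. \<Sum>b\<in>UNIV. mip (G' u) (E a) (E b) * E a $ i * E b $ j))" ..
  then show ?thesis using D[of i j] by simp
qed

text \<open>The product rule with the inverse matrix as one factor. In this form, with an arbitrary
  derivative \<open>G'\<close>, it serves the time direction, where \<open>G'\<close> is the
  right-hand side of the flow.\<close>

lemma mtrace_has_derivative:
  fixes G :: "'e::real_normed_vector \<Rightarrow> real^'m::finite^'m"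
    and B :: "'e \<Rightarrow> real^'m \<Rightarrow> real^'m \<Rightarrow> 'f::real_normed_vector"
  assumes G: "(G has_derivative G') (at y)"
    and S: "open S" "y \<in> S" "\<And>z. z \<in> S \<Longrightarrow> posdef (G z)"
    and E: "orthonormal_frame (G y) E"
    and B: "\<And>i j. ((\<lambda>z. B z (axis i 1) (axis j 1)) has_derivative (\<lambda>u. B' u (axis i 1) (axis j 1))) (at y)"
    and bil: "bilinear (B y)" "\<And>u. bilinear (B' u)"
  shows "((\<lambda>z. mtrace (G z) (B z)) has_derivative
    (\<lambda>u. (\<Sum>a\<in>UNIV. B' u (E a) (E a))
        - (\<Sum>a\<in>UNIV. \<Sum>b\<in>UNIV. mip (G' u) (E a) (E b) *\<^sub>R B y (E a) (E b)))) (at y)"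
proof -
  let ?P' = "\<lambda>u i j. - (\<Sum>a\<in>UNIV. \<Sum>b\<in>UNIV. mip (G' u) (E a) (E b) * E a $ i * E b $ j)"
  have 1: "((\<lambda>z. mtrace (G z) (B z)) has_derivative
    (\<lambda>u. \<Sum>i\<in>UNIV. \<Sum>j\<in>UNIV. matrix_inv (G y) $ i $ j *\<^sub>R B' u (axis i 1) (axis j 1)
        + ?P' u i j *\<^sub>R B y (axis i 1) (axis j 1))) (at y)"
    unfolding mtrace_def
    by (intro has_derivative_sum has_derivative_scaleR B has_derivative_matrix_inv[OF G S E])
  have 2: "(\<Sum>i\<in>UNIV. \<Sum>j\<in>UNIV. ?P' u i j *\<^sub>R B y (axis i 1) (axis j 1))
    = - (\<Sum>a\<in>UNIV. \<Sum>b\<in>UNIV. mip (G' u) (E a) (E b) *\<^sub>R B y (E a) (E b))" for u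
  proof -
    have "(\<Sum>a\<in>UNIV. \<Sum>b\<in>UNIV. mip (G' u) (E a) (E b) *\<^sub>R B y (E a) (E b))
      = (\<Sum>a\<in>UNIV. \<Sum>b\<in>UNIV. \<Sum>i\<in>UNIV. \<Sum>j\<in>UNIV.
          (mip (G' u) (E a) (E b) * E a $ i * E b $ j) *\<^sub>R B y (axis i 1) (axis j 1))"
      (is "_ = (\<Sum>a\<in>_. \<Sum>b\<in>_. \<Sum>i\<in>_. \<Sum>j\<in>_. ?t a b i j)")
      by (subst bilinear_axis_expand[OF bil(1)]) (simp add: scaleR_sum_right mult.assoc)
    also have "\<dots> = (\<Sum>a\<in>UNIV. \<Sum>i\<in>UNIV. \<Sum>b\<in>UNIV. \<Sum>j\<in>UNIV. ?t a b i j)"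
      by (intro sum.cong refl sum.swap)
    also have "\<dots> = (\<Sum>i\<in>UNIV. \<Sum>a\<in>UNIV. \<Sum>b\<in>UNIV. \<Sum>j\<in>UNIV. ?t a b i j)"
      by (rule sum.swap)
    also have "\<dots> = (\<Sum>i\<in>UNIV. \<Sum>a\<in>UNIV. \<Sum>j\<in>UNIV. \<Sum>b\<in>UNIV. ?t a b i j)"
      by (intro sum.cong refl sum.swap)
    also have "\<dots> = (\<Sum>i\<in>UNIV. \<Sum>j\<in>UNIV. \<Sum>a\<in>UNIV. \<Sum>b\<in>UNIV. ?t a b i j)"
      by (intro sum.cong refl sum.swap)
    finally show ?thesis by (simp add: scaleR_sum_left sum_negf)
  qed
  have 3: "(\<Sum>i\<in>UNIV. \<Sum>j\<in>UNIV. matrix_inv (G y) $ i $ j *\<^sub>R B' u (axis i 1) (axis j 1))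
      = (\<Sum>a\<in>UNIV. B' u (E a) (E a))" for u
    using mtrace_frame[OF E bil(2)] unfolding mtrace_def .
  show ?thesis using 1 unfolding sum.distrib 2 3 by simp
qed

text \<open>The hypothesis on \<open>C\<close> is metric compatibility. Expanding
  \<open>C u (E a)\<close> in the frame turns the contribution of \<open>G'\<close> into the two
  correction terms of a covariant derivative: the trace commutes with the connection.\<close>

lemma mtrace_has_derivative_connection:
  fixes G :: "'e::real_normed_vector \<Rightarrow> real^'m::finite^'m"
    and B :: "'e \<Rightarrow> real^'m \<Rightarrow> real^'m \<Rightarrow> 'f::real_normed_vector"
  assumes G: "(G has_derivative G') (at y)"
    and S: "open S" "y \<in> S" "\<And>z. z \<in> S \<Longrightarrow> posdef (G z)"
    and E: "orthonormal_frame (G y) E"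
    and B: "\<And>i j. ((\<lambda>z. B z (axis i 1) (axis j 1)) has_derivative (\<lambda>u. B' u (axis i 1) (axis j 1))) (at y)"
    and bil: "bilinear (B y)" "\<And>u. bilinear (B' u)"
    and C: "\<And>u v w. mip (G' u) v w = mip (G y) (C u v) w + mip (G y) v (C u w)"
  shows "((\<lambda>z. mtrace (G z) (B z)) has_derivative
    (\<lambda>u. \<Sum>a\<in>UNIV. B' u (E a) (E a) - B y (C u (E a)) (E a) - B y (E a) (C u (E a)))) (at y)"
proof -
  note P = S(3)[OF S(2)]
  have left: "(\<Sum>b\<in>UNIV. mip (G y) v (E b) *\<^sub>R B y w (E b)) = B y w v" for v w
  proof -
    have "B y w v = B y w (\<Sum>b\<in>UNIV. mip (G y) v (E b) *\<^sub>R E b)"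
      using orthonormal_frame_expand[OF E P, of v] by simp
    also have "\<dots> = (\<Sum>b\<in>UNIV. mip (G y) v (E b) *\<^sub>R B y w (E b))"
      using bil(1) unfolding bilinear_def by (simp add: linear_sum linear_scale)
    finally show ?thesis ..
  qed
  have right: "(\<Sum>b\<in>UNIV. mip (G y) (E b) v *\<^sub>R B y (E b) w) = B y v w" for v w
  proof -
    have "B y v w = B y (\<Sum>b\<in>UNIV. mip (G y) v (E b) *\<^sub>R E b) w"
      using orthonormal_frame_expand[OF E P, of v] by simp
    also have "\<dots> = (\<Sum>b\<in>UNIV. B y (mip (G y) v (E b) *\<^sub>R E b) w)"
      using linear_sum[of "\<lambda>v. B y v w"] bil(1) unfolding bilinear_def by blast
    also have "\<dots> = (\<Sum>b\<in>UNIV. mip (G y) (E b) v *\<^sub>R B y (E b) w)"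
      by (simp add: bilinear_lmul[OF bil(1)] posdef_commute[OF P, of v])
    finally show ?thesis ..
  qed
  have "(\<Sum>a\<in>UNIV. \<Sum>b\<in>UNIV. mip (G' u) (E a) (E b) *\<^sub>R B y (E a) (E b))
      = (\<Sum>a\<in>UNIV. \<Sum>b\<in>UNIV. mip (G y) (C u (E a)) (E b) *\<^sub>R B y (E a) (E b))
      + (\<Sum>a\<in>UNIV. \<Sum>b\<in>UNIV. mip (G y) (E a) (C u (E b)) *\<^sub>R B y (E a) (E b))" for u
    unfolding C by (simp add: scaleR_add_left sum.distrib)
  also have "(\<Sum>a\<in>UNIV. \<Sum>b\<in>UNIV. mip (G y) (E a) (C u (E b)) *\<^sub>R B y (E a) (E b))
      = (\<Sum>b\<in>UNIV. \<Sum>a\<in>UNIV. mip (G y) (E a) (C u (E b)) *\<^sub>R B y (E a) (E b))" for u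
    by (rule sum.swap)
  finally have *: "(\<Sum>a\<in>UNIV. \<Sum>b\<in>UNIV. mip (G' u) (E a) (E b) *\<^sub>R B y (E a) (E b))
      = (\<Sum>a\<in>UNIV. B y (E a) (C u (E a))) + (\<Sum>a\<in>UNIV. B y (C u (E a)) (E a))" for u
    unfolding left right .
  have "(\<Sum>a\<in>UNIV. B' u (E a) (E a) - B y (C u (E a)) (E a) - B y (E a) (C u (E a)))
      = (\<Sum>a\<in>UNIV. B' u (E a) (E a))
        - ((\<Sum>a\<in>UNIV. B y (E a) (C u (E a))) + (\<Sum>a\<in>UNIV. B y (C u (E a)) (E a)))" for u
    by (simp add: sum_subtractf)
  then show ?thesis
    using mtrace_has_derivative[OF G S E B bil] unfolding * by simp
qed

section \<open>Levi-Civita connection and curvature as multilinear maps\<close>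

text \<open>\<open>conn G y u v\<close> is \<open>\<Gamma>(u, v)\<close>, \<open>dconn G y b\<close> the derivative of \<open>\<Gamma>\<close> in direction \<open>b\<close>, and
  \<open>curv G y b a c\<close> is \<open>R(b, a) c\<close>.\<close>

definition conn :: "(real^'m::finite \<Rightarrow> real^'m^'m) \<Rightarrow> real^'m \<Rightarrow> real^'m \<Rightarrow> real^'m \<Rightarrow> real^'m" where
  "conn G y u v = (\<chi> k. \<Sum>i\<in>UNIV. \<Sum>j\<in>UNIV. christoffel G y k i j * u $ i * v $ j)"

definition dconn :: "(real^'m::finite \<Rightarrow> real^'m^'m) \<Rightarrow> real^'m \<Rightarrow> real^'m \<Rightarrow> real^'m \<Rightarrow> real^'m \<Rightarrow> real^'m" where
  "dconn G y b u v = (\<chi> k. \<Sum>i\<in>UNIV. \<Sum>j\<in>UNIV.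
     dir_deriv (\<lambda>z. christoffel G z k i j) y b * u $ i * v $ j)"

definition curv :: "(real^'m::finite \<Rightarrow> real^'m^'m) \<Rightarrow> real^'m \<Rightarrow> real^'m \<Rightarrow> real^'m \<Rightarrow> real^'m \<Rightarrow> real^'m" where
  "curv G y b a c = dconn G y b a c - dconn G y a b c
     + conn G y b (conn G y a c) - conn G y a (conn G y b c)"

lemma bilinear_tensor:
  "bilinear (\<lambda>u v. (\<chi> k. \<Sum>i\<in>UNIV. \<Sum>j\<in>UNIV. T k i j * u $ i * v $ j) :: real^'k::finite)"
  unfolding bilinear_def
  by (auto intro!: linearI simp: vec_eq_iff algebra_simps sum.distrib sum_distrib_left)

lemma bilinear_conn: "bilinear (conn G y)"
  using bilinear_tensor[of "christoffel G y"] unfolding conn_def[abs_def] .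

lemma bilinear_dconn: "bilinear (dconn G y b)"
  using bilinear_tensor unfolding dconn_def[abs_def] .

lemmas conn_add_right = bilinear_radd[OF bilinear_conn]
  and conn_diff_right = bilinear_rsub[OF bilinear_conn]

lemma mip_scaleR_matrix: "mip (c *\<^sub>R A) v w = c * mip A v w"
  unfolding mip_expand by (simp add: sum_distrib_left mult_ac)

lemma mip_add_matrix: "mip (A + B) v w = mip A v w + mip B v w"
  unfolding mip_expand by (simp add: algebra_simps sum.distrib)

lemma linear_mip_matrix: "linear (\<lambda>A. mip A v w)"
  by (rule linearI) (simp_all add: mip_scaleR_matrix mip_add_matrix)

locale coord_metric =
  fixes U :: "(real^'m::finite) set" and G :: "real^'m \<Rightarrow> real^'m^'m"
  assumes smooth: "smooth_in U G" and pos: "\<And>y. y \<in> U \<Longrightarrow> posdef (G y)"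
begin

lemma open_U: "open U"
  using smooth unfolding smooth_in_def by blast

lemmas dG = smooth_in_has_derivative[OF smooth]

lemma linear_dG: "y \<in> U \<Longrightarrow> linear (dir_deriv G y)"
  by (rule smooth_in_linear[OF smooth])

lemma dG_commute:
  assumes "y \<in> U"
  shows "mip (dir_deriv G y u) v w = mip (dir_deriv G y u) w v"
proof (rule mip_commute)
  have "dir_deriv G y u $ i $ j = dir_deriv G y u $ j $ i" for i j
  proof -
    have ij: "((\<lambda>z. G z $ i $ j) has_derivative (\<lambda>u. dir_deriv G y u $ i $ j)) (at y)"
      by (rule has_derivative_entry[OF dG[OF assms]])
    have sym: "G z $ i $ j = G z $ j $ i" if "z \<in> U" for z
    proof -
      have "transpose (G z) $ i $ j = G z $ i $ j" using pos[OF that] unfolding posdef_def by simp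
      then show ?thesis by (simp add: transpose_def)
    qed
    have ji: "((\<lambda>z. G z $ j $ i) has_derivative (\<lambda>u. dir_deriv G y u $ i $ j)) (at y)"
      by (rule has_derivative_transform_within_open[OF ij open_U assms]) (rule sym)
    from has_derivative_unique[OF this has_derivative_entry[OF dG[OF assms]]]
    show ?thesis by (rule fun_cong)
  qed
  then show "transpose (dir_deriv G y u) = dir_deriv G y u"
    by (simp add: vec_eq_iff transpose_def)
qed

lemma partial_G:
  assumes "y \<in> U"
  shows "partial i (\<lambda>z. G z $ j $ l) y = dir_deriv G y (axis i 1) $ j $ l"
  unfolding partial_def by (rule dir_deriv_eqI[OF has_derivative_entry[OF dG[OF assms]], symmetric])

text \<open>Pairing with the metric cancels the inverse matrix in the Christoffel symbols, and the
  three groups of partial derivatives become derivatives of \<open>G\<close> along \<open>u\<close>,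
  \<open>v\<close> and \<open>w\<close>.\<close>

lemma koszul:
  assumes y: "y \<in> U"
  shows "mip (G y) (conn G y u v) w
    = 1/2 * (mip (dir_deriv G y u) v w + mip (dir_deriv G y v) u w - mip (dir_deriv G y w) u v)"
proof -
  let ?A = "\<lambda>i. dir_deriv G y (axis i 1)"
  have lin: "linear (\<lambda>u. mip (dir_deriv G y u) v w)" for v w
    by (rule linear_compose[OF linear_dG[OF y] linear_mip_matrix, unfolded o_def])
  \<comment> \<open>The covector obtained from \<open>conn G y u v\<close> by lowering the
    index.\<close>
  define t where "t = (\<chi> l. 1/2 * (\<Sum>i\<in>UNIV. \<Sum>j\<in>UNIV. (?A i $ j $ l + ?A j $ i $ l - ?A l $ i $ j) * u $ i * v $ j))"
  have "conn G y u v $ k = (matrix_inv (G y) *v t) $ k" for k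
  proof -
    have "conn G y u v $ k = (\<Sum>i\<in>UNIV. \<Sum>j\<in>UNIV. \<Sum>l\<in>UNIV.
        matrix_inv (G y) $ k $ l * (1/2 * ((?A i $ j $ l + ?A j $ i $ l - ?A l $ i $ j) * u $ i * v $ j)))"
      unfolding conn_def christoffel_def partial_G[OF y]
      by (simp add: sum_distrib_left sum_distrib_right sum_divide_distrib mult_ac)
    also have "\<dots> = (\<Sum>i\<in>UNIV. \<Sum>l\<in>UNIV. \<Sum>j\<in>UNIV.
        matrix_inv (G y) $ k $ l * (1/2 * ((?A i $ j $ l + ?A j $ i $ l - ?A l $ i $ j) * u $ i * v $ j)))"
      by (intro sum.cong refl sum.swap)
    also have "\<dots> = (\<Sum>l\<in>UNIV. \<Sum>i\<in>UNIV. \<Sum>j\<in>UNIV.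
        matrix_inv (G y) $ k $ l * (1/2 * ((?A i $ j $ l + ?A j $ i $ l - ?A l $ i $ j) * u $ i * v $ j)))"
      by (rule sum.swap)
    also have "\<dots> = (matrix_inv (G y) *v t) $ k"
      unfolding matrix_vector_mult_def t_def by (simp only: vec_lambda_beta sum_distrib_left)
    finally show ?thesis .
  qed
  then have c: "conn G y u v = matrix_inv (G y) *v t" by (simp add: vec_eq_iff)
  have "mip (G y) (conn G y u v) w = mip (G y) w (matrix_inv (G y) *v t)"
    unfolding c by (rule posdef_commute[OF pos[OF y]])
  also have "\<dots> = w \<bullet> t"
    unfolding mip_def
    by (simp add: matrix_vector_mul_assoc matrix_inv_mult[OF posdef_invertible[OF pos[OF y]]])
  also have "\<dots> = 1/2 * (\<Sum>l\<in>UNIV. \<Sum>i\<in>UNIV. \<Sum>j\<in>UNIV.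
      w $ l * ((?A i $ j $ l + ?A j $ i $ l - ?A l $ i $ j) * u $ i * v $ j))"
    unfolding t_def inner_vec_def by (simp add: sum_distrib_left sum_divide_distrib mult_ac)
  also have "\<dots> = 1/2 * (\<Sum>l\<in>UNIV. \<Sum>i\<in>UNIV. \<Sum>j\<in>UNIV. u $ i * (?A i $ j $ l * v $ j * w $ l)
       + v $ j * (?A j $ i $ l * u $ i * w $ l) - w $ l * (?A l $ i $ j * u $ i * v $ j))"
    by (intro arg_cong[where f = "(*) (1/2)"] sum.cong refl) algebra
  also have "\<dots> = 1/2 * ((\<Sum>l\<in>UNIV. \<Sum>i\<in>UNIV. \<Sum>j\<in>UNIV. u $ i * (?A i $ j $ l * v $ j * w $ l))
       + (\<Sum>l\<in>UNIV. \<Sum>i\<in>UNIV. \<Sum>j\<in>UNIV. v $ j * (?A j $ i $ l * u $ i * w $ l))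
       - (\<Sum>l\<in>UNIV. \<Sum>i\<in>UNIV. \<Sum>j\<in>UNIV. w $ l * (?A l $ i $ j * u $ i * v $ j)))"
    by (simp only: sum.distrib sum_subtractf)
  also have "(\<Sum>l\<in>UNIV. \<Sum>i\<in>UNIV. \<Sum>j\<in>UNIV. u $ i * (?A i $ j $ l * v $ j * w $ l))
      = mip (dir_deriv G y u) v w" (is "?L = _")
  proof -
    have "mip (dir_deriv G y u) v w = (\<Sum>i\<in>UNIV. u $ i *\<^sub>R mip (?A i) v w)"
      by (rule linear_axis_expand[OF lin])
    also have "\<dots> = (\<Sum>i\<in>UNIV. \<Sum>j\<in>UNIV. \<Sum>l\<in>UNIV. u $ i * (?A i $ j $ l * v $ j * w $ l))"
      unfolding mip_expand by (simp add: sum_distrib_left)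
    also have "\<dots> = (\<Sum>i\<in>UNIV. \<Sum>l\<in>UNIV. \<Sum>j\<in>UNIV. u $ i * (?A i $ j $ l * v $ j * w $ l))"
      by (intro sum.cong refl sum.swap)
    also have "\<dots> = ?L" by (rule sum.swap)
    finally show ?thesis ..
  qed
  also have "(\<Sum>l\<in>UNIV. \<Sum>i\<in>UNIV. \<Sum>j\<in>UNIV. v $ j * (?A j $ i $ l * u $ i * w $ l))
      = mip (dir_deriv G y v) u w" (is "?L = _")
  proof -
    have "mip (dir_deriv G y v) u w = (\<Sum>j\<in>UNIV. v $ j *\<^sub>R mip (?A j) u w)"
      by (rule linear_axis_expand[OF lin])
    also have "\<dots> = (\<Sum>j\<in>UNIV. \<Sum>i\<in>UNIV. \<Sum>l\<in>UNIV. v $ j * (?A j $ i $ l * u $ i * w $ l))"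
      unfolding mip_expand by (simp add: sum_distrib_left)
    also have "\<dots> = (\<Sum>j\<in>UNIV. \<Sum>l\<in>UNIV. \<Sum>i\<in>UNIV. v $ j * (?A j $ i $ l * u $ i * w $ l))"
      by (intro sum.cong refl sum.swap)
    also have "\<dots> = (\<Sum>l\<in>UNIV. \<Sum>j\<in>UNIV. \<Sum>i\<in>UNIV. v $ j * (?A j $ i $ l * u $ i * w $ l))"
      by (rule sum.swap)
    also have "\<dots> = ?L" by (intro sum.cong refl sum.swap)
    finally show ?thesis ..
  qed
  also have "(\<Sum>l\<in>UNIV. \<Sum>i\<in>UNIV. \<Sum>j\<in>UNIV. w $ l * (?A l $ i $ j * u $ i * v $ j))
      = mip (dir_deriv G y w) u v" (is "?L = _")
  proof -
    have "mip (dir_deriv G y w) u v = (\<Sum>l\<in>UNIV. w $ l *\<^sub>R mip (?A l) u v)"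
      by (rule linear_axis_expand[OF lin])
    also have "\<dots> = ?L" unfolding mip_expand by (simp add: sum_distrib_left)
    finally show ?thesis ..
  qed
  finally show ?thesis .
qed

text \<open>Freedom from torsion: the Koszul formula is symmetric in \<open>u\<close> and
  \<open>v\<close>, and the metric is nondegenerate.\<close>

lemma conn_commute:
  assumes y: "y \<in> U"
  shows "conn G y u v = conn G y v u"
proof -
  have "mip (G y) (conn G y u v - conn G y v u) w = 0" for w
    unfolding mip_diff_left koszul[OF y] using dG_commute[OF y, of w u v] by simp
  then show ?thesis using posdef_eq0[OF pos[OF y]] by (metis right_minus_eq)
qed

text \<open>In the sum of the two Koszul formulas the derivatives along \<open>v\<close> and
  \<open>w\<close> cancel and the one along \<open>u\<close> is counted twice with factor
  1/2.\<close>

lemma metric_compatible: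
  assumes y: "y \<in> U"
  shows "mip (dir_deriv G y u) v w = mip (G y) (conn G y u v) w + mip (G y) v (conn G y u w)"
  unfolding posdef_commute[OF pos[OF y], of v] koszul[OF y] dG_commute[OF y, of u w v]
    dG_commute[OF y, of v w u] dG_commute[OF y, of w v u] by (simp add: field_simps)

lemma christoffel_differentiable:
  assumes y: "y \<in> U"
  shows "(\<lambda>z. christoffel G z k i j) differentiable at y"
proof -
  have ent: "(\<lambda>z. H z $ a $ b) differentiable at y" if "smooth_in U H" for H :: "real^'m \<Rightarrow> real^'m^'m" and a b
    using has_derivative_entry[OF smooth_in_has_derivative[OF that y]] differentiableI by blast
  have P: "(\<lambda>z. matrix_inv (G z) $ k $ l) differentiable at y" for k l
    by (rule differentiable_matrix_inv[OF ent[OF smooth] open_U y posdef_invertible[OF pos]])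
  have A: "(\<lambda>z. dir_deriv G z u $ a $ b) differentiable at y" for u a b
    by (rule ent[OF smooth_in_dir_deriv[OF smooth]])
  have "(\<lambda>z. \<Sum>l\<in>UNIV. 1/2 * matrix_inv (G z) $ k $ l *
        (dir_deriv G z (axis i 1) $ j $ l + dir_deriv G z (axis j 1) $ i $ l
          - dir_deriv G z (axis l 1) $ i $ j)) differentiable at y"
    by (intro differentiable_sum ballI differentiable_mult differentiable_const differentiable_add
        differentiable_diff P A finite)
  then obtain D where D: "((\<lambda>z. \<Sum>l\<in>UNIV. 1/2 * matrix_inv (G z) $ k $ l *
        (dir_deriv G z (axis i 1) $ j $ l + dir_deriv G z (axis j 1) $ i $ l
          - dir_deriv G z (axis l 1) $ i $ j)) has_derivative D) (at y)"
    unfolding differentiable_def by blast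
  have "((\<lambda>z. christoffel G z k i j) has_derivative D) (at y)"
    by (rule has_derivative_transform_within_open[OF D open_U y])
      (simp add: christoffel_def partial_G)
  then show ?thesis by (rule differentiableI)
qed

text \<open>Stated along a map \<open>f\<close> so that it covers both the connection of the domain,
  with \<open>f\<close> the identity, and that of the target evaluated along the map.\<close>

lemma conn_has_derivative:
  fixes f X Y :: "'e::real_normed_vector \<Rightarrow> real^'m"
  assumes y: "f x \<in> U" and f: "(f has_derivative f') (at x)"
    and X: "(X has_derivative X') (at x)" and Y: "(Y has_derivative Y') (at x)"
  shows "((\<lambda>x. conn G (f x) (X x) (Y x)) has_derivative
    (\<lambda>b. dconn G (f x) (f' b) (X x) (Y x) + conn G (f x) (X' b) (Y x) + conn G (f x) (X x) (Y' b))) (at x)"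
proof -
  have nth: "((\<lambda>x. Z x $ i) has_derivative (\<lambda>b. Z' b $ i)) (at x)"
    if "(Z has_derivative Z') (at x)" for Z :: "'e \<Rightarrow> real^'m" and Z' i
    using that by (intro bounded_linear.has_derivative[OF bounded_linear_vec_nth])
  have c: "((\<lambda>x. christoffel G (f x) k i j) has_derivative
      (\<lambda>b. dir_deriv (\<lambda>z. christoffel G z k i j) (f x) (f' b))) (at x)" for k i j
    by (rule has_derivative_compose[OF f christoffel_differentiable[OF y, unfolded frechet_derivative_works]])
  have "((\<lambda>x. conn G (f x) (X x) (Y x) $ k) has_derivative
    (\<lambda>b. (dconn G (f x) (f' b) (X x) (Y x) + conn G (f x) (X' b) (Y x) + conn G (f x) (X x) (Y' b)) $ k)) (at x)" for k
  proof -
    have "((\<lambda>x. \<Sum>i\<in>UNIV. \<Sum>j\<in>UNIV. christoffel G (f x) k i j * X x $ i * Y x $ j) has_derivative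
      (\<lambda>b. \<Sum>i\<in>UNIV. \<Sum>j\<in>UNIV. christoffel G (f x) k i j * X x $ i * Y' b $ j
         + (christoffel G (f x) k i j * X' b $ i
            + dir_deriv (\<lambda>z. christoffel G z k i j) (f x) (f' b) * X x $ i) * Y x $ j)) (at x)"
      by (intro has_derivative_sum has_derivative_mult c nth X Y)
    moreover have "(\<lambda>b. \<Sum>i\<in>UNIV. \<Sum>j\<in>UNIV. christoffel G (f x) k i j * X x $ i * Y' b $ j
         + (christoffel G (f x) k i j * X' b $ i
            + dir_deriv (\<lambda>z. christoffel G z k i j) (f x) (f' b) * X x $ i) * Y x $ j)
      = (\<lambda>b. (dconn G (f x) (f' b) (X x) (Y x) + conn G (f x) (X' b) (Y x) + conn G (f x) (X x) (Y' b)) $ k)"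
      unfolding dconn_def conn_def by (simp add: distrib_right sum.distrib add_ac)
    ultimately show ?thesis unfolding conn_def by simp
  qed
  then show ?thesis
    unfolding has_derivative_componentwise_within[of "\<lambda>x. conn G (f x) (X x) (Y x)"] Basis_vec_def
    by (auto simp: inner_axis)
qed

text \<open>Compatibility of the pulled-back connection:
  \<open>X' b + conn G (f x) (f' b) (X x)\<close> is the covariant derivative of the vector field
  \<open>X\<close> along \<open>f\<close>. It is used with \<open>f\<close> a map in space and with
  \<open>f\<close> a curve in time.\<close>

lemma mip_has_derivative:
  fixes f X Y :: "'e::real_normed_vector \<Rightarrow> real^'m"
  assumes y: "f x \<in> U" and f: "(f has_derivative f') (at x)"
    and X: "(X has_derivative X') (at x)" and Y: "(Y has_derivative Y') (at x)"
  shows "((\<lambda>x. mip (G (f x)) (X x) (Y x)) has_derivative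
    (\<lambda>b. mip (G (f x)) (X' b + conn G (f x) (f' b) (X x)) (Y x)
       + mip (G (f x)) (X x) (Y' b + conn G (f x) (f' b) (Y x)))) (at x)"
proof -
  have nth: "((\<lambda>x. Z x $ i) has_derivative (\<lambda>b. Z' b $ i)) (at x)"
    if "(Z has_derivative Z') (at x)" for Z :: "'e \<Rightarrow> real^'m" and Z' i
    using that by (intro bounded_linear.has_derivative[OF bounded_linear_vec_nth])
  have g: "((\<lambda>x. G (f x) $ i $ j) has_derivative (\<lambda>b. dir_deriv G (f x) (f' b) $ i $ j)) (at x)" for i j
    by (rule has_derivative_entry[OF has_derivative_compose[OF f dG[OF y]]])
  have "((\<lambda>x. mip (G (f x)) (X x) (Y x)) has_derivative
      (\<lambda>b. \<Sum>i\<in>UNIV. \<Sum>j\<in>UNIV. G (f x) $ i $ j * X x $ i * Y' b $ j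
         + (G (f x) $ i $ j * X' b $ i + dir_deriv G (f x) (f' b) $ i $ j * X x $ i) * Y x $ j)) (at x)"
    unfolding mip_expand by (intro has_derivative_sum has_derivative_mult g nth X Y)
  moreover have "(\<Sum>i\<in>UNIV. \<Sum>j\<in>UNIV. G (f x) $ i $ j * X x $ i * Y' b $ j
         + (G (f x) $ i $ j * X' b $ i + dir_deriv G (f x) (f' b) $ i $ j * X x $ i) * Y x $ j)
      = mip (G (f x)) (X x) (Y' b) + mip (G (f x)) (X' b) (Y x) + mip (dir_deriv G (f x) (f' b)) (X x) (Y x)" for b
    unfolding mip_expand by (simp add: distrib_right sum.distrib add_ac)
  ultimately show ?thesis
    unfolding metric_compatible[OF y] by (simp add: mip_add_left mip_add_right add_ac)
qed

text \<open>Differentiating metric compatibility once more expresses the second derivative of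
  \<open>G\<close> through the connection. That second derivative is symmetric in its two
  directions, the products of two \<open>conn\<close> terms are symmetric as well, and the remaining
  asymmetry is the sum of the two curvature terms, which must vanish.\<close>

lemma curv_skew:
  assumes y: "y \<in> U"
  shows "mip (G y) (curv G y a b c) d = - mip (G y) (curv G y a b d) c"
proof -
  have D: "mip (dir_deriv (\<lambda>z. dir_deriv G z b) y a) c d
     = mip (G y) (dconn G y a b c + conn G y a (conn G y b c)) d + mip (G y) (conn G y b c) (conn G y a d)
     + (mip (G y) (conn G y a c) (conn G y b d) + mip (G y) c (dconn G y a b d + conn G y a (conn G y b d)))"
    (is "_ = ?R a") for a b
  proof -
    have cc: "((\<lambda>z. conn G z b c) has_derivative (\<lambda>a. dconn G y a b c)) (at y)" for c
      using conn_has_derivative[OF y has_derivative_ident has_derivative_const has_derivative_const, of b c]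
      by (simp add: bilinear_lzero[OF bilinear_conn] bilinear_rzero[OF bilinear_conn])
    have 1: "((\<lambda>z. mip (G z) (conn G z b c) d + mip (G z) c (conn G z b d)) has_derivative ?R) (at y)"
      using has_derivative_add[OF
        mip_has_derivative[OF y has_derivative_ident cc has_derivative_const, of c d]
        mip_has_derivative[OF y has_derivative_ident has_derivative_const cc, of c d]]
      by simp
    have 2: "((\<lambda>z. mip (dir_deriv G z b) c d) has_derivative ?R) (at y)"
      by (rule has_derivative_transform_within_open[OF 1 open_U y]) (simp add: metric_compatible)
    have 3: "((\<lambda>z. mip (dir_deriv G z b) c d) has_derivative
        (\<lambda>a. mip (dir_deriv (\<lambda>z. dir_deriv G z b) y a) c d)) (at y)"
      by (rule bounded_linear.has_derivative[OF linear_conv_bounded_linear[THEN iffD1, OF linear_mip_matrix]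
            smooth_in_has_derivative[OF smooth_in_dir_deriv[OF smooth] y]])
    from fun_cong[OF has_derivative_unique[OF 3 2]] show ?thesis .
  qed
  have "mip (dir_deriv (\<lambda>z. dir_deriv G z b) y a) c d = mip (dir_deriv (\<lambda>z. dir_deriv G z a) y b) c d"
    using smooth_in_symmetric[OF smooth y] by metis
  then show ?thesis
    unfolding D curv_def posdef_commute[OF pos[OF y], of _ c] by (simp add: mip_add_left mip_diff_left mip_add_right mip_diff_right)
qed

end

text \<open>The trace of an endomorphism does not depend on the basis; here it passes from the
  coordinate basis to an orthonormal frame by expanding each image vector in the frame.\<close>

lemma trace_frame:
  assumes E: "orthonormal_frame G E" and G: "posdef G" and L: "linear L"
  shows "(\<Sum>i\<in>UNIV. L (axis i 1) $ i) = (\<Sum>a\<in>UNIV. mip G (L (E a)) (E a))"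
proof -
  have "L (axis i 1) $ i = (\<Sum>a\<in>UNIV. mip G (L (axis i 1)) (E a) * E a $ i)" for i
  proof -
    have "L (axis i 1) $ i = (\<Sum>a\<in>UNIV. mip G (L (axis i 1)) (E a) *\<^sub>R E a) $ i"
      using orthonormal_frame_expand[OF E G, of "L (axis i 1)"] by simp
    then show ?thesis by (simp add: sum_component)
  qed
  then have "(\<Sum>i\<in>UNIV. L (axis i 1) $ i) = (\<Sum>i\<in>UNIV. \<Sum>a\<in>UNIV. mip G (L (axis i 1)) (E a) * E a $ i)"
    by simp
  also have "\<dots> = (\<Sum>a\<in>UNIV. \<Sum>i\<in>UNIV. mip G (L (axis i 1)) (E a) * E a $ i)"
    by (rule sum.swap)
  also have "\<dots> = (\<Sum>a\<in>UNIV. mip G (L (E a)) (E a))"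
  proof (rule sum.cong[OF refl])
    fix a
    have "mip G (L (E a)) (E a) = mip G (\<Sum>i\<in>UNIV. E a $ i *\<^sub>R L (axis i 1)) (E a)"
      using linear_axis_expand[OF L, of "E a"] by simp
    then show "(\<Sum>i\<in>UNIV. mip G (L (axis i 1)) (E a) * E a $ i) = mip G (L (E a)) (E a)"
      by (simp add: mip_sum_left mip_scale_left mult.commute)
  qed
  finally show ?thesis .
qed

context coord_metric
begin

lemma linear_dchristoffel:
  "y \<in> U \<Longrightarrow> dir_deriv (\<lambda>z. christoffel G z k i j) y b = (\<Sum>p\<in>UNIV. b $ p * partial p (\<lambda>z. christoffel G z k i j) y)"
  using linear_axis_expand[OF linear_frechet_derivative[OF christoffel_differentiable]]
  unfolding partial_def by simp

text \<open>Links the index formula \<open>riem\<close> with the invariant expression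
  \<open>curv\<close>. It also yields linearity of the curvature and identifies the numerator of
  \<open>sectional\<close>.\<close>

lemma curv_riem:
  assumes y: "y \<in> U"
  shows "curv G y b a c = (\<chi> l. \<Sum>i\<in>UNIV. \<Sum>j\<in>UNIV. \<Sum>k\<in>UNIV. riem G y l i j k * b $ i * a $ j * c $ k)"
proof -
  let ?C = "christoffel G y" and ?p = "\<lambda>i l j k. partial i (\<lambda>z. christoffel G z l j k) y"
  have 1: "dconn G y b a c $ l = (\<Sum>i\<in>UNIV. \<Sum>j\<in>UNIV. \<Sum>k\<in>UNIV. ?p i l j k * b $ i * a $ j * c $ k)" for l a b
  proof -
    have "dconn G y b a c $ l = (\<Sum>j\<in>UNIV. \<Sum>k\<in>UNIV. \<Sum>i\<in>UNIV. ?p i l j k * b $ i * a $ j * c $ k)"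
      unfolding dconn_def linear_dchristoffel[OF y]
      by (simp add: sum_distrib_left sum_distrib_right mult_ac)
    also have "\<dots> = (\<Sum>j\<in>UNIV. \<Sum>i\<in>UNIV. \<Sum>k\<in>UNIV. ?p i l j k * b $ i * a $ j * c $ k)"
      by (intro sum.cong refl sum.swap)
    also have "\<dots> = (\<Sum>i\<in>UNIV. \<Sum>j\<in>UNIV. \<Sum>k\<in>UNIV. ?p i l j k * b $ i * a $ j * c $ k)"
      by (rule sum.swap)
    finally show ?thesis .
  qed
  have 2: "conn G y b (conn G y a c) $ l
      = (\<Sum>i\<in>UNIV. \<Sum>j\<in>UNIV. \<Sum>k\<in>UNIV. (\<Sum>p\<in>UNIV. ?C l i p * ?C p j k) * b $ i * a $ j * c $ k)" for l a b
  proof -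
    have "conn G y b (conn G y a c) $ l
      = (\<Sum>i\<in>UNIV. \<Sum>p\<in>UNIV. \<Sum>j\<in>UNIV. \<Sum>k\<in>UNIV. ?C l i p * ?C p j k * b $ i * a $ j * c $ k)"
      unfolding conn_def by (simp add: sum_distrib_left sum_distrib_right mult_ac)
    also have "\<dots> = (\<Sum>i\<in>UNIV. \<Sum>j\<in>UNIV. \<Sum>p\<in>UNIV. \<Sum>k\<in>UNIV. ?C l i p * ?C p j k * b $ i * a $ j * c $ k)"
      by (intro sum.cong refl sum.swap)
    also have "\<dots> = (\<Sum>i\<in>UNIV. \<Sum>j\<in>UNIV. \<Sum>k\<in>UNIV. \<Sum>p\<in>UNIV. ?C l i p * ?C p j k * b $ i * a $ j * c $ k)"
      by (intro sum.cong refl sum.swap)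
    finally show ?thesis by (simp add: sum_distrib_right)
  qed
  have sw: "(\<Sum>i\<in>UNIV. \<Sum>j\<in>UNIV. \<Sum>k\<in>UNIV. T i j k * a $ i * b $ j * c $ k)
     = (\<Sum>i\<in>UNIV. \<Sum>j\<in>UNIV. \<Sum>k\<in>UNIV. T j i k * b $ i * a $ j * c $ k)" for T :: "'m \<Rightarrow> 'm \<Rightarrow> 'm \<Rightarrow> real"
    by (subst sum.swap) (simp add: mult_ac)
  have 3: "dconn G y a b c $ l = (\<Sum>i\<in>UNIV. \<Sum>j\<in>UNIV. \<Sum>k\<in>UNIV. ?p j l i k * b $ i * a $ j * c $ k)" for l
    unfolding 1 by (rule sw)
  have 4: "conn G y a (conn G y b c) $ l
      = (\<Sum>i\<in>UNIV. \<Sum>j\<in>UNIV. \<Sum>k\<in>UNIV. (\<Sum>p\<in>UNIV. ?C l j p * ?C p i k) * b $ i * a $ j * c $ k)" for l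
    unfolding 2 by (rule sw)
  have "curv G y b a c $ l = (\<Sum>i\<in>UNIV. \<Sum>j\<in>UNIV. \<Sum>k\<in>UNIV. riem G y l i j k * b $ i * a $ j * c $ k)" for l
    unfolding curv_def vector_add_component vector_minus_component 1[of b a] 3 2[of b a] 4 riem_def sum_subtractf
    by (simp add: algebra_simps sum.distrib sum_subtractf)
  then show ?thesis by (simp add: vec_eq_iff)
qed

lemma linear_curv1: "y \<in> U \<Longrightarrow> linear (\<lambda>b. curv G y b a c)"
  unfolding curv_riem
  by (auto intro!: linearI simp: vec_eq_iff algebra_simps sum.distrib sum_distrib_left)

lemma ricci_frame:
  assumes y: "y \<in> U" and E: "orthonormal_frame (G y) E"
  shows "mip (ricci G y) v w = (\<Sum>a\<in>UNIV. mip (G y) (curv G y (E a) v w) (E a))"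
proof -
  have "(\<Sum>a\<in>UNIV. mip (G y) (curv G y (E a) v w) (E a)) = (\<Sum>l\<in>UNIV. curv G y (axis l 1) v w $ l)"
    by (rule trace_frame[OF E pos[OF y] linear_curv1[OF y], symmetric])
  also have "\<dots> = (\<Sum>l\<in>UNIV. \<Sum>j\<in>UNIV. \<Sum>k\<in>UNIV. riem G y l l j k * v $ j * w $ k)"
  proof (rule sum.cong[OF refl])
    fix l
    have "(\<Sum>j\<in>UNIV. \<Sum>k\<in>UNIV. riem G y l i j k * axis l 1 $ i * v $ j * w $ k)
       = (if i = l then \<Sum>j\<in>UNIV. \<Sum>k\<in>UNIV. riem G y l l j k * v $ j * w $ k else 0)" for i
      by (simp add: axis_def)
    then show "curv G y (axis l 1) v w $ l = (\<Sum>j\<in>UNIV. \<Sum>k\<in>UNIV. riem G y l l j k * v $ j * w $ k)"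
      unfolding curv_riem[OF y] by simp
  qed
  also have "\<dots> = (\<Sum>j\<in>UNIV. \<Sum>l\<in>UNIV. \<Sum>k\<in>UNIV. riem G y l l j k * v $ j * w $ k)"
    by (rule sum.swap)
  also have "\<dots> = (\<Sum>j\<in>UNIV. \<Sum>k\<in>UNIV. \<Sum>l\<in>UNIV. riem G y l l j k * v $ j * w $ k)"
    by (intro sum.cong refl sum.swap)
  also have "\<dots> = mip (ricci G y) v w"
    unfolding mip_expand ricci_def by (simp add: sum_distrib_right)
  finally show ?thesis ..
qed

end

section \<open>The second fundamental form of a map\<close>

definition deriv2 :: "(real^'m::finite \<Rightarrow> real^'n::finite) \<Rightarrow> real^'m \<Rightarrow> real^'m \<Rightarrow> real^'m \<Rightarrow> real^'n" where
  "deriv2 f y u c = dir_deriv (\<lambda>z. dir_deriv f z c) y u"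

definition deriv3 :: "(real^'m::finite \<Rightarrow> real^'n::finite) \<Rightarrow> real^'m \<Rightarrow> real^'m \<Rightarrow> real^'m \<Rightarrow> real^'m \<Rightarrow> real^'n" where
  "deriv3 f y b u c = dir_deriv (\<lambda>z. deriv2 f z u c) y b"

lemma deriv2_has_derivative:
  "smooth_in U f \<Longrightarrow> y \<in> U \<Longrightarrow> ((\<lambda>z. dir_deriv f z c) has_derivative (\<lambda>u. deriv2 f y u c)) (at y)"
  unfolding deriv2_def by (rule smooth_in_has_derivative[OF smooth_in_dir_deriv])

lemma smooth_in_deriv2: "smooth_in U f \<Longrightarrow> smooth_in U (\<lambda>z. deriv2 f z u c)"
  unfolding deriv2_def by (intro smooth_in_dir_deriv)

lemma deriv3_has_derivative:
  "smooth_in U f \<Longrightarrow> y \<in> U \<Longrightarrow> ((\<lambda>z. deriv2 f z u c) has_derivative (\<lambda>b. deriv3 f y b u c)) (at y)"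
  unfolding deriv3_def by (rule smooth_in_has_derivative[OF smooth_in_deriv2])

lemma deriv2_commute: "smooth_in U f \<Longrightarrow> y \<in> U \<Longrightarrow> deriv2 f y u c = deriv2 f y c u"
  unfolding deriv2_def by (rule smooth_in_symmetric)

text \<open>Linearity in the direction of the outer derivative is automatic; symmetry carries it to
  the other slot.\<close>

lemma bilinear_deriv2:
  assumes "smooth_in U f" "y \<in> U"
  shows "bilinear (deriv2 f y)"
proof -
  have 1: "linear (\<lambda>u. deriv2 f y u c)" for c
    using has_derivative_linear[OF deriv2_has_derivative[OF assms]] .
  then have "linear (\<lambda>u. deriv2 f y c u)" for c
    unfolding deriv2_commute[OF assms, of c] .
  with 1 show ?thesis unfolding bilinear_def by auto
qed

lemma deriv3_commute12:
  assumes "smooth_in U f" "y \<in> U"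
  shows "deriv3 f y b u c = deriv3 f y u b c"
  unfolding deriv3_def deriv2_def by (rule smooth_in_symmetric[OF smooth_in_dir_deriv]) (use assms in auto)

lemma deriv3_commute23:
  assumes f: "smooth_in U f" and y: "y \<in> U"
  shows "deriv3 f y b u c = deriv3 f y b c u"
proof -
  have "open U" using f unfolding smooth_in_def by blast
  from has_derivative_transform_within_open[OF deriv3_has_derivative[OF f y] this y deriv2_commute[OF f]]
  have "((\<lambda>z. deriv2 f z c u) has_derivative (\<lambda>b. deriv3 f y b u c)) (at y)" .
  from fun_cong[OF has_derivative_unique[OF this deriv3_has_derivative[OF f y]]] show ?thesis .
qed

lemma linear_deriv3_1:
  assumes "smooth_in U f" "y \<in> U"
  shows "linear (\<lambda>b. deriv3 f y b u c)"
  by (rule has_derivative_linear[OF deriv3_has_derivative[OF assms]])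

lemma bilinear_deriv3:
  assumes f: "smooth_in U f" and y: "y \<in> U"
  shows "bilinear (deriv3 f y b)"
proof -
  have 1: "linear (\<lambda>u. deriv3 f y b u c)" for c
    unfolding deriv3_commute12[OF f y, of b] by (rule linear_deriv3_1[OF f y])
  then have "linear (\<lambda>u. deriv3 f y b c u)" for c
    unfolding deriv3_commute23[OF f y, of b c] .
  with 1 show ?thesis unfolding bilinear_def by auto
qed

text \<open>The direction may vary with the point, as it does in the term
  \<open>dir_deriv f y (conn G y u v)\<close> of the second fundamental form.\<close>

lemma dir_deriv_has_derivative:
  fixes f :: "real^'m::finite \<Rightarrow> real^'n::finite"
  assumes f: "smooth_in U f" and y: "y \<in> U" and X: "(X has_derivative X') (at y)"
  shows "((\<lambda>z. dir_deriv f z (X z)) has_derivative (\<lambda>b. deriv2 f y b (X y) + dir_deriv f y (X' b))) (at y)"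
proof -
  have "open U" using f unfolding smooth_in_def by blast
  have nth: "((\<lambda>z. X z $ i) has_derivative (\<lambda>b. X' b $ i)) (at y)" for i
    using X by (intro bounded_linear.has_derivative[OF bounded_linear_vec_nth])
  have eq: "linear L \<Longrightarrow> (\<Sum>i\<in>UNIV. v $ i *\<^sub>R L (axis i 1)) = L v" for L :: "real^'m \<Rightarrow> real^'n" and v
    using linear_axis_expand[of L v] by simp
  have 1: "((\<lambda>z. \<Sum>i\<in>UNIV. X z $ i *\<^sub>R dir_deriv f z (axis i 1)) has_derivative
      (\<lambda>b. \<Sum>i\<in>UNIV. X y $ i *\<^sub>R deriv2 f y b (axis i 1) + X' b $ i *\<^sub>R dir_deriv f y (axis i 1))) (at y)"
    by (intro has_derivative_sum has_derivative_scaleR nth deriv2_has_derivative[OF f y])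
  have "linear (deriv2 f y b)" for b using bilinear_deriv2[OF f y] unfolding bilinear_def by blast
  then have 2: "(\<lambda>b. \<Sum>i\<in>UNIV. X y $ i *\<^sub>R deriv2 f y b (axis i 1) + X' b $ i *\<^sub>R dir_deriv f y (axis i 1))
    = (\<lambda>b. deriv2 f y b (X y) + dir_deriv f y (X' b))"
    unfolding sum.distrib by (simp add: eq smooth_in_linear[OF f y])
  show ?thesis
    by (rule has_derivative_transform_within_open[OF 1[unfolded 2] \<open>open U\<close> y])
      (rule eq[OF smooth_in_linear[OF f]])
qed

lemma bilinear_compose:
  assumes "bilinear B" "linear L" "linear K"
  shows "bilinear (\<lambda>u v. B (L u) (K v))"
  using assms unfolding bilinear_def
  by (auto intro: linear_compose[unfolded o_def] )

lemma bilinear_add: "bilinear B \<Longrightarrow> bilinear C \<Longrightarrow> bilinear (\<lambda>u v. B u v + C u v)"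
  unfolding bilinear_def by (auto intro: linear_compose_add)

lemma bilinear_diff: "bilinear B \<Longrightarrow> bilinear C \<Longrightarrow> bilinear (\<lambda>u v. B u v - C u v)"
  unfolding bilinear_def by (auto intro: linear_compose_sub)

lemma bilinear_linear: "linear L \<Longrightarrow> bilinear B \<Longrightarrow> bilinear (\<lambda>u v. L (B u v))"
  unfolding bilinear_def by (auto intro: linear_compose[unfolded o_def])

lemma bilinearD1: "bilinear B \<Longrightarrow> linear (\<lambda>u. B u v)" and bilinearD2: "bilinear B \<Longrightarrow> linear (B u)"
  unfolding bilinear_def by auto

text \<open>\<open>hess\<close> is \<open>\<nabla>df\<close>, \<open>dhess\<close> its plain directional derivative in the coordinates, and
  \<open>cov_hess G H f y b u c\<close> is \<open>(\<nabla>\<^sub>b \<nabla>df)(u, c)\<close>.\<close>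

definition hess ::
    "(real^'m::finite \<Rightarrow> real^'m^'m) \<Rightarrow> (real^'n::finite \<Rightarrow> real^'n^'n) \<Rightarrow> (real^'m \<Rightarrow> real^'n)
      \<Rightarrow> real^'m \<Rightarrow> real^'m \<Rightarrow> real^'m \<Rightarrow> real^'n" where
  "hess G H f y u v = deriv2 f y u v - dir_deriv f y (conn G y u v)
     + conn H (f y) (dir_deriv f y u) (dir_deriv f y v)"

definition dhess ::
    "(real^'m::finite \<Rightarrow> real^'m^'m) \<Rightarrow> (real^'n::finite \<Rightarrow> real^'n^'n) \<Rightarrow> (real^'m \<Rightarrow> real^'n)
      \<Rightarrow> real^'m \<Rightarrow> real^'m \<Rightarrow> real^'m \<Rightarrow> real^'m \<Rightarrow> real^'n" where
  "dhess G H f y b u c = deriv3 f y b u c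
     - (deriv2 f y b (conn G y u c) + dir_deriv f y (dconn G y b u c))
     + (dconn H (f y) (dir_deriv f y b) (dir_deriv f y u) (dir_deriv f y c)
        + conn H (f y) (deriv2 f y b u) (dir_deriv f y c)
        + conn H (f y) (dir_deriv f y u) (deriv2 f y b c))"

definition cov_hess ::
    "(real^'m::finite \<Rightarrow> real^'m^'m) \<Rightarrow> (real^'n::finite \<Rightarrow> real^'n^'n) \<Rightarrow> (real^'m \<Rightarrow> real^'n)
      \<Rightarrow> real^'m \<Rightarrow> real^'m \<Rightarrow> real^'m \<Rightarrow> real^'m \<Rightarrow> real^'n" where
  "cov_hess G H f y b u c = dhess G H f y b u c
     - hess G H f y (conn G y b u) c - hess G H f y u (conn G y b c)
     + conn H (f y) (dir_deriv f y b) (hess G H f y u c)"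

text \<open>The pulled-back metric as a bilinear form, the invariant counterpart of
  \<open>grad_tensor\<close>; its trace is the energy density.\<close>

definition pullback_ip ::
    "(real^'n::finite \<Rightarrow> real^'n^'n) \<Rightarrow> (real^'m::finite \<Rightarrow> real^'n) \<Rightarrow> real^'m \<Rightarrow> real^'m \<Rightarrow> real^'m \<Rightarrow> real" where
  "pullback_ip H f y u v = mip (H (f y)) (dir_deriv f y u) (dir_deriv f y v)"

locale coord_map =
  M: coord_metric U G + N: coord_metric V H
  for U :: "(real^'m::finite) set" and G and V :: "(real^'n::finite) set" and H +
  fixes f :: "real^'m \<Rightarrow> real^'n"
  assumes smooth_f: "smooth_in U f" and f_in: "\<And>y. y \<in> U \<Longrightarrow> f y \<in> V"
begin

abbreviation "F \<equiv> dir_deriv f"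
abbreviation "A \<equiv> hess G H f"
abbreviation "C \<equiv> cov_hess G H f"

lemmas df = smooth_in_has_derivative[OF smooth_f]
lemmas linear_F = smooth_in_linear[OF smooth_f]
lemmas dF = deriv2_has_derivative[OF smooth_f]

lemma hess_commute: "y \<in> U \<Longrightarrow> A y u v = A y v u"
  unfolding hess_def using M.conn_commute[of y u v] deriv2_commute[OF smooth_f, of y u v]
    N.conn_commute[OF f_in, of y "F y u" "F y v"] by simp

lemma bilinear_hess: "y \<in> U \<Longrightarrow> bilinear (A y)"
  unfolding hess_def[abs_def]
  by (intro bilinear_add bilinear_diff bilinear_deriv2[OF smooth_f] bilinear_linear[OF linear_F]
      bilinear_compose[OF bilinear_conn linear_F linear_F] bilinear_conn)

lemma bilinear_dhess: "y \<in> U \<Longrightarrow> bilinear (dhess G H f y b)"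
  unfolding dhess_def[abs_def]
  by (intro bilinear_add bilinear_diff bilinear_deriv3[OF smooth_f]
      bilinear_linear[OF bilinearD2[OF bilinear_deriv2[OF smooth_f]]] bilinear_linear[OF linear_F]
      bilinear_compose[OF bilinear_dconn linear_F linear_F] bilinear_conn bilinear_dconn
      bilinear_compose[OF bilinear_conn linear_F bilinearD2[OF bilinear_deriv2[OF smooth_f]]]
      bilinear_compose[OF bilinear_conn bilinearD2[OF bilinear_deriv2[OF smooth_f]] linear_F])

lemma bilinear_pullback_ip: "y \<in> U \<Longrightarrow> bilinear (pullback_ip H f y)"
  unfolding pullback_ip_def[abs_def] by (intro bilinear_compose[OF bilinear_mip] linear_F)

lemma hess_has_derivative:
  assumes y: "y \<in> U"
  shows "((\<lambda>z. A z u c) has_derivative (\<lambda>b. dhess G H f y b u c)) (at y)"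
proof -
  have cc: "((\<lambda>z. conn G z u c) has_derivative (\<lambda>b. dconn G y b u c)) (at y)"
    using M.conn_has_derivative[OF y has_derivative_ident has_derivative_const has_derivative_const, of u c]
    by (simp add: bilinear_lzero[OF bilinear_conn] bilinear_rzero[OF bilinear_conn])
  show ?thesis
    unfolding hess_def dhess_def
    by (intro has_derivative_add has_derivative_diff deriv3_has_derivative[OF smooth_f y]
        dir_deriv_has_derivative[OF smooth_f y cc]
        N.conn_has_derivative[where f = f, OF f_in[OF y] df[OF y] dF[OF y] dF[OF y]])
qed

text \<open>Exchanging \<open>b\<close> and \<open>a\<close> cancels the third derivatives of
  \<open>f\<close> and all terms that are symmetric because the connections are torsion-free. What
  survives are first derivatives of the two connections and their quadratic terms, which assemble to
  the two curvatures.\<close>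

lemma ricci_identity:
  assumes y: "y \<in> U"
  shows "C y b a c - C y a b c
     = curv H (f y) (F y b) (F y a) (F y c) - F y (curv G y b a c)"
proof -
  note sym = deriv3_commute12[OF smooth_f y, of b a c] deriv2_commute[OF smooth_f y, of b a]
    M.conn_commute[OF y, of b a]
  have F: "F y (curv G y b a c) = F y (dconn G y b a c) - F y (dconn G y a b c)
      + F y (conn G y b (conn G y a c)) - F y (conn G y a (conn G y b c))"
    unfolding curv_def by (simp add: linear_add[OF linear_F[OF y]] linear_diff[OF linear_F[OF y]])
  show ?thesis
    unfolding cov_hess_def dhess_def curv_def[of H] F hess_def sym
    by (simp add: conn_add_right conn_diff_right algebra_simps)
qed

lemma pullback_ip_has_derivative:
  assumes y: "y \<in> U"
  shows "((\<lambda>z. pullback_ip H f z v w) has_derivative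
    (\<lambda>u. mip (H (f y)) (deriv2 f y u v + conn H (f y) (F y u) (F y v)) (F y w)
       + mip (H (f y)) (F y v) (deriv2 f y u w + conn H (f y) (F y u) (F y w)))) (at y)"
  unfolding pullback_ip_def
  by (rule N.mip_has_derivative[where f = f, OF f_in[OF y] df[OF y] dF[OF y] dF[OF y]])

lemma linear_F2conn: "y \<in> U \<Longrightarrow> linear (\<lambda>v. deriv2 f y u v + conn H (f y) (F y u) (F y v))"
  by (intro linear_compose_add bilinearD2[OF bilinear_deriv2[OF smooth_f]]
      linear_compose[OF linear_F bilinearD2[OF bilinear_conn], unfolded o_def])

text \<open>The corrections by the domain connection, coming from the trace, and by the target
  connection, coming from the inner product, complete the second derivative of \<open>f\<close> to
  \<nabla>df.\<close>

lemma density_has_derivative: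
  assumes y: "y \<in> U"
  shows "((\<lambda>z. mtrace (G z) (pullback_ip H f z)) has_derivative
    (\<lambda>u. 2 * mtrace (G y) (\<lambda>v w. mip (H (f y)) (A y u v) (F y w)))) (at y)"
proof -
  obtain E where E: "orthonormal_frame (G y) E"
    using orthonormal_frame_exists[OF M.pos[OF y]] .
  note com = posdef_commute[OF N.pos[OF f_in[OF y]]]
  have bil: "bilinear (\<lambda>v w. mip (H (f y)) (deriv2 f y u v + conn H (f y) (F y u) (F y v)) (F y w)
       + mip (H (f y)) (F y v) (deriv2 f y u w + conn H (f y) (F y u) (F y w)))" for u
    by (intro bilinear_add bilinear_compose[OF bilinear_mip linear_F2conn linear_F]
        bilinear_compose[OF bilinear_mip linear_F linear_F2conn] y)
  have 1: "((\<lambda>z. mtrace (G z) (pullback_ip H f z)) has_derivative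
    (\<lambda>u. \<Sum>a\<in>UNIV. mip (H (f y)) (deriv2 f y u (E a) + conn H (f y) (F y u) (F y (E a))) (F y (E a))
       + mip (H (f y)) (F y (E a)) (deriv2 f y u (E a) + conn H (f y) (F y u) (F y (E a)))
       - pullback_ip H f y (conn G y u (E a)) (E a) - pullback_ip H f y (E a) (conn G y u (E a)))) (at y)"
    by (rule mtrace_has_derivative_connection[OF M.dG[OF y] M.open_U y M.pos E
          pullback_ip_has_derivative[OF y] bilinear_pullback_ip[OF y] bil M.metric_compatible[OF y]])
  have 2: "mtrace (G y) (\<lambda>v w. mip (H (f y)) (A y u v) (F y w)) = (\<Sum>a\<in>UNIV. mip (H (f y)) (A y u (E a)) (F y (E a)))" for u
    by (rule mtrace_frame[OF E bilinear_compose[OF bilinear_mip bilinearD2[OF bilinear_hess[OF y]] linear_F[OF y]]])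
  have 3: "mip (H (f y)) (deriv2 f y u v + conn H (f y) (F y u) (F y v)) (F y v)
       + mip (H (f y)) (F y v) (deriv2 f y u v + conn H (f y) (F y u) (F y v))
       - pullback_ip H f y (conn G y u v) v - pullback_ip H f y v (conn G y u v)
     = 2 * mip (H (f y)) (A y u v) (F y v)" for u v
    unfolding com[of "F y v"] pullback_ip_def hess_def by (simp add: mip_add_left mip_diff_left)
  show ?thesis using 1 unfolding 2 3 by (simp add: sum_distrib_left)
qed

text \<open>The direction \<open>u\<close> is constant in coordinates but not parallel, hence the
  extra term with \<open>conn G y b u\<close>. It has the shape of a first derivative of the energy
  density and therefore disappears at a critical point.\<close>

lemma density_derivative_has_derivative:
  assumes y: "y \<in> U" and E: "orthonormal_frame (G y) E"
  shows "((\<lambda>z. mtrace (G z) (\<lambda>v w. mip (H (f z)) (A z u v) (F z w))) has_derivative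
    (\<lambda>b. \<Sum>a\<in>UNIV. mip (H (f y)) (C y b u (E a)) (F y (E a))
        + mip (H (f y)) (A y (conn G y b u) (E a)) (F y (E a))
        + mip (H (f y)) (A y u (E a)) (A y b (E a)))) (at y)"
proof -
  have lin: "linear (\<lambda>v. dhess G H f y b u v + conn H (f y) (F y b) (A y u v))" for b
    by (intro linear_compose_add bilinearD2[OF bilinear_dhess[OF y]]
      linear_compose[OF bilinearD2[OF bilinear_hess[OF y]] bilinearD2[OF bilinear_conn], unfolded o_def])
  have bil0: "bilinear (\<lambda>v w. mip (H (f y)) (A y u v) (F y w))"
    by (rule bilinear_compose[OF bilinear_mip bilinearD2[OF bilinear_hess[OF y]] linear_F[OF y]])
  have bil: "bilinear (\<lambda>v w. mip (H (f y)) (dhess G H f y b u v + conn H (f y) (F y b) (A y u v)) (F y w)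
       + mip (H (f y)) (A y u v) (deriv2 f y b w + conn H (f y) (F y b) (F y w)))" for b
    by (rule bilinear_add[OF bilinear_compose[OF bilinear_mip lin linear_F[OF y]]
          bilinear_compose[OF bilinear_mip bilinearD2[OF bilinear_hess[OF y]] linear_F2conn[OF y]]])
  have 1: "((\<lambda>z. mtrace (G z) (\<lambda>v w. mip (H (f z)) (A z u v) (F z w))) has_derivative
    (\<lambda>b. \<Sum>a\<in>UNIV. mip (H (f y)) (dhess G H f y b u (E a) + conn H (f y) (F y b) (A y u (E a))) (F y (E a))
       + mip (H (f y)) (A y u (E a)) (deriv2 f y b (E a) + conn H (f y) (F y b) (F y (E a)))
       - mip (H (f y)) (A y u (conn G y b (E a))) (F y (E a))
       - mip (H (f y)) (A y u (E a)) (F y (conn G y b (E a))))) (at y)"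
    by (rule mtrace_has_derivative_connection[OF M.dG[OF y] M.open_U y M.pos E
          N.mip_has_derivative[where f = f, OF f_in[OF y] df[OF y] hess_has_derivative[OF y] dF[OF y]]
          bil0 bil M.metric_compatible[OF y]])
  have 2: "mip (H (f y)) (dhess G H f y b u v + conn H (f y) (F y b) (A y u v)) (F y v)
       + mip (H (f y)) (A y u v) (deriv2 f y b v + conn H (f y) (F y b) (F y v))
       - mip (H (f y)) (A y u (conn G y b v)) (F y v)
       - mip (H (f y)) (A y u v) (F y (conn G y b v))
     = mip (H (f y)) (C y b u v) (F y v) + mip (H (f y)) (A y (conn G y b u) v) (F y v)
        + mip (H (f y)) (A y u v) (A y b v)" for b v
    unfolding cov_hess_def hess_def[of _ _ _ _ b v]
    by (simp add: mip_add_left mip_diff_left mip_add_right mip_diff_right)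
  show ?thesis using 1 unfolding 2 .
qed

text \<open>The sum over \<open>a\<close> is the covariant derivative of the tension field along
  \<open>f\<close>; subtracting the connection term of the target leaves the plain derivative of its
  components.\<close>

lemma tension_has_derivative:
  assumes y: "y \<in> U" and E: "orthonormal_frame (G y) E"
  shows "((\<lambda>z. mtrace (G z) (A z)) has_derivative
    (\<lambda>b. (\<Sum>a\<in>UNIV. C y b (E a) (E a)) - conn H (f y) (F y b) (mtrace (G y) (A y)))) (at y)"
proof -
  have 1: "((\<lambda>z. mtrace (G z) (A z)) has_derivative
    (\<lambda>b. \<Sum>a\<in>UNIV. dhess G H f y b (E a) (E a) - A y (conn G y b (E a)) (E a) - A y (E a) (conn G y b (E a)))) (at y)"
    by (rule mtrace_has_derivative_connection[OF M.dG[OF y] M.open_U y M.pos E hess_has_derivative[OF y]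
          bilinear_hess[OF y] bilinear_dhess[OF y] M.metric_compatible[OF y]])
  have 2: "conn H (f y) (F y b) (mtrace (G y) (A y)) = (\<Sum>a\<in>UNIV. conn H (f y) (F y b) (A y (E a) (E a)))" for b
    unfolding mtrace_frame[OF E bilinear_hess[OF y]] by (rule linear_sum[OF bilinearD2[OF bilinear_conn]])
  have 3: "dhess G H f y b v v - A y (conn G y b v) v - A y v (conn G y b v)
      = C y b v v - conn H (f y) (F y b) (A y v v)" for b v
    unfolding cov_hess_def by simp
  show ?thesis using 1 unfolding 2 3 sum_subtractf .
qed

end

section \<open>The evolution inequality at a spatial maximum\<close>

text \<open>If the second derivative along \<open>u\<close> were positive, the first derivative
  along \<open>u\<close>, which vanishes at \<open>y\<close>, would be positive shortly after, and
  the mean value theorem would produce a larger value of \<open>q\<close>.\<close>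

lemma second_derivative_at_max:
  fixes q :: "'e::euclidean_space \<Rightarrow> real"
  assumes U: "open U" "y \<in> U" and q: "\<And>z. z \<in> U \<Longrightarrow> (q has_derivative Q z) (at z)"
    and Q: "((\<lambda>z. Q z u) has_derivative Q2) (at y)"
    and max: "\<And>z. z \<in> U \<Longrightarrow> q z \<le> q y"
  shows "Q y = (\<lambda>v. 0)" "Q2 u \<le> 0"
proof -
  show Q0: "Q y = (\<lambda>v. 0)"
    by (rule differential_zero_maxmin[OF U(2,1) q[OF U(2)]]) (use max in blast)
  show "Q2 u \<le> 0"
  proof (rule ccontr)
    assume "\<not> Q2 u \<le> 0"
    then have pos: "0 < Q2 u" by simp
    have line: "((\<lambda>s. y + s *\<^sub>R u) has_derivative (\<lambda>r. r *\<^sub>R u)) (at s)" for s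
      by (auto intro!: derivative_eq_intros)
    have real_deriv: "((\<lambda>s. p (y + s *\<^sub>R u)) has_real_derivative P u) (at s)"
      if "(p has_derivative P) (at (y + s *\<^sub>R u))" for p :: "'e \<Rightarrow> real" and P s
    proof -
      have "(\<lambda>r. P (r *\<^sub>R u)) = (*) (P u)"
        using linear_scale[OF has_derivative_linear[OF that]] by (auto simp: mult.commute)
      with has_derivative_compose[OF line that] show ?thesis
        unfolding has_field_derivative_def by simp
    qed
    have "((\<lambda>s. Q (y + s *\<^sub>R u) u) has_real_derivative Q2 u) (at 0)"
      by (rule real_deriv[of "\<lambda>z. Q z u"]) (simp add: Q)
    from has_real_derivative_pos_inc_right[OF this pos]
    obtain d where d: "d > 0" "\<And>h. 0 < h \<Longrightarrow> h < d \<Longrightarrow> 0 < Q (y + h *\<^sub>R u) u"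
      using Q0 by auto
    have "open ((\<lambda>s. y + s *\<^sub>R u) -` U)" by (intro open_vimage U continuous_intros)
    moreover have "0 \<in> (\<lambda>s. y + s *\<^sub>R u) -` U" using U by simp
    ultimately obtain r where r: "r > 0" "ball 0 r \<subseteq> (\<lambda>s. y + s *\<^sub>R u) -` U"
      using open_contains_ball by blast
    have inU: "y + s *\<^sub>R u \<in> U" if "0 \<le> s" "s < r" for s
      using r(2) that by (auto simp: subset_iff)
    define h where "h = min d r / 2"
    have h: "0 < h" "h < d" "h < r" using d(1) r(1) unfolding h_def by auto
    have der: "((\<lambda>s. q (y + s *\<^sub>R u)) has_real_derivative Q (y + s *\<^sub>R u) u) (at s)" if "0 \<le> s" "s \<le> h" for s
      by (rule real_deriv[OF q[OF inU]]) (use that h in auto)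
    obtain s where s: "0 < s" "s < h" "q (y + h *\<^sub>R u) - q (y + 0 *\<^sub>R u) = (h - 0) * Q (y + s *\<^sub>R u) u"
      using MVT2[OF h(1) der] by blast
    have "0 < Q (y + s *\<^sub>R u) u" using d(2) s h by simp
    then have "0 < (h - 0) * Q (y + s *\<^sub>R u) u" using h by simp
    then have "q y < q (y + h *\<^sub>R u)" using s(3) by simp
    then show False using max[OF inU, of h] h by simp
  qed
qed

lemma grad_tensor_mip:
  assumes f: "f differentiable at y"
  shows "mip (grad_tensor H f y) v w = pullback_ip H f y v w"
proof -
  have lin: "linear (dir_deriv f y)" by (rule linear_frechet_derivative[OF f])
  have p: "partial i (\<lambda>z. f z $ a) y = dir_deriv f y (axis i 1) $ a" for i a
    unfolding partial_def
    by (rule dir_deriv_eqI[OF bounded_linear.has_derivative[OF bounded_linear_vec_nth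
            f[unfolded frechet_derivative_works]], symmetric])
  have "grad_tensor H f y $ i $ j = pullback_ip H f y (axis i 1) (axis j 1)" for i j
    unfolding grad_tensor_def pullback_ip_def mip_expand p by simp
  moreover have "pullback_ip H f y v w
      = (\<Sum>i\<in>UNIV. \<Sum>j\<in>UNIV. (v $ i * w $ j) *\<^sub>R pullback_ip H f y (axis i 1) (axis j 1))"
    unfolding pullback_ip_def
    by (rule bilinear_axis_expand[OF bilinear_compose[OF bilinear_mip lin lin]])
  ultimately show ?thesis unfolding mip_expand[of "grad_tensor H f y"] by (simp add: mult_ac)
qed

lemma trace_metric_mtrace: "trace_metric G B = mtrace G (mip B)"
  unfolding trace_metric_def mtrace_def mip_axis by simp

lemma energy_mtrace:
  "f differentiable at y \<Longrightarrow> trace_metric G (grad_tensor H f y) = mtrace G (pullback_ip H f y)"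
  unfolding trace_metric_mtrace by (simp add: mtrace_def grad_tensor_mip)

text \<open>For independent vectors this is the sectional bound multiplied by the positive Gram
  determinant. For dependent ones the curvature term vanishes while the Gram determinant and
  \<open>K\<close> are non-negative. The product form can be summed over a frame whose images may be
  dependent.\<close>

lemma (in coord_metric) curvature_le:
  assumes y: "y \<in> U" and K: "0 \<le> K"
    and sec: "\<And>v w. v \<noteq> w \<Longrightarrow> independent {v, w} \<Longrightarrow> sectional G y v w \<le> K"
  shows "mip (G y) (curv G y v w w) v \<le> K * (mip (G y) v v * mip (G y) w w - (mip (G y) v w)\<^sup>2)"
proof -
  note P = pos[OF y]
  have lin: "curv G y v w w = c *\<^sub>R curv G y x w w" if "v = c *\<^sub>R x" for c x v w
    unfolding that by (rule linear_scale[OF linear_curv1[OF y]])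
  have self: "curv G y v v w = 0" for v w by (simp add: curv_def)
  show ?thesis
  proof (cases "v \<noteq> w \<and> independent {v, w}")
    case True
    then have w: "w \<noteq> 0" using dependent_zero[of "{v, w}"] by blast
    \<comment> \<open>The coefficient of the projection of \<open>v\<close> onto \<open>w\<close>;
      the Gram determinant is |v - c w|^2 |w|^2.\<close>
    define c where "c = mip (G y) v w / mip (G y) w w"
    have "v - c *\<^sub>R w \<noteq> 0"
    proof
      assume "v - c *\<^sub>R w = 0"
      then have "v \<in> span {w}" by (simp add: span_breakdown_eq exI[of _ c])
      with True show False by (simp add: independent_insert)
    qed
    then have "0 < mip (G y) (v - c *\<^sub>R w) (v - c *\<^sub>R w)" using P unfolding posdef_def by blast
    moreover have ww: "0 < mip (G y) w w" using P w unfolding posdef_def by blast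
    moreover have "mip (G y) (v - c *\<^sub>R w) (v - c *\<^sub>R w) * mip (G y) w w
        = mip (G y) v v * mip (G y) w w - (mip (G y) v w)\<^sup>2"
      using ww unfolding c_def posdef_commute[OF P, of w v]
      by (simp add: mip_diff_left mip_diff_right mip_scale_left mip_scale_right
          posdef_commute[OF P, of w v] field_simps power2_eq_square)
    ultimately have D: "0 < mip (G y) v v * mip (G y) w w - (mip (G y) v w)\<^sup>2"
      by (metis mult_pos_pos)
    have "sectional G y v w = mip (G y) (curv G y v w w) v / (mip (G y) v v * mip (G y) w w - (mip (G y) v w)\<^sup>2)"
      unfolding sectional_def curv_riem[OF y] mip_def ..
    then show ?thesis using sec[of v w] True D by (simp add: pos_divide_le_eq)
  next
    case False
    have "mip (G y) (curv G y v w w) v = 0"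
    proof (cases "v = w")
      case True
      then show ?thesis by (simp add: self)
    next
      case neq: False
      then have "dependent {v, w}" using False by blast
      then consider "w = 0" | "v \<in> span {w}"
        using neq by (metis dependent_single independent_insert insert_absorb2)
      then show ?thesis
      proof cases
        case 1
        have "curv G y v 0 0 = 0"
          unfolding curv_def
          by (simp add: bilinear_lzero[OF bilinear_conn] bilinear_rzero[OF bilinear_conn]
              bilinear_lzero[OF bilinear_dconn] bilinear_rzero[OF bilinear_dconn])
        then show ?thesis using 1 by simp
      next
        case 2
        then obtain c where "v = c *\<^sub>R w" by (auto simp: span_breakdown_eq)
        from lin[OF this, of w] show ?thesis by (simp add: self)
      qed
    qed
    moreover have "0 \<le> mip (G y) v v * mip (G y) w w - (mip (G y) v w)\<^sup>2"
    proof (cases "w = 0")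
      case False
      then have ww: "0 < mip (G y) w w" using P unfolding posdef_def by blast
      define c where "c = mip (G y) v w / mip (G y) w w"
      have "mip (G y) (v - c *\<^sub>R w) (v - c *\<^sub>R w) * mip (G y) w w
        = mip (G y) v v * mip (G y) w w - (mip (G y) v w)\<^sup>2"
        using ww unfolding c_def posdef_commute[OF P, of w v]
        by (simp add: mip_diff_left mip_diff_right mip_scale_left mip_scale_right
          posdef_commute[OF P, of w v] field_simps power2_eq_square)
      moreover have "0 \<le> mip (G y) (v - c *\<^sub>R w) (v - c *\<^sub>R w) * mip (G y) w w"
        using posdef_ge0[OF P] by (intro mult_nonneg_nonneg)
      ultimately show ?thesis by simp
    qed simp
    ultimately show ?thesis using K by simp
  qed
qed

context coord_map
begin

lemma cov_hess_commute:
  assumes y: "y \<in> U"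
  shows "C y b u c = C y b c u"
proof -
  from has_derivative_transform_within_open[OF hess_has_derivative[OF y] M.open_U y hess_commute]
  have "((\<lambda>z. A z c u) has_derivative (\<lambda>b. dhess G H f y b u c)) (at y)" .
  from fun_cong[OF has_derivative_unique[OF this hess_has_derivative[OF y]]]
  have "dhess G H f y b u c = dhess G H f y b c u" .
  then show ?thesis
    unfolding cov_hess_def
    using hess_commute[OF y, of "conn G y b u" c] hess_commute[OF y, of u "conn G y b c"]
      hess_commute[OF y, of u c] by simp
qed

abbreviation "edens \<equiv> \<lambda>z. mtrace (G z) (pullback_ip H f z)"

text \<open>This replaces the statement that the Laplacian is non-positive at a maximum: the second
  derivative is taken along each frame vector separately. The square |\<nabla>df|^2 of Bochner's
  formula has the favourable sign and is discarded.\<close>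

lemma cov_hess_sum_at_max:
  assumes y: "y \<in> U" and E: "orthonormal_frame (G y) E"
    and max: "\<And>z. z \<in> U \<Longrightarrow> edens z \<le> edens y"
  shows "(\<Sum>b\<in>UNIV. \<Sum>a\<in>UNIV. mip (H (f y)) (C y (E b) (E b) (E a)) (F y (E a))) \<le> 0"
proof (rule sum_nonpos)
  fix b
  let ?Q = "\<lambda>z u. 2 * mtrace (G z) (\<lambda>v w. mip (H (f z)) (A z u v) (F z w))"
  note dd = has_derivative_mult_right[OF density_derivative_has_derivative[OF y E], of 2]
  note max = second_derivative_at_max[OF M.open_U y density_has_derivative dd max]
  have "?Q y = (\<lambda>v. 0)" by (rule max(1))
  from fun_cong[OF this]
  have 1: "mtrace (G y) (\<lambda>v w. mip (H (f y)) (A y u v) (F y w)) = 0" for u by simp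
  have 2: "mtrace (G y) (\<lambda>v w. mip (H (f y)) (A y u v) (F y w)) = (\<Sum>a\<in>UNIV. mip (H (f y)) (A y u (E a)) (F y (E a)))" for u
    by (rule mtrace_frame[OF E bilinear_compose[OF bilinear_mip bilinearD2[OF bilinear_hess[OF y]] linear_F[OF y]]])
  have "2 * (\<Sum>a\<in>UNIV. mip (H (f y)) (C y (E b) (E b) (E a)) (F y (E a))
        + mip (H (f y)) (A y (conn G y (E b) (E b)) (E a)) (F y (E a))
        + mip (H (f y)) (A y (E b) (E a)) (A y (E b) (E a))) \<le> 0"
    by (rule max(2))
  then have "(\<Sum>a\<in>UNIV. mip (H (f y)) (C y (E b) (E b) (E a)) (F y (E a)))
      + (\<Sum>a\<in>UNIV. mip (H (f y)) (A y (E b) (E a)) (A y (E b) (E a))) \<le> 0"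
    using 1[of "conn G y (E b) (E b)"] unfolding 2 by (simp add: sum.distrib)
  moreover have "0 \<le> (\<Sum>a\<in>UNIV. mip (H (f y)) (A y (E b) (E a)) (A y (E b) (E a)))"
    by (intro sum_nonneg posdef_ge0 N.pos f_in y)
  ultimately show "(\<Sum>a\<in>UNIV. mip (H (f y)) (C y (E b) (E b) (E a)) (F y (E a))) \<le> 0" by linarith
qed

text \<open>For fixed \<open>a\<close>, expand \<open>curv G y (E a) (E b) (E b)\<close> in the
  frame. Skew symmetry in both pairs rewrites its coefficient along \<open>E d\<close> as the
  product of R(E b, E a) E d with E b, and summing over \<open>b\<close> gives the Ricci tensor at
  \<open>E a\<close>, \<open>E d\<close>.\<close>

lemma ricci_term:
  assumes y: "y \<in> U" and E: "orthonormal_frame (G y) E"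
  shows "(\<Sum>a\<in>UNIV. \<Sum>b\<in>UNIV. pullback_ip H f y (curv G y (E a) (E b) (E b)) (E a))
    = (\<Sum>a\<in>UNIV. \<Sum>d\<in>UNIV. mip (ricci G y) (E a) (E d) * pullback_ip H f y (E a) (E d))"
proof -
  have com: "pullback_ip H f y v w = pullback_ip H f y w v" for v w
    unfolding pullback_ip_def by (rule posdef_commute[OF N.pos[OF f_in[OF y]]])
  have ex: "pullback_ip H f y v w = (\<Sum>d\<in>UNIV. mip (G y) v (E d) * pullback_ip H f y (E d) w)" for v w
  proof -
    note L = bilinearD1[OF bilinear_pullback_ip[OF y], of w]
    have "pullback_ip H f y v w = pullback_ip H f y (\<Sum>d\<in>UNIV. mip (G y) v (E d) *\<^sub>R E d) w"
      using orthonormal_frame_expand[OF E M.pos[OF y], of v] by simp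
    also have "\<dots> = (\<Sum>d\<in>UNIV. mip (G y) v (E d) * pullback_ip H f y (E d) w)"
      by (simp add: linear_sum[OF L] linear_scale[OF L])
    finally show ?thesis .
  qed
  have skew: "mip (G y) (curv G y a b b) d = mip (G y) (curv G y b a d) b" for a b d
  proof -
    have "mip (G y) (curv G y a b b) d = - mip (G y) (curv G y a b d) b" by (rule M.curv_skew[OF y])
    also have "curv G y a b d = - curv G y b a d" by (simp add: curv_def)
    finally show ?thesis by (simp add: mip_minus_left)
  qed
  have "(\<Sum>b\<in>UNIV. pullback_ip H f y (curv G y (E a) (E b) (E b)) (E a))
      = (\<Sum>d\<in>UNIV. mip (ricci G y) (E a) (E d) * pullback_ip H f y (E a) (E d))" for a
  proof -
    have "(\<Sum>b\<in>UNIV. pullback_ip H f y (curv G y (E a) (E b) (E b)) (E a))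
      = (\<Sum>b\<in>UNIV. \<Sum>d\<in>UNIV. mip (G y) (curv G y (E b) (E a) (E d)) (E b) * pullback_ip H f y (E d) (E a))"
      unfolding ex[of "curv G y (E a) _ _"] skew ..
    also have "\<dots> = (\<Sum>d\<in>UNIV. \<Sum>b\<in>UNIV. mip (G y) (curv G y (E b) (E a) (E d)) (E b) * pullback_ip H f y (E d) (E a))"
      by (rule sum.swap)
    also have "\<dots> = (\<Sum>d\<in>UNIV. mip (ricci G y) (E a) (E d) * pullback_ip H f y (E a) (E d))"
      unfolding M.ricci_frame[OF y E] com[of "E a"] sum_distrib_right ..
    finally show ?thesis .
  qed
  then show ?thesis by simp
qed

lemma tension_mtrace:
  assumes y: "y \<in> U"
  shows "tension G H f y = mtrace (G y) (A y)"
proof -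
  have p: "partial i (\<lambda>z. f z $ a) z = F z (axis i 1) $ a" if "z \<in> U" for z i a
    unfolding partial_def
    by (rule dir_deriv_eqI[OF bounded_linear.has_derivative[OF bounded_linear_vec_nth df[OF that]], symmetric])
  have p2: "partial i (partial j (\<lambda>z. f z $ a)) y = deriv2 f y (axis i 1) (axis j 1) $ a" for i j a
  proof -
    have "((\<lambda>z. F z (axis j 1) $ a) has_derivative (\<lambda>u. deriv2 f y u (axis j 1) $ a)) (at y)"
      by (rule bounded_linear.has_derivative[OF bounded_linear_vec_nth dF[OF y]])
    then have "(partial j (\<lambda>z. f z $ a) has_derivative (\<lambda>u. deriv2 f y u (axis j 1) $ a)) (at y)"
      by (rule has_derivative_transform_within_open[OF _ M.open_U y]) (simp add: p)
    from dir_deriv_eqI[OF this] show ?thesis unfolding partial_def[of i] by simp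
  qed
  have F: "F y (conn G y (axis i 1) (axis j 1)) $ a = (\<Sum>k\<in>UNIV. christoffel G y k i j * F y (axis k 1) $ a)" for i j a
  proof -
    have "conn G y (axis i 1) (axis j 1) $ k = christoffel G y k i j" for k
    proof -
      have "(\<Sum>q\<in>UNIV. christoffel G y k p q * axis i 1 $ p * axis j 1 $ q)
        = (if p = i then christoffel G y k i j else 0)" for p
        by (cases "p = i") (simp_all add: axis_def if_distrib cong: if_cong)
      then show ?thesis unfolding conn_def by simp
    qed
    then show ?thesis
      by (subst linear_axis_expand[OF linear_F[OF y]]) (simp add: sum_component)
  qed
  have "hess_map G H f y a $ i $ j = A y (axis i 1) (axis j 1) $ a" for a i j
    unfolding hess_map_def hess_def p2 p[OF y] vector_add_component vector_minus_component F
    by (simp add: conn_def)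
  then show ?thesis
    unfolding tension_def trace_metric_def mtrace_def by (simp add: vec_eq_iff sum_component)
qed

text \<open>Time enters only through curves at the fixed point \<open>y\<close>: the metric
  \<open>Gt\<close>, the image point \<open>ft\<close> and the differential \<open>X\<close>, each
  with its derivative at \<open>t\<close>. The assumption on \<open>X\<close> encodes the exchange
  of time and space derivatives, so the argument here is purely spatial.\<close>

lemma evolution_inequality_at_max:
  fixes Gt :: "real \<Rightarrow> real^'m^'m" and ft :: "real \<Rightarrow> real^'n" and X :: "real \<Rightarrow> real^'m \<Rightarrow> real^'n"
  assumes y: "y \<in> U" and max: "\<And>z. z \<in> U \<Longrightarrow> edens z \<le> edens y"
    and K: "0 \<le> K" "\<And>v w. v \<noteq> w \<Longrightarrow> independent {v, w} \<Longrightarrow> sectional H (f y) v w \<le> K"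
    and \<alpha>: "0 \<le> \<alpha>"
    and I: "open I" "t \<in> I" "\<And>s. s \<in> I \<Longrightarrow> posdef (Gt s)"
    and Gt: "Gt t = G y" "(Gt has_vector_derivative (- 2) *\<^sub>R ricci G y + (2 * \<alpha>) *\<^sub>R grad_tensor H f y) (at t)"
    and ft: "ft t = f y" "(ft has_vector_derivative tension G H f y) (at t)"
    and X: "X t = F y" "\<And>i. ((\<lambda>s. X s (axis i 1)) has_vector_derivative dir_deriv (tension G H f) y (axis i 1)) (at t)"
  shows "\<exists>d. ((\<lambda>s. mtrace (Gt s) (\<lambda>v w. mip (H (ft s)) (X s v) (X s w))) has_real_derivative d) (at t)
    \<and> d \<le> 2 * (K - \<alpha> / CARD('m)) * (edens y)\<^sup>2"
proof -
  obtain E where E: "orthonormal_frame (G y) E"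
    using orthonormal_frame_exists[OF M.pos[OF y]] .
  note P = N.pos[OF f_in[OF y]]
  let ?ip = "mip (H (f y))" and ?S = "pullback_ip H f y"
  let ?\<tau> = "tension G H f y"
  let ?G' = "(- 2) *\<^sub>R ricci G y + (2 * \<alpha>) *\<^sub>R grad_tensor H f y"
  define T where "T = dir_deriv (tension G H f) y"
  have "((\<lambda>z. tension G H f z) has_derivative
    (\<lambda>b. (\<Sum>a\<in>UNIV. C y b (E a) (E a)) - conn H (f y) (F y b) (mtrace (G y) (A y)))) (at y)"
    by (rule has_derivative_transform_within_open[OF tension_has_derivative[OF y E] M.open_U y])
      (simp add: tension_mtrace)
  note dT = this
  \<comment> \<open>Torsion-freeness of the target connection matches this correction with the one
    subtracted in \<open>tension_has_derivative\<close>; the left-hand side is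
    \<nabla>\<tau>.\<close>
  then have T: "T b + conn H (f y) ?\<tau> (F y b) = (\<Sum>a\<in>UNIV. C y b (E a) (E a))" for b
    unfolding T_def tension_mtrace[OF y] N.conn_commute[OF f_in[OF y], of _ "F y b"]
    by (simp flip: dir_deriv_eqI[OF dT] add: tension_mtrace[OF y])
  have linT: "linear T"
    unfolding T_def by (rule linear_frechet_derivative[OF differentiableI[OF dT]])
  have dfr: "f differentiable at y" by (rule differentiableI[OF df[OF y]])
  \<comment> \<open>The time derivative of the pulled-back form. The image point moves with velocity
    \<open>?\<tau>\<close>, which accounts for the connection terms.\<close>
  let ?B' = "\<lambda>v w. ?ip (T v + conn H (f y) ?\<tau> (F y v)) (F y w) + ?ip (F y v) (T w + conn H (f y) ?\<tau> (F y w))"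
  have lin2: "linear (\<lambda>v. T v + conn H (f y) ?\<tau> (F y v))"
    by (intro linear_compose_add linT linear_compose[OF linear_F[OF y] bilinearD2[OF bilinear_conn], unfolded o_def])
  have bil: "bilinear ?B'"
    by (rule bilinear_add[OF bilinear_compose[OF bilinear_mip lin2 linear_F[OF y]]
          bilinear_compose[OF bilinear_mip linear_F[OF y] lin2]])
  have bil': "bilinear (\<lambda>v w. r * ?B' v w)" for r
    by (rule bilinear_linear[OF _ bil]) (simp add: linear_times)
  have dB: "((\<lambda>s. mip (H (ft s)) (X s (axis i 1)) (X s (axis j 1))) has_derivative
      (\<lambda>r. r * ?B' (axis i 1) (axis j 1))) (at t)" for i j
  proof -
    have "((\<lambda>s. mip (H (ft s)) (X s (axis i 1)) (X s (axis j 1))) has_derivative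
      (\<lambda>r. mip (H (ft t)) (r *\<^sub>R T (axis i 1) + conn H (ft t) (r *\<^sub>R ?\<tau>) (X t (axis i 1))) (X t (axis j 1))
        + mip (H (ft t)) (X t (axis i 1)) (r *\<^sub>R T (axis j 1) + conn H (ft t) (r *\<^sub>R ?\<tau>) (X t (axis j 1))))) (at t)"
      unfolding T_def
      by (rule N.mip_has_derivative[where f = ft and x = t])
        (use f_in[OF y] ft X in \<open>auto simp: has_vector_derivative_def\<close>)
    then show ?thesis
      unfolding ft(1) X(1)
      by (simp add: bilinear_lmul[OF bilinear_conn] mip_scale_left mip_scale_right flip: scaleR_add_right distrib_left)
  qed
  have dG: "(Gt has_derivative (\<lambda>r. r *\<^sub>R ?G')) (at t)"
    using Gt(2) unfolding has_vector_derivative_def .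
  define d where "d = (\<Sum>a\<in>UNIV. ?B' (E a) (E a)) - (\<Sum>a\<in>UNIV. \<Sum>b\<in>UNIV. mip ?G' (E a) (E b) * ?S (E a) (E b))"
  have "((\<lambda>s. mtrace (Gt s) (\<lambda>v w. mip (H (ft s)) (X s v) (X s w))) has_derivative
    (\<lambda>r. (\<Sum>a\<in>UNIV. r * ?B' (E a) (E a))
        - (\<Sum>a\<in>UNIV. \<Sum>b\<in>UNIV. mip (r *\<^sub>R ?G') (E a) (E b) *\<^sub>R mip (H (ft t)) (X t (E a)) (X t (E b))))) (at t)"
    by (rule mtrace_has_derivative[where B' = "\<lambda>r v w. r * ?B' v w", OF dG I _ dB _ bil'])
      (use E bilinear_pullback_ip[OF y] in \<open>simp_all add: Gt ft X pullback_ip_def[abs_def]\<close>)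
  moreover have "(\<lambda>r. (\<Sum>a\<in>UNIV. r * ?B' (E a) (E a))
        - (\<Sum>a\<in>UNIV. \<Sum>b\<in>UNIV. mip (r *\<^sub>R ?G') (E a) (E b) *\<^sub>R mip (H (ft t)) (X t (E a)) (X t (E b))))
      = (*) d"
    unfolding d_def ft(1) X(1) mip_scaleR_matrix pullback_ip_def
    by (rule ext) (simp add: right_diff_distrib sum_distrib_left mult_ac)
  ultimately have der: "((\<lambda>s. mtrace (Gt s) (\<lambda>v w. mip (H (ft s)) (X s v) (X s w))) has_real_derivative d) (at t)"
    unfolding has_field_derivative_def by simp
  have B: "?B' (E a) (E a) = 2 * (\<Sum>b\<in>UNIV. ?ip (C y (E a) (E b) (E b)) (F y (E a)))" for a
    unfolding posdef_commute[OF P, of "F y (E a)"] T by (simp add: mip_sum_left)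
  \<comment> \<open>Symmetry of the second fundamental form and the Ricci identity move the repeated
    direction to the front, where the trace over \<open>b\<close> is the one controlled at a
    maximum.\<close>
  have C: "?ip (C y a b b) (F y a) = ?ip (C y b b a) (F y a) + ?ip (curv H (f y) (F y a) (F y b) (F y b)) (F y a)
      - ?S (curv G y a b b) a" for a b
  proof -
    have "C y a b b = C y b b a + curv H (f y) (F y a) (F y b) (F y b) - F y (curv G y a b b)"
      using ricci_identity[OF y, of a b b] cov_hess_commute[OF y, of b a b] by (simp add: algebra_simps)
    then show ?thesis by (simp add: mip_add_left mip_diff_left pullback_ip_def)
  qed
  define R where "R = (\<Sum>a\<in>UNIV. \<Sum>b\<in>UNIV. mip (ricci G y) (E a) (E b) * ?S (E a) (E b))"
  define Q where "Q = (\<Sum>a\<in>UNIV. \<Sum>b\<in>UNIV. (?S (E a) (E b))\<^sup>2)"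
  define Z where "Z = (\<Sum>a\<in>UNIV. \<Sum>b\<in>UNIV. ?ip (curv H (f y) (F y (E a)) (F y (E b)) (F y (E b))) (F y (E a)))"
  define L where "L = (\<Sum>a\<in>UNIV. \<Sum>b\<in>UNIV. ?ip (C y (E b) (E b) (E a)) (F y (E a)))"
  have "(\<Sum>a\<in>UNIV. ?B' (E a) (E a)) = 2 * (L + Z - R)"
    unfolding B C L_def Z_def R_def ricci_term[OF y E, symmetric]
    by (simp add: sum.distrib sum_subtractf flip: sum_distrib_left)
  moreover have "(\<Sum>a\<in>UNIV. \<Sum>b\<in>UNIV. mip ?G' (E a) (E b) * ?S (E a) (E b)) = - 2 * R + 2 * \<alpha> * Q"
    unfolding mip_add_matrix mip_scaleR_matrix grad_tensor_mip[OF dfr] R_def Q_def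
    by (simp add: left_diff_distrib sum_subtractf sum_negf sum_distrib_left power2_eq_square mult.assoc)
  \<comment> \<open>The \<open>R\<close> produced by commuting derivatives and the one from the
    evolution of the metric have coefficients -2 and 2.\<close>
  ultimately have d: "d = 2 * L + 2 * Z - 2 * \<alpha> * Q" unfolding d_def by simp
  have L: "L \<le> 0"
    using cov_hess_sum_at_max[OF y E max] unfolding L_def by (subst sum.swap) simp
  have dens: "edens y = (\<Sum>a\<in>UNIV. ?S (E a) (E a))"
    by (rule mtrace_frame[OF E bilinear_pullback_ip[OF y]])
  have Q0: "0 \<le> Q" unfolding Q_def by (intro sum_nonneg zero_le_power2)
  \<comment> \<open>The Gram determinants of the images of the frame add up to
    (|\<nabla>\<phi>|^2)^2 - Q, and \<open>K\<close> being non-negative lets Q be dropped.\<close>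
  have Z: "Z \<le> K * (edens y)\<^sup>2"
  proof -
    have "Z \<le> (\<Sum>a\<in>UNIV. \<Sum>b\<in>UNIV. K * (?S (E a) (E a) * ?S (E b) (E b) - (?S (E a) (E b))\<^sup>2))"
      unfolding Z_def pullback_ip_def
      by (intro sum_mono N.curvature_le[OF f_in[OF y] K])
    also have "\<dots> = K * ((edens y)\<^sup>2 - Q)"
      unfolding dens power2_eq_square[of "sum _ _"] sum_product Q_def
      by (simp add: sum_subtractf flip: sum_distrib_left)
    also have "\<dots> \<le> K * (edens y)\<^sup>2"
      using K(1) Q0 by (intro mult_left_mono) auto
    finally show ?thesis .
  qed
  \<comment> \<open>Cauchy-Schwarz against the constant 1 on the diagonal of the pulled-back form,
    then the diagonal is bounded by all entries; this is where the dimension comes in.\<close>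
  have "(edens y)\<^sup>2 \<le> (\<Sum>a\<in>UNIV. (?S (E a) (E a))\<^sup>2) * (\<Sum>a\<in>(UNIV::'m set). 1\<^sup>2)"
    unfolding dens using Cauchy_Schwarz_ineq_sum[of "\<lambda>a. ?S (E a) (E a)" "\<lambda>a. 1" "UNIV :: 'm set"] by simp
  also have "\<dots> \<le> Q * CARD('m)"
  proof -
    have "(?S (E a) (E a))\<^sup>2 \<le> (\<Sum>b\<in>UNIV. (?S (E a) (E b))\<^sup>2)" for a
      by (rule member_le_sum) auto
    then have "(\<Sum>a\<in>UNIV. (?S (E a) (E a))\<^sup>2) \<le> Q" unfolding Q_def by (rule sum_mono)
    then show ?thesis by simp
  qed
  finally have "(edens y)\<^sup>2 / CARD('m) \<le> Q" by (simp add: pos_divide_le_eq)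
  then have "\<alpha> * ((edens y)\<^sup>2 / CARD('m)) \<le> \<alpha> * Q" using \<alpha> by (rule mult_left_mono)
  then have "d \<le> 2 * (K * (edens y)\<^sup>2) - 2 * (\<alpha> * ((edens y)\<^sup>2 / CARD('m)))"
    unfolding d using L Z by linarith
  also have "\<dots> = 2 * (K - \<alpha> / CARD('m)) * (edens y)\<^sup>2" by (simp add: algebra_simps)
  finally show ?thesis using der by blast
qed

end

section \<open>Charts\<close>

lemma is_chartD:
  assumes "is_chart c"
  shows "open (dom_chart c)" "open (img_chart c)"
    "continuous_on (dom_chart c) (coord c)" "continuous_on (img_chart c) (inv_coord c)"
    "p \<in> dom_chart c \<Longrightarrow> coord c p \<in> img_chart c" "p \<in> dom_chart c \<Longrightarrow> inv_coord c (coord c p) = p"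
    "y \<in> img_chart c \<Longrightarrow> inv_coord c y \<in> dom_chart c" "y \<in> img_chart c \<Longrightarrow> coord c (inv_coord c y) = y"
  using assms unfolding is_chart_def homeomorphism_def by auto

lemma riemannian_metric_coord_metric:
  assumes "smooth_atlas A" "riemannian_metric A g" "c \<in> A"
  shows "coord_metric (img_chart c) (g c)"
proof
  have "open (img_chart c)" using assms is_chartD(2) unfolding smooth_atlas_def by blast
  then show "smooth_in (img_chart c) (g c)"
    using assms unfolding riemannian_metric_def by (intro smooth_on_open) auto
  show "posdef (g c y)" if "y \<in> img_chart c" for y
    using assms that unfolding riemannian_metric_def posdef_def mip_def by blast
qed

lemma mip_congruence: "mip (transpose J ** G ** J) v w = mip G (J *v v) (J *v w)"
proof -
  have "mip (transpose J ** G ** J) v w = v \<bullet> (transpose J *v (G *v (J *v w)))"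
    unfolding mip_def by (simp add: matrix_vector_mul_assoc matrix_mul_assoc)
  also have "\<dots> = mip G (J *v v) (J *v w)"
    unfolding mip_def by (metis dot_lmul_matrix inner_commute vector_transpose_matrix)
  finally show ?thesis .
qed

lemma coord_change:
  assumes A: "smooth_atlas A" and c: "c \<in> A" and c': "c' \<in> A" and p: "p \<in> dom_chart c" "p \<in> dom_chart c'"
  shows "(coord c' \<circ> inv_coord c) differentiable at (coord c p)"
    and "riemannian_metric A g \<Longrightarrow> mip (g c (coord c p)) v w
      = mip (g c' (coord c' p)) (dir_deriv (coord c' \<circ> inv_coord c) (coord c p) v)
          (dir_deriv (coord c' \<circ> inv_coord c) (coord c p) w)"
proof -
  have ch: "is_chart c" "is_chart c'" using A c c' unfolding smooth_atlas_def by blast+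
  let ?S = "coord c ` (dom_chart c \<inter> dom_chart c')"
  have "?S = img_chart c \<inter> inv_coord c -` dom_chart c'"
    using is_chartD[OF ch(1)] by (force simp: image_iff)
  moreover have "open (img_chart c \<inter> inv_coord c -` dom_chart c')"
    by (rule continuous_open_preimage[OF is_chartD(4)[OF ch(1)] is_chartD(2)[OF ch(1)] is_chartD(1)[OF ch(2)]])
  ultimately have op: "open ?S" by simp
  have "smooth_on ?S (coord c' \<circ> inv_coord c)"
    using A c c' unfolding smooth_atlas_def by blast
  from smooth_in_differentiable[OF smooth_on_open[OF op this]]
  show d: "(coord c' \<circ> inv_coord c) differentiable at (coord c p)" using p by blast
  have J: "transition_matrix c c' (coord c p) *v v = dir_deriv (coord c' \<circ> inv_coord c) (coord c p) v" for v
    unfolding transition_matrix_def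
    by (rule fun_cong[OF matrix_vector_mul(2)[OF linear_frechet_derivative[OF d]]])
  show "mip (g c (coord c p)) v w
      = mip (g c' (coord c' p)) (dir_deriv (coord c' \<circ> inv_coord c) (coord c p) v)
          (dir_deriv (coord c' \<circ> inv_coord c) (coord c p) w)" if "riemannian_metric A g"
  proof -
    have "g c (coord c p) = transpose (transition_matrix c c' (coord c p)) ** g c' (coord c' p)
            ** transition_matrix c c' (coord c p)"
      using that c c' p unfolding riemannian_metric_def by blast
    then show ?thesis by (simp add: mip_congruence J)
  qed
qed

lemma local_rep_domain_open:
  assumes "is_chart c" "is_chart d" "continuous_on UNIV h"
  shows "open {y \<in> img_chart c. h (inv_coord c y) \<in> dom_chart d}"
proof -
  have "continuous_on (img_chart c) (\<lambda>y. h (inv_coord c y))"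
    using continuous_on_compose2[OF assms(3) is_chartD(4)[OF assms(1)]] by simp
  from continuous_open_preimage[OF this is_chartD(2)[OF assms(1)] is_chartD(1)[OF assms(2)]]
  show ?thesis by (simp add: vimage_def Int_def)
qed

text \<open>The differential of a transition map is an isometry between the coordinate metrics, so
  it sends an orthonormal frame to an orthonormal frame and the two frame sums agree term by term.
  Differentiability in the pair \<open>c\<close>, \<open>d\<close> follows from that in
  \<open>c'\<close>, \<open>d'\<close> by the chain rule.\<close>

lemma energy_density_in_change_charts:
  assumes A: "smooth_atlas A" "riemannian_metric A g" and B: "smooth_atlas B" "riemannian_metric B \<gamma>"
    and h: "continuous_on UNIV h"
    and c: "c \<in> A" "p \<in> dom_chart c" and c': "c' \<in> A" "p \<in> dom_chart c'"
    and d: "d \<in> B" "h p \<in> dom_chart d" and d': "d' \<in> B" "h p \<in> dom_chart d'"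
    and diff: "local_rep c' d' h differentiable at (coord c' p)"
  shows "energy_density_in g \<gamma> c d h p = energy_density_in g \<gamma> c' d' h p"
proof -
  have ch: "is_chart c" "is_chart c'" "is_chart d" "is_chart d'"
    using A B c c' d d' unfolding smooth_atlas_def by blast+
  let ?y = "coord c p" and ?y' = "coord c' p" and ?z = "coord d (h p)" and ?z' = "coord d' (h p)"
  let ?\<psi> = "coord c' \<circ> inv_coord c" and ?\<chi> = "coord d \<circ> inv_coord d'"
  let ?f = "local_rep c d h" and ?f' = "local_rep c' d' h"
  have y: "?y \<in> img_chart c" "inv_coord c ?y = p" using is_chartD(5,6)[OF ch(1) c(2)] by auto
  have y': "?y' \<in> img_chart c'" "inv_coord c' ?y' = p" using is_chartD(5,6)[OF ch(2) c'(2)] by auto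
  have fy: "?f ?y = ?z" "?f' ?y' = ?z'" "?\<psi> ?y = ?y'" unfolding local_rep_def using y y' by auto
  note \<psi> = coord_change(1)[OF A(1) c(1) c'(1) c(2) c'(2)]
  note \<chi> = coord_change(1)[OF B(1) d'(1) d(1) d'(2) d(2)]
  have D\<psi>: "(?\<psi> has_derivative dir_deriv ?\<psi> ?y) (at ?y)" using \<psi> frechet_derivative_works by blast
  have Df': "(?f' has_derivative dir_deriv ?f' ?y') (at (?\<psi> ?y))"
    using diff unfolding fy frechet_derivative_works .
  have D\<chi>: "(?\<chi> has_derivative dir_deriv ?\<chi> ?z') (at (?f' (?\<psi> ?y)))"
    using \<chi> unfolding fy frechet_derivative_works .
  \<comment> \<open>The neighbourhood on which both coordinate expressions are related by the
    transition maps; \<open>id\<close> brings the first set into the form treated by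
    \<open>local_rep_domain_open\<close>.\<close>
  let ?S = "{z \<in> img_chart c. id (inv_coord c z) \<in> dom_chart c'} \<inter> {z \<in> img_chart c. h (inv_coord c z) \<in> dom_chart d'}"
  have "open ?S"
    by (intro open_Int local_rep_domain_open ch h continuous_on_id')
  moreover have "?y \<in> ?S" using y c' d' by simp
  moreover have "?\<chi> (?f' (?\<psi> z)) = ?f z" if "z \<in> ?S" for z
    using that is_chartD(6)[OF ch(2)] is_chartD(6)[OF ch(4)] by (simp add: local_rep_def)
  ultimately have Df: "(?f has_derivative (\<lambda>u. dir_deriv ?\<chi> ?z' (dir_deriv ?f' ?y' (dir_deriv ?\<psi> ?y u)))) (at ?y)"
    using has_derivative_transform_within_open[OF
        has_derivative_compose[OF has_derivative_compose[OF D\<psi> Df'] D\<chi>]] by blast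
  have dfu: "dir_deriv ?f ?y u = dir_deriv ?\<chi> ?z' (dir_deriv ?f' ?y' (dir_deriv ?\<psi> ?y u))" for u
    by (rule dir_deriv_eqI[OF Df, symmetric])
  interpret g: coord_metric "img_chart c" "g c" by (rule riemannian_metric_coord_metric[OF A c(1)])
  obtain E where E: "orthonormal_frame (g c ?y) E" using orthonormal_frame_exists[OF g.pos[OF y(1)]] .
  define E' where "E' = (\<lambda>a. dir_deriv ?\<psi> ?y (E a))"
  note ge = coord_change(2)[OF A(1) c(1) c'(1) c(2) c'(2) A(2)]
  note he = coord_change(2)[OF B(1) d'(1) d(1) d'(2) d(2) B(2)]
  have E': "orthonormal_frame (g c' ?y') E'"
    using E unfolding orthonormal_frame_def E'_def ge .
  have bil: "bilinear (pullback_ip H f y)" if "f differentiable at y" for H :: "real^'k::finite \<Rightarrow> _" and f :: "real^'l::finite \<Rightarrow> _" and y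
    unfolding pullback_ip_def[abs_def]
    by (intro bilinear_compose[OF bilinear_mip] linear_frechet_derivative that)
  have "energy_density_in g \<gamma> c d h p = (\<Sum>a\<in>UNIV. pullback_ip (\<gamma> d) ?f ?y (E a) (E a))"
    unfolding energy_density_in_def energy_mtrace[OF differentiableI[OF Df]]
    by (rule mtrace_frame[OF E bil[OF differentiableI[OF Df]]])
  also have "\<dots> = (\<Sum>a\<in>UNIV. pullback_ip (\<gamma> d') ?f' ?y' (E' a) (E' a))"
    unfolding pullback_ip_def dfu fy E'_def he ..
  also have "\<dots> = energy_density_in g \<gamma> c' d' h p"
    unfolding energy_density_in_def energy_mtrace[OF diff]
    by (rule mtrace_frame[OF E' bil[OF diff], symmetric])
  finally show ?thesis .
qed

lemma chart_at_mem:
  assumes "smooth_atlas A"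
  shows "chart_at A p \<in> A" "p \<in> dom_chart (chart_at A p)"
proof -
  have "\<exists>c. c \<in> A \<and> p \<in> dom_chart c" using assms unfolding smooth_atlas_def by blast
  from someI_ex[OF this] show "chart_at A p \<in> A" "p \<in> dom_chart (chart_at A p)"
    unfolding chart_at_def by auto
qed

section \<open>Functions smooth on time slices\<close>

lemma smooth_on_slice:
  fixes f :: "real \<Rightarrow> 'e::euclidean_space \<Rightarrow> 'f::real_normed_vector"
  assumes f: "smooth_on S (\<lambda>(t, y). f t y)" and op: "open {y. (t, y) \<in> S}"
  shows "smooth_in {y. (t, y) \<in> S} (f t)"
proof (rule smooth_on_open[OF op], unfold smooth_on_def, rule ballI)
  fix y assume "y \<in> {y. (t, y) \<in> S}"
  then obtain V \<Phi> where V: "open V" "(t, y) \<in> V" "\<forall>k. Ck_on k V \<Phi>" "\<forall>w\<in>V \<inter> S. \<Phi> w = (\<lambda>(t, y). f t y) w"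
    using f unfolding smooth_on_def by blast
  have "smooth_in V \<Phi>" using V unfolding smooth_in_def by blast
  from smooth_in_Pair_slice(1)[OF this, of t]
  have "open {y. (t, y) \<in> V}" "\<forall>k. Ck_on k {y. (t, y) \<in> V} (\<lambda>y. \<Phi> (t, y))"
    unfolding smooth_in_def by auto
  then show "\<exists>V F. open V \<and> y \<in> V \<and> (\<forall>k. Ck_on k V F) \<and> (\<forall>z\<in>V \<inter> {y. (t, y) \<in> S}. F z = f t z)"
    using V(2,4) by (intro exI[of _ "{y. (t, y) \<in> V}"] exI[of _ "\<lambda>y. \<Phi> (t, y)"]) auto
qed

text \<open>The slices are open in space even at t = 0, so the spatial derivative there equals the
  derivative in direction \<open>(0, u)\<close> of any local smooth extension, which is continuous
  across t = 0.\<close>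

lemma continuous_on_slice_derivative:
  fixes f :: "real \<Rightarrow> 'e::euclidean_space \<Rightarrow> 'f::real_normed_vector"
  assumes f: "smooth_on S (\<lambda>(t, y). f t y)" and op: "\<And>t. open {y. (t, y) \<in> S}"
  shows "continuous_on S (\<lambda>(t, y). f t y)" "continuous_on S (\<lambda>(t, y). dir_deriv (f t) y u)"
proof -
  have "continuous (at w within S) (\<lambda>(t, y). f t y) \<and> continuous (at w within S) (\<lambda>(t, y). dir_deriv (f t) y u)"
    if "w \<in> S" for w
  proof -
    from bspec[OF f[unfolded smooth_on_def] that]
    obtain V \<Phi> where V: "open V" "w \<in> V" "\<forall>k. Ck_on k V \<Phi>" "\<forall>w\<in>V \<inter> S. \<Phi> w = (\<lambda>(t, y). f t y) w"
      by (elim exE conjE)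
    have sm: "smooth_in V \<Phi>" using V unfolding smooth_in_def by blast
    have eq: "dir_deriv (f t) y u = dir_deriv \<Phi> (t, y) (0, u)" if "(t, y) \<in> V \<inter> S" for t y
    proof -
      have 1: "(f t has_derivative dir_deriv (f t) y) (at y)"
        by (rule smooth_in_has_derivative[OF smooth_on_slice[OF f op]]) (use that in simp)
      have 2: "open ({y. (t, y) \<in> V} \<inter> {y. (t, y) \<in> S})"
        using smooth_in_Pair_slice(1)[OF sm, of t] op[of t] unfolding smooth_in_def by blast
      have "((\<lambda>z. \<Phi> (t, z)) has_derivative dir_deriv (f t) y) (at y)"
        by (rule has_derivative_transform_within_open[OF 1 2]) (use V(4) that in auto)
      from dir_deriv_eqI[OF this] show ?thesis
        using smooth_in_Pair_slice(2)[OF sm, of t y u] that by simp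
    qed
    have at: "at w within S = at w within (V \<inter> S)"
      by (rule at_within_nhd[OF V(2,1)]) auto
    have ev: "\<forall>\<^sub>F z in at w within S. z \<in> V \<inter> S"
      unfolding at by (rule eventually_at_topological[THEN iffD2]) (use V(1,2) in auto)
    have c1: "continuous (at w within S) \<Phi>"
      using smooth_in_isCont[OF sm V(2)] continuous_at_imp_continuous_at_within by blast
    have c2: "continuous (at w within S) (\<lambda>z. dir_deriv \<Phi> z (0, u))"
      using smooth_in_isCont[OF smooth_in_dir_deriv[OF sm] V(2)] continuous_at_imp_continuous_at_within by blast
    have "continuous (at w within S) (\<lambda>(t, y). f t y)"
    proof -
      have "\<forall>\<^sub>F z in at w within S. \<Phi> z = (\<lambda>(t, y). f t y) z"
        using ev by (rule eventually_mono) (use V(4) in blast)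
      moreover have "\<Phi> w = (\<lambda>(t, y). f t y) w" using V(2,4) that by blast
      ultimately show ?thesis
        using Lim_transform_eventually[OF c1[unfolded continuous_within]]
        unfolding continuous_within by simp
    qed
    moreover have "continuous (at w within S) (\<lambda>(t, y). dir_deriv (f t) y u)"
    proof -
      have "\<forall>\<^sub>F z in at w within S. dir_deriv \<Phi> z (0, u) = (\<lambda>(t, y). dir_deriv (f t) y u) z"
        using ev by (rule eventually_mono) (auto simp: eq)
      moreover have "dir_deriv \<Phi> w (0, u) = (\<lambda>(t, y). dir_deriv (f t) y u) w"
        using V(2) that by (cases w) (simp add: eq)
      ultimately show ?thesis
        using Lim_transform_eventually[OF c2[unfolded continuous_within]]
        unfolding continuous_within by simp
    qed
    ultimately show ?thesis ..
  qed
  then show "continuous_on S (\<lambda>(t, y). f t y)" "continuous_on S (\<lambda>(t, y). dir_deriv (f t) y u)"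
    unfolding continuous_on_eq_continuous_within by blast+
qed

text \<open>On the slice the joint time derivative equals \<tau>, so the claim is the symmetry of
  the mixed derivative in the directions \<open>(1, 0)\<close> and \<open>(0, u)\<close>.\<close>

lemma mixed_time_derivative:
  fixes f :: "real \<Rightarrow> 'e::euclidean_space \<Rightarrow> 'f::euclidean_space"
  assumes f: "smooth_in W (\<lambda>(t, y). f t y)" and w: "(t, y) \<in> W"
    and eq: "\<And>z. (t, z) \<in> W \<Longrightarrow> ((\<lambda>s. f s z) has_vector_derivative \<tau> z) (at t)"
  shows "((\<lambda>s. dir_deriv (f s) y u) has_vector_derivative dir_deriv \<tau> y u) (at t)"
proof -
  let ?\<Phi> = "\<lambda>(t, y). f t y"
  have W: "open W" using f unfolding smooth_in_def by blast
  have time: "((\<lambda>s. p (s, z)) has_derivative (\<lambda>r. r *\<^sub>R dir_deriv p (t, z) (1, 0))) (at t)"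
    if "smooth_in W p" "(t, z) \<in> W" for p :: "real \<times> 'e \<Rightarrow> 'f" and z
  proof -
    have "((\<lambda>s. (s, z)) has_derivative (\<lambda>r. (r, 0))) (at t)"
      by (auto intro!: derivative_eq_intros)
    from has_derivative_compose[OF this smooth_in_has_derivative[OF that]]
    have "((\<lambda>s. p (s, z)) has_derivative (\<lambda>r. dir_deriv p (t, z) (r, 0))) (at t)" .
    moreover have "(\<lambda>r. dir_deriv p (t, z) (r, 0)) = (\<lambda>r. r *\<^sub>R dir_deriv p (t, z) (1, 0))"
    proof
      show "dir_deriv p (t, z) (r, 0) = r *\<^sub>R dir_deriv p (t, z) (1, 0)" for r
        using linear_scale[OF smooth_in_linear[OF that], of r "(1, 0)"] by simp
    qed
    ultimately show ?thesis by simp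
  qed
  have \<tau>: "\<tau> z = dir_deriv ?\<Phi> (t, z) (1, 0)" if "(t, z) \<in> W" for z
  proof -
    have "((\<lambda>s. f s z) has_derivative (\<lambda>r. r *\<^sub>R dir_deriv ?\<Phi> (t, z) (1, 0))) (at t)"
      using time[OF f that] by simp
    from fun_cong[OF has_derivative_unique[OF eq[OF that, unfolded has_vector_derivative_def] this], of 1]
    show ?thesis by simp
  qed
  note D = smooth_in_dir_deriv[OF f, of "(0, u)"]
  have sl: "dir_deriv (f s) y u = dir_deriv ?\<Phi> (s, y) (0, u)" if "(s, y) \<in> W" for s
    using smooth_in_Pair_slice(2)[OF f that, of u] by simp
  have 1: "((\<lambda>s. dir_deriv (f s) y u) has_derivative
      (\<lambda>r. r *\<^sub>R dir_deriv (\<lambda>z. dir_deriv ?\<Phi> z (0, u)) (t, y) (1, 0))) (at t)"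
  proof (rule has_derivative_transform_within_open[OF time[OF D w]])
    show "open ((\<lambda>s. (s, y)) -` W)" by (intro open_vimage W continuous_intros)
  qed (use w sl in auto)
  have "dir_deriv (\<lambda>z. dir_deriv ?\<Phi> z (0, u)) (t, y) (1, 0) = dir_deriv (\<lambda>z. dir_deriv ?\<Phi> z (1, 0)) (t, y) (0, u)"
    by (rule smooth_in_symmetric[OF f w])
  also have "\<dots> = dir_deriv (\<lambda>z. dir_deriv ?\<Phi> (t, z) (1, 0)) y u"
    by (rule smooth_in_Pair_slice(2)[OF smooth_in_dir_deriv[OF f] w, symmetric])
  also have "\<dots> = dir_deriv \<tau> y u"
  proof -
    have sm: "smooth_in {z. (t, z) \<in> W} (\<lambda>z. dir_deriv ?\<Phi> (t, z) (1, 0))"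
      by (rule smooth_in_Pair_slice(1)[OF smooth_in_dir_deriv[OF f]])
    then have "open {z. (t, z) \<in> W}" unfolding smooth_in_def by blast
    from frechet_derivative_transform_within_open[OF smooth_in_differentiable[OF sm] this, of y \<tau>]
    show ?thesis using w \<tau> by simp
  qed
  finally show ?thesis using 1 unfolding has_vector_derivative_def by simp
qed

section \<open>A maximum principle on compact spaces\<close>

text \<open>A first-contact argument. The differential inequality is demanded only where
  \<open>e\<close> touches the barrier at a spatial maximum, and only after time \<open>a\<close>;
  at time \<open>a\<close> itself continuity is enough.\<close>

lemma barrier_comparison:
  fixes e :: "real \<Rightarrow> 'a::t2_space \<Rightarrow> real"
  assumes cpt: "compact (UNIV :: 'a set)" and cont: "continuous_on ({a..b} \<times> UNIV) (\<lambda>(t, x). e t x)"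
    and \<rho>: "continuous_on {a..b} \<rho>" "\<And>t. a < t \<Longrightarrow> t \<le> b \<Longrightarrow> (\<rho> has_real_derivative \<rho>' t) (at t)"
    and init: "\<And>x. e a x < \<rho> a"
    and evo: "\<And>t x. a < t \<Longrightarrow> t \<le> b \<Longrightarrow> e t x = \<rho> t \<Longrightarrow> (\<And>z. e t z \<le> e t x)
      \<Longrightarrow> \<exists>d. ((\<lambda>s. e s x) has_real_derivative d) (at t) \<and> d < \<rho>' t"
    and t: "a \<le> t" "t \<le> b"
  shows "e t x < \<rho> t"
proof (rule ccontr)
  assume neg: "\<not> e t x < \<rho> t"
  let ?K = "{a..b} \<times> (UNIV :: 'a set)"
  define h where "h = (\<lambda>(t, x). e t x - \<rho> t)"
  have h: "continuous_on ?K h"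
  proof -
    have "continuous_on ?K (\<lambda>w. \<rho> (fst w))"
      by (rule continuous_on_compose2[OF \<rho>(1)]) (auto intro!: continuous_intros)
    from continuous_on_diff[OF cont this] show ?thesis unfolding h_def by (simp add: case_prod_beta)
  qed
  have K: "compact ?K" by (intro compact_Times compact_Icc cpt)
  then have "closed (?K \<inter> h -` {0..})"
    by (intro continuous_closed_preimage h compact_imp_closed closed_atLeast)
  from compact_Int_closed[OF K this] have "compact (?K \<inter> h -` {0..})" by (simp add: Int_assoc[symmetric])
  then have cB: "compact (fst ` (?K \<inter> h -` {0..}))"
    by (intro compact_continuous_image continuous_intros)
  have "(t, x) \<in> ?K \<inter> h -` {0..}" using neg t by (simp add: h_def)
  then have "fst ` (?K \<inter> h -` {0..}) \<noteq> {}" by blast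
  \<comment> \<open>A first contact time exists because the set where \<open>e\<close> is at least
    \<open>\<rho>\<close> is compact, and so is its projection to the time axis.\<close>
  from compact_attains_inf[OF cB this]
  obtain w where w: "w \<in> ?K \<inter> h -` {0..}" "\<And>z. z \<in> ?K \<inter> h -` {0..} \<Longrightarrow> fst w \<le> fst z" by blast
  obtain t0 x0 where tx: "w = (t0, x0)" by (cases w)
  have t0: "a \<le> t0" "t0 \<le> b" "\<rho> t0 \<le> e t0 x0" using w(1) by (auto simp: tx h_def)
  have below: "e s z < \<rho> s" if "a \<le> s" "s < t0" for s z
  proof (rule ccontr)
    assume "\<not> e s z < \<rho> s"
    then have "(s, z) \<in> ?K \<inter> h -` {0..}" using that t0 by (simp add: h_def)
    from w(2)[OF this] show False using that by (simp add: tx)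
  qed
  have at0: "a < t0" using init[of x0] t0 by (cases "a = t0") auto
  have le: "e t0 z \<le> \<rho> t0" for z
  proof -
    \<comment> \<open>The strict inequalities before \<open>t0\<close> survive at \<open>t0\<close>
      as weak ones, so the contact point is a spatial maximum of \<open>e t0\<close>.\<close>
    have cl: "closure {a..<t0} = {a..t0}" using at0 by simp
    have "continuous_on {a..t0} (\<lambda>s. h (s, z))"
      by (rule continuous_on_compose2[OF h]) (use t0 in \<open>auto intro!: continuous_intros\<close>)
    then have c: "continuous_on (closure {a..<t0}) (\<lambda>s. h (s, z))" unfolding cl .
    have "t0 \<in> closure {a..<t0}" unfolding cl using at0 by simp
    then have "h (t0, z) \<le> 0"
    proof (rule continuous_le_on_closure[OF c])
      show "h (s, z) \<le> 0" if "s \<in> {a..<t0}" for s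
        using below[of s z] that by (simp add: h_def)
    qed
    then show ?thesis by (simp add: h_def)
  qed
  have eq: "e t0 x0 = \<rho> t0" using le[of x0] t0(3) by simp
  obtain d where d: "((\<lambda>s. e s x0) has_real_derivative d) (at t0)" "d < \<rho>' t0"
    using evo[OF at0 t0(2) eq] le eq by auto
  \<comment> \<open>A negative derivative of the difference at first contact forces \<open>e\<close>
    above the barrier slightly earlier, where it is known to lie below.\<close>
  have "((\<lambda>s. e s x0 - \<rho> s) has_real_derivative d - \<rho>' t0) (at t0)"
    by (intro DERIV_diff d \<rho>(2) at0 t0)
  from DERIV_neg_dec_left[OF this]
  obtain r where r: "r > 0" "\<And>k. 0 < k \<Longrightarrow> k < r \<Longrightarrow> e t0 x0 - \<rho> t0 < e (t0 - k) x0 - \<rho> (t0 - k)"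
    using d(2) by auto
  define k where "k = min r (t0 - a) / 2"
  have "0 < k" "k < r" "k < t0 - a" unfolding k_def using r(1) at0 by auto
  then show False using r(2)[of k] below[of "t0 - k" x0] eq by simp
qed

section \<open>The energy density along the flow\<close>

lemma continuous_on_Pair_slice:
  assumes "continuous_on (I \<times> UNIV) (\<lambda>(t, x). h t x)" "t \<in> I"
  shows "continuous_on UNIV (h t)"
proof -
  have "continuous_on UNIV (\<lambda>x. (t, x))" by (intro continuous_intros)
  from continuous_on_compose2[OF assms(1) this] assms(2) show ?thesis by auto
qed

locale rh_flow =
  fixes M :: "('a::{t2_space,second_countable_topology}, 'm::finite) chart set"
    and N :: "('b::{t2_space,second_countable_topology}, 'n::finite) chart set"
    and \<gamma> :: "('b, 'n) metric"
    and g :: "real \<Rightarrow> ('a, 'm) metric"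
    and \<phi> :: "real \<Rightarrow> 'a \<Rightarrow> 'b"
    and \<alpha> :: "real \<Rightarrow> real"
    and T :: ereal
  assumes closed_M: "closed_manifold M" and closed_N: "closed_manifold N"
    and metric_\<gamma>: "riemannian_metric N \<gamma>"
    and T_pos: "0 < T"
    and flow: "RH_flow M N \<gamma> \<alpha> T g \<phi>"
    and \<alpha>_nonneg: "\<And>t. t \<in> time_interval T \<Longrightarrow> 0 \<le> \<alpha> t"
begin

abbreviation "I \<equiv> time_interval T"

definition e :: "real \<Rightarrow> 'a \<Rightarrow> real" where
  "e t x = energy_density M (g t) N \<gamma> (\<phi> t) x"

abbreviation rep :: "('a, 'm) chart \<Rightarrow> ('b, 'n) chart \<Rightarrow> real \<Rightarrow> real^'m \<Rightarrow> real^'n" where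
  "rep c d t \<equiv> local_rep c d (\<phi> t)"

text \<open>Need not be open, because \<open>I\<close> contains 0; only its slices at fixed time are
  open in space.\<close>

definition S :: "('a, 'm) chart \<Rightarrow> ('b, 'n) chart \<Rightarrow> (real \<times> (real^'m)) set" where
  "S c d = {(t, y). t \<in> I \<and> y \<in> img_chart c \<and> \<phi> t (inv_coord c y) \<in> dom_chart d}"

lemma atlas_M: "smooth_atlas M" and atlas_N: "smooth_atlas N"
  using closed_M closed_N unfolding closed_manifold_def by auto

lemma compact_M: "compact (UNIV :: 'a set)"
  using closed_M unfolding closed_manifold_def by auto

lemma chart_M: "c \<in> M \<Longrightarrow> is_chart c" and chart_N: "d \<in> N \<Longrightarrow> is_chart d"
  using atlas_M atlas_N unfolding smooth_atlas_def by auto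

lemma metric_g: "t \<in> I \<Longrightarrow> riemannian_metric M (g t)"
  using flow unfolding RH_flow_def smooth_metric_family_def by blast

lemma metric_M: "t \<in> I \<Longrightarrow> c \<in> M \<Longrightarrow> coord_metric (img_chart c) (g t c)"
  by (rule riemannian_metric_coord_metric[OF atlas_M metric_g])

lemma metric_N: "d \<in> N \<Longrightarrow> coord_metric (img_chart d) (\<gamma> d)"
  by (rule riemannian_metric_coord_metric[OF atlas_N metric_\<gamma>])

lemma continuous_\<phi>: "continuous_on (I \<times> UNIV) (\<lambda>(t, p). \<phi> t p)"
  using flow unfolding RH_flow_def smooth_map_family_def by blast

lemma continuous_\<phi>_at: "t \<in> I \<Longrightarrow> continuous_on UNIV (\<phi> t)"
  by (rule continuous_on_Pair_slice[OF continuous_\<phi>])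

lemma smooth_rep: "c \<in> M \<Longrightarrow> d \<in> N \<Longrightarrow> smooth_on (S c d) (\<lambda>(t, y). rep c d t y)"
  using flow unfolding RH_flow_def smooth_map_family_def S_def by blast

lemma open_S_slice:
  assumes "c \<in> M" "d \<in> N"
  shows "open {y. (t, y) \<in> S c d}"
proof (cases "t \<in> I")
  case True
  have "{y. (t, y) \<in> S c d} = {y \<in> img_chart c. \<phi> t (inv_coord c y) \<in> dom_chart d}"
    using True unfolding S_def by auto
  then show ?thesis
    using local_rep_domain_open[OF chart_M[OF assms(1)] chart_N[OF assms(2)] continuous_\<phi>_at[OF True]] by simp
qed (simp add: S_def)

lemma smooth_rep_slice: "c \<in> M \<Longrightarrow> d \<in> N \<Longrightarrow> smooth_in {y. (t, y) \<in> S c d} (rep c d t)"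
  by (rule smooth_on_slice[OF smooth_rep open_S_slice])

lemma rep_in_image:
  assumes "d \<in> N" "(t, y) \<in> S c d"
  shows "rep c d t y \<in> img_chart d"
  using is_chartD(5)[OF chart_N[OF assms(1)]] assms(2) unfolding S_def local_rep_def by simp

lemma coord_map_rep:
  assumes "t \<in> I" "c \<in> M" "d \<in> N"
  shows "coord_map {y. (t, y) \<in> S c d} (g t c) (img_chart d) (\<gamma> d) (rep c d t)"
proof -
  interpret m: coord_metric "img_chart c" "g t c" by (rule metric_M[OF assms(1,2)])
  interpret n: coord_metric "img_chart d" "\<gamma> d" by (rule metric_N[OF assms(3)])
  have sub: "{y. (t, y) \<in> S c d} \<subseteq> img_chart c" unfolding S_def by auto
  show ?thesis
  proof
    show "smooth_in {y. (t, y) \<in> S c d} (g t c)"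
      by (rule smooth_in_subset[OF m.smooth sub open_S_slice[OF assms(2,3)]])
    show "posdef (g t c y)" if "y \<in> {y. (t, y) \<in> S c d}" for y
      using m.pos sub that by blast
    show "smooth_in {y. (t, y) \<in> S c d} (rep c d t)" by (rule smooth_rep_slice[OF assms(2,3)])
    show "rep c d t y \<in> img_chart d" if "y \<in> {y. (t, y) \<in> S c d}" for y
      using rep_in_image[OF assms(3)] that by blast
  qed
qed

lemma mem_S:
  assumes "t \<in> I" "c \<in> M" "p \<in> dom_chart c" "\<phi> t p \<in> dom_chart d"
  shows "(t, coord c p) \<in> S c d"
  using assms is_chartD(5,6)[OF chart_M[OF assms(2)] assms(3)] unfolding S_def by simp

text \<open>\<open>energy_density\<close> selects charts anew at every point; fixing one pair of
  charts near a point is what makes \<open>e\<close> accessible to calculus.\<close>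

lemma e_in_charts:
  assumes t: "t \<in> I" and c: "c \<in> M" "p \<in> dom_chart c" and d: "d \<in> N" "\<phi> t p \<in> dom_chart d"
  shows "e t p = mtrace (g t c (coord c p)) (pullback_ip (\<gamma> d) (rep c d t) (coord c p))"
proof -
  have diff: "rep c d t differentiable at (coord c p)"
    using smooth_in_differentiable[OF smooth_rep_slice[OF c(1) d(1)]] mem_S[OF t c d(2)] by blast
  have "e t p = energy_density_in (g t) \<gamma> c d (\<phi> t) p"
    unfolding e_def energy_density_def
    by (rule energy_density_in_change_charts[OF atlas_M metric_g[OF t] atlas_N metric_\<gamma> continuous_\<phi>_at[OF t]
          chart_at_mem[OF atlas_M] c chart_at_mem[OF atlas_N] d diff])
  also have "\<dots> = mtrace (g t c (coord c p)) (pullback_ip (\<gamma> d) (rep c d t) (coord c p))"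
    unfolding energy_density_in_def by (rule energy_mtrace[OF diff])
  finally show ?thesis .
qed

lemma e_nonneg:
  assumes t: "t \<in> I"
  shows "0 \<le> e t p"
proof -
  let ?c = "chart_at M p" and ?d = "chart_at N (\<phi> t p)"
  note c = chart_at_mem[OF atlas_M, of p] and d = chart_at_mem[OF atlas_N, of "\<phi> t p"]
  interpret coord_map "{y. (t, y) \<in> S ?c ?d}" "g t ?c" "img_chart ?d" "\<gamma> ?d" "rep ?c ?d t"
    by (rule coord_map_rep[OF t c(1) d(1)])
  have y: "coord ?c p \<in> {y. (t, y) \<in> S ?c ?d}" using mem_S[OF t c d(2)] by simp
  obtain E where E: "orthonormal_frame (g t ?c (coord ?c p)) E"
    using orthonormal_frame_exists[OF M.pos[OF y]] .
  show ?thesis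
    unfolding e_in_charts[OF t c d] mtrace_frame[OF E bilinear_pullback_ip[OF y]]
    unfolding pullback_ip_def by (intro sum_nonneg posdef_ge0 N.pos f_in y)
qed

lemma continuous_e: "continuous_on (I \<times> UNIV) (\<lambda>(t, p). e t p)"
  unfolding continuous_on_eq_continuous_within
proof
  fix w assume "w \<in> I \<times> (UNIV :: 'a set)"
  then obtain t0 p0 where w: "w = (t0, p0)" and t0: "t0 \<in> I" by blast
  define c where "c = chart_at M p0"
  define d where "d = chart_at N (\<phi> t0 p0)"
  have c: "c \<in> M" "p0 \<in> dom_chart c" unfolding c_def using chart_at_mem[OF atlas_M] by auto
  have d: "d \<in> N" "\<phi> t0 p0 \<in> dom_chart d" unfolding d_def using chart_at_mem[OF atlas_N] by auto
  note ch = chart_M[OF c(1)] chart_N[OF d(1)]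
  define W where "W = I \<times> dom_chart c \<inter> (\<lambda>(t, p). \<phi> t p) -` dom_chart d"
  have "continuous_on (I \<times> dom_chart c) (\<lambda>(t, p). \<phi> t p)"
    by (rule continuous_on_subset[OF continuous_\<phi>]) auto
  from continuous_openin_preimage_gen[OF this is_chartD(1)[OF ch(2)]]
  obtain Q where Q: "open Q" "W = I \<times> dom_chart c \<inter> Q" unfolding W_def openin_open by blast
  \<comment> \<open>Makes \<open>W\<close> the trace on \<open>I \<times> UNIV\<close> of an open
    set, so that limits within \<open>W\<close> and within \<open>I \<times> UNIV\<close> coincide
    at \<open>w\<close>.\<close>
  define Q' where "Q' = Q \<inter> UNIV \<times> dom_chart c"
  have Q': "open Q'" "W = I \<times> UNIV \<inter> Q'"
    unfolding Q'_def using Q is_chartD(1)[OF ch(1)] by (auto intro: open_Int open_Times)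
  have wW: "w \<in> W" unfolding W_def w using t0 c d by simp
  let ?G = "\<lambda>z. g (fst z) c (snd z)" and ?f = "\<lambda>z. rep c d (fst z) (snd z)"
  let ?F = "\<lambda>i z. dir_deriv (rep c d (fst z)) (snd z) (axis i 1)"
  have sm: "smooth_on (I \<times> img_chart c) (\<lambda>(t, y). g t c y)"
    using flow c(1) unfolding RH_flow_def smooth_metric_family_def by blast
  have "open {y. (t, y) \<in> I \<times> img_chart c}" for t
    using is_chartD(2)[OF ch(1)] by (cases "t \<in> I") auto
  from continuous_on_slice_derivative(1)[OF sm this]
  have cG: "continuous_on (I \<times> img_chart c) ?G" by (simp add: case_prod_beta)
  have subS: "S c d \<subseteq> I \<times> img_chart c" unfolding S_def by auto
  note cr = continuous_on_slice_derivative[OF smooth_rep[OF c(1) d(1)] open_S_slice[OF c(1) d(1)]]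
  have cf: "continuous_on (S c d) ?f" using cr(1) by (simp add: case_prod_beta)
  have cF: "continuous_on (S c d) (?F i)" for i using cr(2)[of "axis i 1"] by (simp add: case_prod_beta)
  interpret n: coord_metric "img_chart d" "\<gamma> d" by (rule metric_N[OF d(1)])
  have "continuous_on (img_chart d) (\<gamma> d)"
    using smooth_in_isCont[OF n.smooth] by (intro continuous_at_imp_continuous_on) auto
  then have cH: "continuous_on (S c d) (\<lambda>z. \<gamma> d (?f z))"
    by (rule continuous_on_compose2[OF _ cf]) (auto intro!: rep_in_image[OF d(1), of _ _ c])
  have cP: "continuous_on (S c d) (\<lambda>z. matrix_inv (?G z) $ i $ j)" for i j
  proof (rule continuous_on_matrix_inv[OF continuous_on_subset[OF cG subS]])
    show "invertible (?G z)" if "z \<in> S c d" for z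
    proof (rule posdef_invertible)
      show "posdef (?G z)"
        using coord_metric.pos[OF metric_M[OF _ c(1)]] that subS by (cases z) auto
    qed
  qed
  have cd: "continuous_on (S c d) (\<lambda>z. mtrace (?G z) (pullback_ip (\<gamma> d) (rep c d (fst z)) (snd z)))"
    unfolding mtrace_def pullback_ip_def mip_def
    by (intro continuous_intros cP cF cH continuous_on_inner)
      (auto simp: matrix_vector_mult_def intro!: continuous_intros cF cH)
  have "continuous_on W (\<lambda>z. (fst z, coord c (snd z)))"
    by (intro continuous_intros continuous_on_compose2[OF is_chartD(3)[OF ch(1)]]) (auto simp: W_def)
  then have "continuous_on W (\<lambda>z. mtrace (g (fst z) c (coord c (snd z)))
      (pullback_ip (\<gamma> d) (rep c d (fst z)) (coord c (snd z))))"
    using continuous_on_compose2[OF cd] mem_S[OF _ c(1)] unfolding W_def by fastforce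
  then have "continuous_on W (\<lambda>(t, p). e t p)"
    by (rule continuous_on_eq) (auto simp: W_def e_in_charts[OF _ c(1) _ d(1)])
  then have "continuous (at w within W) (\<lambda>(t, p). e t p)"
    using wW unfolding continuous_on_eq_continuous_within by blast
  moreover have "at w within I \<times> UNIV = at w within W"
    by (rule at_within_nhd[of w Q']) (use wW Q' in auto)
  ultimately show "continuous (at w within I \<times> UNIV) (\<lambda>(t, p). e t p)" by simp
qed

section \<open>The differential inequality for the flow and comparison with barriers\<close>

lemma evolution_at_max:
  assumes t: "t \<in> I" "0 < t" and max: "\<And>z. e t z \<le> e t p"
    and K: "0 \<le> K" "sectional_le N \<gamma> K"
  shows "\<exists>\<delta>. ((\<lambda>s. e s p) has_real_derivative \<delta>) (at t)
    \<and> \<delta> \<le> 2 * (K - \<alpha> t / CARD('m)) * (e t p)\<^sup>2"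
proof -
  define c where "c = chart_at M p"
  define d where "d = chart_at N (\<phi> t p)"
  have c: "c \<in> M" "p \<in> dom_chart c" unfolding c_def using chart_at_mem[OF atlas_M] by auto
  have d: "d \<in> N" "\<phi> t p \<in> dom_chart d" unfolding d_def using chart_at_mem[OF atlas_N] by auto
  note ch = chart_M[OF c(1)] chart_N[OF d(1)]
  let ?U = "{y. (t, y) \<in> S c d}" and ?y = "coord c p"
  interpret coord_map ?U "g t c" "img_chart d" "\<gamma> d" "rep c d t"
    by (rule coord_map_rep[OF t(1) c(1) d(1)])
  have y: "?y \<in> ?U" using mem_S[OF t(1) c d(2)] by simp
  have iy: "inv_coord c ?y = p" "?y \<in> img_chart c" using is_chartD(5,6)[OF ch(1) c(2)] by auto
  \<comment> \<open>Removing the initial time leaves an open set, on which the derivatives within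
    \<open>I\<close> given by the flow are two-sided.\<close>
  define I0 where "I0 = {s. 0 < s \<and> ereal s < T}"
  have I0_eq: "I0 = {0<..} \<inter> ereal -` {..<T}" unfolding I0_def by auto
  have "open (ereal -` {..<T})" by (intro open_vimage open_lessThan continuous_on_ereal continuous_on_id)
  then have "open I0" unfolding I0_eq by (intro open_Int open_greaterThan)
  moreover have "I0 \<subseteq> I" unfolding I0_def time_interval_def by auto
  moreover have "t \<in> I0" using t unfolding I0_def time_interval_def by simp
  ultimately have I0: "open I0" "I0 \<subseteq> I" "t \<in> I0" by blast+
  \<comment> \<open>An open neighbourhood in space-time on which the coordinate expression is
    jointly smooth; without openness mixed derivatives could not be exchanged.\<close>
  define W where "W = (I0 \<times> img_chart c) \<inter> (\<lambda>(s, z). \<phi> s (inv_coord c z)) -` dom_chart d"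
  have W: "open W" unfolding W_def
  proof (rule continuous_open_preimage)
    have 1: "continuous_on (I0 \<times> img_chart c) (\<lambda>w. (fst w, inv_coord c (snd w)))"
      by (intro continuous_intros continuous_on_compose2[OF is_chartD(4)[OF ch(1)]]) auto
    have 2: "(\<lambda>w. (fst w, inv_coord c (snd w))) ` (I0 \<times> img_chart c) \<subseteq> I \<times> UNIV"
      using I0(2) by auto
    from continuous_on_compose2[OF continuous_\<phi> 1 2]
    show "continuous_on (I0 \<times> img_chart c) (\<lambda>(s, z). \<phi> s (inv_coord c z))"
      by (simp add: case_prod_beta)
  qed (intro open_Times I0 is_chartD ch)+
  have WS: "W \<subseteq> S c d" unfolding W_def S_def using I0(2) by auto
  have wW: "(t, ?y) \<in> W" unfolding W_def using I0 iy d by simp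
  have WU: "(t, z) \<in> W \<longleftrightarrow> z \<in> ?U" for z
    unfolding W_def S_def using I0 by auto
  have smW: "smooth_in W (\<lambda>(s, y). rep c d s y)"
    by (rule smooth_on_open[OF W smooth_on_subset[OF smooth_rep[OF c(1) d(1)] WS]])
  \<comment> \<open>Times at which the image of \<open>p\<close> still lies in the chart
    \<open>d\<close>, so that \<open>e s p\<close> is computed in the fixed pair \<open>c\<close>,
    \<open>d\<close>.\<close>
  define J where "J = (\<lambda>s. (s, ?y)) -` W"
  have J: "open J" "t \<in> J"
    unfolding J_def using wW by (auto intro!: open_vimage W continuous_intros)
  have JI: "s \<in> I" "\<phi> s p \<in> dom_chart d" if "s \<in> J" for s
    using that I0(2) iy unfolding J_def W_def by auto
  have atI: "at t within I = at t"
    by (rule at_within_interior) (use I0 interior_maximal in blast)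
  have fl: "((\<lambda>s. g s c (coord c q)) has_vector_derivative
           (- 2) *\<^sub>R ricci (g t c) (coord c q)
           + (2 * \<alpha> t) *\<^sub>R grad_tensor (\<gamma> d) (rep c d t) (coord c q)) (at t)"
    "((\<lambda>s. coord d (\<phi> s q)) has_vector_derivative
           tension (g t c) (\<gamma> d) (rep c d t) (coord c q)) (at t)"
    if "q \<in> dom_chart c" "\<phi> t q \<in> dom_chart d" for q
  proof -
    have "\<forall>t\<in>I. \<forall>c\<in>M. \<forall>d\<in>N. \<forall>p\<in>dom_chart c. \<phi> t p \<in> dom_chart d \<longrightarrow>
        ((\<lambda>s. g s c (coord c p)) has_vector_derivative
           (- 2) *\<^sub>R ricci (g t c) (coord c p)
           + (2 * \<alpha> t) *\<^sub>R grad_tensor (\<gamma> d) (local_rep c d (\<phi> t)) (coord c p)) (at t within I) \<and>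
        ((\<lambda>s. coord d (\<phi> s p)) has_vector_derivative
           tension (g t c) (\<gamma> d) (local_rep c d (\<phi> t)) (coord c p)) (at t within I)"
      using flow unfolding RH_flow_def by (elim conjE)
    from this[rule_format, OF t(1) c(1) d(1) that] show
      "((\<lambda>s. g s c (coord c q)) has_vector_derivative
           (- 2) *\<^sub>R ricci (g t c) (coord c q)
           + (2 * \<alpha> t) *\<^sub>R grad_tensor (\<gamma> d) (rep c d t) (coord c q)) (at t)"
      "((\<lambda>s. coord d (\<phi> s q)) has_vector_derivative
           tension (g t c) (\<gamma> d) (rep c d t) (coord c q)) (at t)"
      unfolding atI by auto
  qed
  have rep_deriv: "((\<lambda>s. rep c d s z) has_vector_derivative tension (g t c) (\<gamma> d) (rep c d t) z) (at t)"
    if "(t, z) \<in> W" for z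
  proof -
    have z: "z \<in> img_chart c" "\<phi> t (inv_coord c z) \<in> dom_chart d" using that unfolding W_def by auto
    show ?thesis
      using fl(2)[OF is_chartD(7)[OF ch(1) z(1)] z(2)] is_chartD(8)[OF ch(1) z(1)]
      unfolding local_rep_def o_def by simp
  qed
  have ez: "e t (inv_coord c z) = edens z" if "z \<in> ?U" for z
  proof -
    have z: "z \<in> img_chart c" "\<phi> t (inv_coord c z) \<in> dom_chart d" using that unfolding S_def by auto
    show ?thesis
      using e_in_charts[OF t(1) c(1) is_chartD(7)[OF ch(1) z(1)] d(1) z(2)] is_chartD(8)[OF ch(1) z(1)]
      by simp
  qed
  have "\<exists>\<delta>. ((\<lambda>s. mtrace (g s c ?y) (\<lambda>v w. mip (\<gamma> d (rep c d s ?y)) (dir_deriv (rep c d s) ?y v)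
      (dir_deriv (rep c d s) ?y w))) has_real_derivative \<delta>) (at t)
    \<and> \<delta> \<le> 2 * (K - \<alpha> t / CARD('m)) * (edens ?y)\<^sup>2"
  proof (rule evolution_inequality_at_max[OF y _ K(1) _ \<alpha>_nonneg[OF t(1)] J _ refl fl(1)[OF c(2) d(2)] refl
        rep_deriv[OF wW] refl mixed_time_derivative[OF smW wW rep_deriv]])
    show "edens z \<le> edens ?y" if "z \<in> ?U" for z
      unfolding ez[OF that, symmetric] ez[OF y, symmetric] iy(1) by (rule max)
    show "sectional (\<gamma> d) (rep c d t ?y) v w \<le> K" if "v \<noteq> w" "independent {v, w}" for v w
      using K(2) d(1) f_in[OF y] that unfolding sectional_le_def by blast
    show "posdef (g s c ?y)" if "s \<in> J" for s
      by (rule coord_metric.pos[OF metric_M[OF JI(1)[OF that] c(1)] iy(2)])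
  qed
  then obtain \<delta> where \<delta>: "((\<lambda>s. mtrace (g s c ?y) (pullback_ip (\<gamma> d) (rep c d s) ?y)) has_real_derivative \<delta>) (at t)"
    "\<delta> \<le> 2 * (K - \<alpha> t / CARD('m)) * (edens ?y)\<^sup>2"
    unfolding pullback_ip_def[abs_def] by blast
  have "((\<lambda>s. e s p) has_real_derivative \<delta>) (at t)"
    by (rule has_field_derivative_transform_within_open[OF \<delta>(1) J])
      (simp add: e_in_charts[OF JI(1) c d(1) JI(2)])
  moreover have "edens ?y = e t p" using ez[OF y] iy(1) by simp
  ultimately show ?thesis using \<delta>(2) by auto
qed

lemma Icc_subset_I: "0 \<le> a \<Longrightarrow> b \<in> I \<Longrightarrow> {a..b} \<subseteq> I"
  unfolding time_interval_def by (auto intro: le_less_trans[of "ereal _" "ereal b"])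

text \<open>A strict supersolution of \<rho>' = 2 (K - \<alpha>/m) \<rho>^2 stays above the energy
  density. The starting time is free, which admits barriers that are singular at 0.\<close>

lemma energy_below_barrier:
  assumes K: "0 \<le> K" "sectional_le N \<gamma> K"
    and ab: "0 \<le> a" "a \<le> b" "b \<in> I"
    and \<rho>: "\<And>t. a \<le> t \<Longrightarrow> t \<le> b \<Longrightarrow> (\<rho> has_real_derivative \<rho>' t) (at t)"
    and \<rho>': "\<And>t. a < t \<Longrightarrow> t \<le> b \<Longrightarrow> 2 * (K - \<alpha> t / CARD('m)) * (\<rho> t)\<^sup>2 < \<rho>' t"
    and init: "\<And>x. e a x < \<rho> a"
  shows "e b x < \<rho> b"
proof (rule barrier_comparison[where e = e and a = a and b = b and \<rho> = \<rho> and \<rho>' = \<rho>', OF compact_M])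
  show "continuous_on ({a..b} \<times> UNIV) (\<lambda>(t, x). e t x)"
    by (rule continuous_on_subset[OF continuous_e]) (use Icc_subset_I ab in auto)
  show "continuous_on {a..b} \<rho>"
    by (rule DERIV_continuous_on[where D = \<rho>']) (auto intro: has_field_derivative_at_within \<rho>)
  fix t x assume t: "a < t" "t \<le> b" and eq: "e t x = \<rho> t" and max: "\<And>z. e t z \<le> e t x"
  have "t \<in> I" using Icc_subset_I[OF ab(1,3)] t by auto
  from evolution_at_max[OF this _ max K] t ab(1) \<rho>'[OF t]
  show "\<exists>d. ((\<lambda>s. e s x) has_real_derivative d) (at t) \<and> d < \<rho>' t"
    unfolding eq by (auto intro: le_less_trans)
qed (use ab init \<rho> in auto)

section \<open>The three bounds\<close>

abbreviation "E0 \<equiv> SUP y. e 0 y"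

lemma zero_in_I: "0 \<in> I"
  using T_pos by (simp add: time_interval_def zero_ereal_def)

lemma initial_le: "e 0 x \<le> E0"
proof (rule cSUP_upper)
  from continuous_attains_sup[OF compact_M _ continuous_on_Pair_slice[OF continuous_e zero_in_I]] show "bdd_above (range (e 0))"
    unfolding bdd_above_def by auto
qed simp

lemma E0_nonneg: "0 \<le> E0"
  using initial_le e_nonneg[OF zero_in_I] order_trans by blast

text \<open>The constant \<open>E0\<close> is a supersolution, but not a strict one; lifting and
  tilting it by \<eta> gives strictness both at time 0 and in the differential inequality.\<close>

lemma energy_le_initial:
  assumes K: "0 \<le> K" "sectional_le N \<gamma> K" and k: "\<And>t. t \<in> I \<Longrightarrow> K - \<alpha> t / CARD('m) \<le> 0"
    and t: "t \<in> I"
  shows "e t x \<le> E0"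
proof (rule field_le_epsilon)
  fix \<epsilon> :: real assume \<epsilon>: "0 < \<epsilon>"
  have t0: "0 \<le> t" using t unfolding time_interval_def by simp
  \<comment> \<open>Chosen so that the total perturbation at time \<open>t\<close> is exactly
    \<epsilon>.\<close>
  define \<eta> where "\<eta> = \<epsilon> / (1 + t)"
  have \<eta>: "0 < \<eta>" "\<eta> * (1 + t) = \<epsilon>" unfolding \<eta>_def using \<epsilon> t0 by auto
  have "e t x < E0 + \<eta> * (1 + t)"
  proof (rule energy_below_barrier[OF K order_refl t0 t, where \<rho>' = "\<lambda>_. \<eta>"])
    show "((\<lambda>s. E0 + \<eta> * (1 + s)) has_real_derivative \<eta>) (at s)" for s
      by (auto intro!: derivative_eq_intros)
    show "2 * (K - \<alpha> s / CARD('m)) * (E0 + \<eta> * (1 + s))\<^sup>2 < \<eta>" if "0 < s" "s \<le> t" for s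
    proof -
      have "s \<in> I" using Icc_subset_I[OF order_refl t] that by auto
      then have "2 * (K - \<alpha> s / CARD('m)) \<le> 0" using k[of s] by simp
      from mult_nonpos_nonneg[OF this zero_le_power2]
      have "2 * (K - \<alpha> s / CARD('m)) * (E0 + \<eta> * (1 + s))\<^sup>2 \<le> 0" .
      then show ?thesis using \<eta> by linarith
    qed
    show "e 0 x < E0 + \<eta> * (1 + 0)" for x using initial_le[of x] \<eta> by simp
  qed
  then show "e t x \<le> E0 + \<epsilon>" using \<eta> by simp
qed

text \<open>The function m / (2 a s) of s solves \<rho>' = -2 (a/m) \<rho>^2 and is infinite at s =
  0, hence the bound is independent of the initial energy.\<close>

lemma energy_le_decay:
  assumes sec: "sectional_le N \<gamma> 0" and \<alpha>0: "0 < \<alpha>\<^sub>0" "\<And>t. t \<in> I \<Longrightarrow> \<alpha>\<^sub>0 \<le> \<alpha> t"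
    and t: "t \<in> I" "0 < t"
  shows "e t x \<le> CARD('m) / (2 * \<alpha>\<^sub>0 * t)"
proof (rule field_le_mult_one_interval)
  fix z :: real assume z: "0 < z" "z < 1"
  let ?m = "real CARD('m)"
  \<comment> \<open>A rate slightly below \<open>\<alpha>\<^sub>0\<close> makes the barrier a strict
    supersolution; letting \<open>z\<close> tend to 1 recovers
    \<open>\<alpha>\<^sub>0\<close>.\<close>
  define \<beta> where "\<beta> = z * \<alpha>\<^sub>0"
  have \<beta>: "0 < \<beta>" "\<beta> < \<alpha>\<^sub>0" unfolding \<beta>_def using z \<alpha>0 by auto
  have m: "0 < ?m" by simp
  \<comment> \<open>The singular barrier is started at a positive time, early enough that it is at
    least \<open>E0 + 1\<close> there and thus strictly above the energy density, which is bounded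
    by \<open>E0\<close>.\<close>
  define a where "a = min t (?m / (2 * \<beta> * (E0 + 1)))"
  have q: "0 < 2 * \<beta> * (E0 + 1)" using \<beta> E0_nonneg by simp
  have a: "0 < a" "a \<le> t" unfolding a_def using t q m by auto
  have "a \<le> ?m / (2 * \<beta> * (E0 + 1))" unfolding a_def by simp
  then have "a * (2 * \<beta> * (E0 + 1)) \<le> ?m" using q by (simp add: pos_le_divide_eq)
  then have start: "E0 + 1 \<le> ?m / (2 * \<beta> * a)" using a \<beta> by (simp add: pos_le_divide_eq mult_ac)
  have aI: "a \<in> I" using Icc_subset_I[OF order_refl t(1)] a by auto
  have "e t x < ?m / (2 * \<beta> * t)"
  proof (rule energy_below_barrier[OF order_refl sec _ a(2) t(1), where \<rho>' = "\<lambda>s. - ?m / (2 * \<beta> * s\<^sup>2)"])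
    show "((\<lambda>s. ?m / (2 * \<beta> * s)) has_real_derivative - ?m / (2 * \<beta> * s\<^sup>2)) (at s)" if "a \<le> s" "s \<le> t" for s
      using a \<beta> that by (auto intro!: derivative_eq_intros simp: field_simps power2_eq_square)
    show "2 * (0 - \<alpha> s / ?m) * (?m / (2 * \<beta> * s))\<^sup>2 < - ?m / (2 * \<beta> * s\<^sup>2)" if "a < s" "s \<le> t" for s
    proof -
      have s: "0 < s" using a that by simp
      have "s \<in> I" using Icc_subset_I[OF order_refl t(1)] that s by auto
      then have "\<beta> < \<alpha> s" using \<alpha>0(2)[of s] \<beta> by simp
      then have "\<beta> * (?m / (2 * \<beta>\<^sup>2 * s\<^sup>2)) < \<alpha> s * (?m / (2 * \<beta>\<^sup>2 * s\<^sup>2))"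
        using s \<beta> m by (intro mult_strict_right_mono) auto
      moreover have "2 * (0 - \<alpha> s / ?m) * (?m / (2 * \<beta> * s))\<^sup>2 = - (\<alpha> s * (?m / (2 * \<beta>\<^sup>2 * s\<^sup>2)))"
        using s \<beta> m by (simp add: field_simps power2_eq_square)
      moreover have "\<beta> * (?m / (2 * \<beta>\<^sup>2 * s\<^sup>2)) = ?m / (2 * \<beta> * s\<^sup>2)"
        using s \<beta> by (simp add: field_simps power2_eq_square)
      ultimately show ?thesis by simp
    qed
    show "e a x < ?m / (2 * \<beta> * a)" for x
    proof -
      have "e a x \<le> E0"
      proof (rule energy_le_initial[OF order_refl sec _ aI])
        show "0 - \<alpha> s / ?m \<le> 0" if "s \<in> I" for s using \<alpha>_nonneg[OF that] by simp
      qed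
      then show ?thesis using start by linarith
    qed
  qed (use a in auto)
  then have "z * e t x \<le> z * (?m / (2 * \<beta> * t))"
    using z by (intro mult_left_mono) (auto simp: less_imp_le)
  also have "\<dots> = ?m / (2 * \<alpha>\<^sub>0 * t)" unfolding \<beta>_def using z by simp
  finally show "z * e t x \<le> ?m / (2 * \<alpha>\<^sub>0 * t)" .
qed

text \<open>The barrier A / (1 - q s) with A = E0 + \<epsilon> and q = 2 (K + \<epsilon>) A solves
  \<rho>' = 2 (K + \<epsilon>) \<rho>^2. The smallness condition says q t < 1/2, which keeps it at
  most 2 A.\<close>

lemma energy_le_double:
  assumes K: "0 \<le> K" "sectional_le N \<gamma> K" and t: "t \<in> I" and small: "4 * K * E0 * t < 1"
  shows "e t x \<le> 2 * E0"
proof -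
  have t0: "0 \<le> t" using t unfolding time_interval_def by simp
  have bound: "e t x \<le> 2 * (E0 + \<epsilon>)" if \<epsilon>: "0 < \<epsilon>" "4 * (K + \<epsilon>) * (E0 + \<epsilon>) * t < 1" for \<epsilon>
  proof -
    let ?A = "E0 + \<epsilon>" and ?q = "2 * (K + \<epsilon>) * (E0 + \<epsilon>)"
    have A: "0 < ?A" "0 < ?q" using \<epsilon> E0_nonneg K by auto
    have half: "1/2 < 1 - ?q * s" if "s \<le> t" for s
    proof -
      have "?q * s \<le> ?q * t" using A that by (intro mult_left_mono) auto
      moreover have "4 * (K + \<epsilon>) * (E0 + \<epsilon>) * t = 2 * (?q * t)" by simp
      ultimately show ?thesis using \<epsilon>(2) by linarith
    qed
    have double: "?A / r \<le> 2 * ?A" if "1/2 < r" for r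
    proof -
      have "?A * 1 \<le> ?A * (2 * r)" using A that by (intro mult_left_mono) auto
      also have "\<dots> = 2 * ?A * r" by (simp only: mult_ac)
      finally have "?A \<le> 2 * ?A * r" by (simp only: mult_1_right)
      then show ?thesis using that by (simp add: pos_divide_le_eq)
    qed
    have "e t x < ?A / (1 - ?q * t)"
    proof (rule energy_below_barrier[OF K order_refl t0 t, where \<rho>' = "\<lambda>s. ?A * ?q / (1 - ?q * s)\<^sup>2"])
      show "((\<lambda>s. ?A / (1 - ?q * s)) has_real_derivative ?A * ?q / (1 - ?q * s)\<^sup>2) (at s)" if "0 \<le> s" "s \<le> t" for s
        using half[OF that(2)] by (auto intro!: derivative_eq_intros simp: power2_eq_square)
      show "2 * (K - \<alpha> s / CARD('m)) * (?A / (1 - ?q * s))\<^sup>2 < ?A * ?q / (1 - ?q * s)\<^sup>2" if "0 < s" "s \<le> t" for s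
      proof -
        have pos: "0 < (?A / (1 - ?q * s))\<^sup>2" using half[OF that(2)] A by simp
        have "s \<in> I" using Icc_subset_I[OF order_refl t] that by auto
        then have "0 \<le> \<alpha> s" by (rule \<alpha>_nonneg)
        then have "- (\<alpha> s / CARD('m)) \<le> 0" by simp
        from le_less_trans[OF this \<epsilon>(1)]
        have "2 * (K - \<alpha> s / CARD('m)) < 2 * (K + \<epsilon>)" by simp
        then have "2 * (K - \<alpha> s / CARD('m)) * (?A / (1 - ?q * s))\<^sup>2 < 2 * (K + \<epsilon>) * (?A / (1 - ?q * s))\<^sup>2"
          using pos by (rule mult_strict_right_mono)
        also have "\<dots> = ?A * ?q / (1 - ?q * s)\<^sup>2" by (simp add: power_divide power2_eq_square mult_ac)
        finally show ?thesis .
      qed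
      show "e 0 x < ?A / (1 - ?q * 0)" for x using initial_le[of x] \<epsilon> by simp
    qed
    also have "?A / (1 - ?q * t) \<le> 2 * ?A"
      using double[OF half[OF order_refl]] .
    finally show ?thesis by simp
  qed
  \<comment> \<open>The smallness condition is strict, so it persists for all small \<epsilon>, and
    \<epsilon> can tend to 0 in the bound.\<close>
  have "((\<lambda>\<epsilon>. 4 * (K + \<epsilon>) * (E0 + \<epsilon>) * t) \<longlongrightarrow> 4 * (K + 0) * (E0 + 0) * t) (at_right 0)"
    by (intro tendsto_intros)
  then have "\<forall>\<^sub>F \<epsilon> in at_right 0. 4 * (K + \<epsilon>) * (E0 + \<epsilon>) * t < 1"
    by (rule order_tendstoD(2)) (use small in simp)
  moreover have "\<forall>\<^sub>F \<epsilon> in at_right 0. (0::real) < \<epsilon>" by (simp add: eventually_at_right_less)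
  ultimately have ev: "\<forall>\<^sub>F \<epsilon> in at_right 0. e t x \<le> 2 * (E0 + \<epsilon>)"
    by eventually_elim (rule bound)
  have "((\<lambda>\<epsilon>. 2 * (E0 + \<epsilon>)) \<longlongrightarrow> 2 * (E0 + 0)) (at_right 0)" by (intro tendsto_intros)
  from tendsto_lowerbound[OF this ev] show ?thesis by simp
qed

end

lemma sectional_le_mono: "sectional_le A g K \<Longrightarrow> K \<le> K' \<Longrightarrow> sectional_le A g K'"
  unfolding sectional_le_def using order_trans by meson

theorem proposition5p5:
  fixes M :: "('a::{t2_space,second_countable_topology}, 'm::finite) chart set"
    and N :: "('b::{t2_space,second_countable_topology}, 'n::finite) chart set"
    and \<gamma> :: "('b, 'n) metric"
    and g :: "real \<Rightarrow> ('a, 'm) metric"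
    and \<phi> :: "real \<Rightarrow> 'a \<Rightarrow> 'b"
    and \<alpha> :: "real \<Rightarrow> real"
    and T :: ereal
    and c0 :: real
  defines "e \<equiv> \<lambda>t x. energy_density M (g t) N \<gamma> (\<phi> t) x"
  defines "E0 \<equiv> SUP y. e 0 y"
  assumes "closed_manifold M"
    and "closed_manifold N"
    and "riemannian_metric N \<gamma>"
    and "0 < T"
    and "RH_flow M N \<gamma> \<alpha> T g \<phi>"
    and "antimono_on (time_interval T) \<alpha>"
    and "\<forall>t\<in>time_interval T. 0 \<le> \<alpha> t"
    and "sectional_le N \<gamma> c0"
  shows "(sectional_le N \<gamma> 0 \<or> (\<forall>t\<in>time_interval T. c0 - \<alpha> t / real CARD('m) \<le> 0)
            \<longrightarrow> (\<forall>t\<in>time_interval T. \<forall>x. e t x \<le> E0))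
       \<and> (\<forall>\<alpha>\<^sub>0 > 0. sectional_le N \<gamma> 0 \<and> (\<forall>t\<in>time_interval T. \<alpha>\<^sub>0 \<le> \<alpha> t)
            \<longrightarrow> (\<forall>t\<in>time_interval T. 0 < t \<longrightarrow> (\<forall>x. e t x \<le> real CARD('m) / (2 * \<alpha>\<^sub>0 * t))))
       \<and> (\<forall>t\<in>time_interval (if c0 * E0 \<le> 0 then T else min T (ereal (inverse (4 * c0 * E0)))).
            \<forall>x. e t x \<le> 2 * E0)"
proof -
  interpret flow: rh_flow M N \<gamma> g \<phi> \<alpha> T
    by unfold_locales (use assms in auto)
  have e: "e = flow.e" unfolding e_def flow.e_def[abs_def] ..
  have E0: "E0 = flow.E0" unfolding E0_def e ..
  have nonpos: "flow.e t x \<le> flow.E0" if "sectional_le N \<gamma> 0" "t \<in> time_interval T" for t x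
  proof (rule flow.energy_le_initial[OF order_refl that(1) _ that(2)])
    show "0 - \<alpha> s / real CARD('m) \<le> 0" if "s \<in> time_interval T" for s
      using flow.\<alpha>_nonneg[OF that] by simp
  qed
  have i: "flow.e t x \<le> flow.E0" if h: "sectional_le N \<gamma> 0 \<or> (\<forall>t\<in>time_interval T. c0 - \<alpha> t / real CARD('m) \<le> 0)"
    and t: "t \<in> time_interval T" for t x
  proof (cases "sectional_le N \<gamma> 0")
    case False
    \<comment> \<open>A negative \<open>c0\<close> would force non-positive curvature; so in this
      case \<open>c0\<close> itself is an admissible non-negative bound \<open>K\<close>.\<close>
    then have "0 \<le> c0" using sectional_le_mono[OF \<open>sectional_le N \<gamma> c0\<close>, of 0] by linarith
    then show ?thesis
      using False h by (intro flow.energy_le_initial[OF _ \<open>sectional_le N \<gamma> c0\<close> _ t]) auto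
  qed (rule nonpos[OF _ t])
  have iii: "flow.e t x \<le> 2 * flow.E0"
    if t: "t \<in> time_interval (if c0 * flow.E0 \<le> 0 then T else min T (ereal (inverse (4 * c0 * flow.E0))))" for t x
  proof -
    have tI: "t \<in> time_interval T" "0 \<le> t" using t unfolding time_interval_def by (auto split: if_splits)
    show ?thesis
    proof (cases "0 \<le> c0")
      case True
      have "4 * c0 * flow.E0 * t < 1"
      proof (cases "c0 * flow.E0 \<le> 0")
        case True
        \<comment> \<open>When the time is limited by \<open>T\<close> alone, the smallness
          condition holds at every time.\<close>
        from mult_nonpos_nonneg[OF this tI(2)] have "c0 * flow.E0 * t \<le> 0" .
        then show ?thesis by simp
      next
        case False
        then have "t < inverse (4 * c0 * flow.E0)" using t unfolding time_interval_def by simp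
        then show ?thesis using False by (simp add: inverse_eq_divide pos_less_divide_eq mult_ac)
      qed
      then show ?thesis by (rule flow.energy_le_double[OF True \<open>sectional_le N \<gamma> c0\<close> tI(1)])
    next
      case False
      \<comment> \<open>A negative bound implies the bound 0, and then the estimate by
        \<open>E0\<close> is stronger than the one by \<open>2 * E0\<close> because
        \<open>E0\<close> is non-negative.\<close>
      then have "sectional_le N \<gamma> 0" using sectional_le_mono[OF \<open>sectional_le N \<gamma> c0\<close>, of 0] by simp
      from nonpos[OF this tI(1), of x] show ?thesis using flow.E0_nonneg by linarith
    qed
  qed
  show ?thesis
    unfolding E0 unfolding e
  proof (intro conjI impI allI ballI)
    show "flow.e t x \<le> real CARD('m) / (2 * \<alpha>\<^sub>0 * t)"
      if "0 < \<alpha>\<^sub>0" "sectional_le N \<gamma> 0 \<and> (\<forall>t\<in>time_interval T. \<alpha>\<^sub>0 \<le> \<alpha> t)"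
        "t \<in> time_interval T" "0 < t" for \<alpha>\<^sub>0 t x
      using that by (intro flow.energy_le_decay) auto
  qed (use i iii in auto)
qed

end
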